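(* If the mesh size $h$ is sufficiently small, then the $C^1$ Petrov-Galerkin method $$\text{find } u_h\in V_h^0 \text{ such that } a(u_h,v_h)=(f,v_h)\quad\forall v_h\in W_h$$ has one and only one solution.
   Context: $\Omega=(a,b)\times(c,d)$; $\alpha>0$, $\beta=(\beta_1,\beta_2)\in\mathbb R^2$, $\gamma\ge 0$ are constants, $f$ is a given real-valued function on $\bar\Omega$ (for which the integrals $(f,v_h)$ make sense). The method discretizes $-\nabla\cdot(\alpha\nabla u)+\beta\cdot\nabla u+\gamma u=f$ in $\Omega$, $u=0$ on $\partial\Omega$. Given $a=x_0<\dots<x_M=b$ and $c=y_0<\dots<y_N=d$, $\mathcal T_h$ is the set of rectangles $\tau_{i,j}=[x_{i-1},x_i]\times[y_{j-1},y_j]$, $1\le i\le M$, $1\le j\le N$; $h$ is the maximal and $h_{\min}$ the minimal edge length; the meshes are quasi-uniform: $h\le C_q h_{\min}$ with a fixed constant $C_q$. $k\ge 3$ is a fixed integer, $\mathbb P_r$ denotes polynomials of degree at most $r$ in one variable and $\mathbb Q_r=\mathbb P_r(x)\otimes\mathbb P_r(y)$. $V_h=\{v\in C^1(\Omega): v|_\tau\in\mathbb Q_k\ \forall\tau\in\mathcal T_h\}$, $V_h^0=\{v\in V_h: v|_{\partial\Omega}=0\}$, $W_h=\{v\in L^2(\Omega): v|_\tau\in\mathbb Q_{k-2}\ \forall\tau\in\mathcal T_h\}$. $(w,v)=\sum_{\tau}\int_\tau wv\,dx\,dy$ and $a(w,v)=(-\nabla\cdot(\alpha\nabla w)+\beta\cdot\nabla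 w+\gamma w,\,v)$, second derivatives being taken elementwise. "Sufficiently small" means $h\le h_0$ for some $h_0>0$ not depending on the particular mesh of the quasi-uniform family. *)

theory Defs
  imports "HOL-Analysis.Analysis"
begin

type_synonym plane = "real \<times> real"

definition Omega :: "real \<Rightarrow> real \<Rightarrow> real \<Rightarrow> real \<Rightarrow> plane set" where
  "Omega a b c d = {a<..<b} \<times> {c<..<d}"

definition grid :: "real \<Rightarrow> real \<Rightarrow> nat \<Rightarrow> (nat \<Rightarrow> real) \<Rightarrow> bool" where
  "grid a b M x \<longleftrightarrow> x 0 = a \<and> x M = b \<and> (\<forall>i<M. x i < x (Suc i))"

definition elem :: "(nat \<Rightarrow> real) \<Rightarrow> (nat \<Rightarrow> real) \<Rightarrow> nat \<Rightarrow> nat \<Rightarrow> plane set" where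
  "elem x y i j = {x (i - 1)..x i} \<times> {y (j - 1)..y j}"

definition T_h :: "nat \<Rightarrow> (nat \<Rightarrow> real) \<Rightarrow> nat \<Rightarrow> (nat \<Rightarrow> real) \<Rightarrow> plane set set" where
  "T_h M x N y = {elem x y i j | i j. i \<in> {1..M} \<and> j \<in> {1..N}}"

definition edge_lengths :: "nat \<Rightarrow> (nat \<Rightarrow> real) \<Rightarrow> nat \<Rightarrow> (nat \<Rightarrow> real) \<Rightarrow> real set" where
  "edge_lengths M x N y = (\<lambda>i. x i - x (i - 1)) ` {1..M} \<union> (\<lambda>j. y j - y (j - 1)) ` {1..N}"

definition h_max :: "nat \<Rightarrow> (nat \<Rightarrow> real) \<Rightarrow> nat \<Rightarrow> (nat \<Rightarrow> real) \<Rightarrow> real" where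
  "h_max M x N y = Max (edge_lengths M x N y)"

definition h_min :: "nat \<Rightarrow> (nat \<Rightarrow> real) \<Rightarrow> nat \<Rightarrow> (nat \<Rightarrow> real) \<Rightarrow> real" where
  "h_min M x N y = Min (edge_lengths M x N y)"

definition Q :: "nat \<Rightarrow> (plane \<Rightarrow> real) set" where
  "Q r = {p. \<exists>C :: nat \<Rightarrow> nat \<Rightarrow> real.
              \<forall>s t. p (s, t) = (\<Sum>i\<le>r. \<Sum>j\<le>r. C i j * s ^ i * t ^ j)}"

definition dx :: "(plane \<Rightarrow> real) \<Rightarrow> plane \<Rightarrow> real" where
  "dx w z = deriv (\<lambda>s. w (s, snd z)) (fst z)"

definition dy :: "(plane \<Rightarrow> real) \<Rightarrow> plane \<Rightarrow> real" where
  "dy w z = deriv (\<lambda>t. w (fst z, t)) (snd z)"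

definition C1 :: "plane set \<Rightarrow> (plane \<Rightarrow> real) set" where
  "C1 S = {v. (\<forall>z\<in>S. v differentiable (at z)) \<and> continuous_on S (dx v) \<and> continuous_on S (dy v)}"

definition L2 :: "plane set \<Rightarrow> (plane \<Rightarrow> real) set" where
  "L2 S = {v. v \<in> borel_measurable (lebesgue_on S) \<and> integrable (lebesgue_on S) (\<lambda>z. (v z)\<^sup>2)}"

text \<open>The elements of the trial space are functions on the closure of the domain; they are
  represented by total functions that take the value \<^term>\<open>undefined\<close> elsewhere, so that
  equality of functions is equality on the closed domain.\<close>

definition V_h :: "plane set \<Rightarrow> plane set set \<Rightarrow> nat \<Rightarrow> (plane \<Rightarrow> real) set" where
  "V_h S T k = {v \<in> extensional (closure S). v \<in> C1 S \<and> (\<forall>\<tau>\<in>T. \<exists>p\<in>Q k. \<forall>z\<in>\<tau>. v z = p z)}"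

definition V_h0 :: "plane set \<Rightarrow> plane set set \<Rightarrow> nat \<Rightarrow> (plane \<Rightarrow> real) set" where
  "V_h0 S T k = {v \<in> V_h S T k. \<forall>z\<in>frontier S. v z = 0}"

text \<open>Test functions are representatives of elements of \<open>L\<^sup>2\<close>, so the restriction to an element is
  a polynomial up to a null set. Pointwise agreement on the closed elements would force
  continuity across the edges.\<close>

definition W_h :: "plane set \<Rightarrow> plane set set \<Rightarrow> nat \<Rightarrow> (plane \<Rightarrow> real) set" where
  "W_h S T k =
     {v \<in> L2 S. \<forall>\<tau>\<in>T. \<exists>p\<in>Q (k - 2). AE z in lebesgue. z \<in> \<tau> \<longrightarrow> v z = p z}"

definition ip :: "plane set set \<Rightarrow> (plane \<Rightarrow> real) \<Rightarrow> (plane \<Rightarrow> real) \<Rightarrow> real" where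
  "ip T w v = (\<Sum>\<tau>\<in>T. LINT z:\<tau>|lebesgue. w z * v z)"

definition ip_defined :: "plane set set \<Rightarrow> (plane \<Rightarrow> real) \<Rightarrow> (plane \<Rightarrow> real) \<Rightarrow> bool" where
  "ip_defined T w v \<longleftrightarrow> (\<forall>\<tau>\<in>T. set_integrable lebesgue \<tau> (\<lambda>z. w z * v z))"

text \<open>For \<open>w\<close> in the trial space the second derivatives are the elementwise ones in the interior
  of each element. They need not exist on the edges, where \<^const>\<open>deriv\<close> is
  unspecified, but the edges are null sets for the (complete) Lebesgue measure in \<^const>\<open>ip\<close>.\<close>

definition diff_op :: "real \<Rightarrow> plane \<Rightarrow> real \<Rightarrow> (plane \<Rightarrow> real) \<Rightarrow> plane \<Rightarrow> real" where
  "diff_op \<alpha> \<beta> \<gamma> w z =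
     - (dx (\<lambda>z. \<alpha> * dx w z) z + dy (\<lambda>z. \<alpha> * dy w z) z)
     + \<beta> \<bullet> (dx w z, dy w z) + \<gamma> * w z"

definition a_form ::
  "real \<Rightarrow> plane \<Rightarrow> real \<Rightarrow> plane set set \<Rightarrow> (plane \<Rightarrow> real) \<Rightarrow> (plane \<Rightarrow> real) \<Rightarrow> real" where
  "a_form \<alpha> \<beta> \<gamma> T w v = ip T (diff_op \<alpha> \<beta> \<gamma> w) v"

end

theory Submission
  imports Defs
begin

text \<open>Let \<open>u\<close> solve the homogeneous discrete problem and let \<open>L\<close> be the differential operator.
  Testing with \<open>\<partial>\<^sub>x\<^sub>x\<partial>\<^sub>y\<^sub>y u\<close>, which lies in the test space, and integrating by parts on the elements
  (all jump terms vanish because \<open>u\<close> is continuously differentiable) gives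
  \<open>\<parallel>\<nabla>u\<^sub>x\<^sub>y\<parallel> \<le> C \<parallel>u\<^sub>x\<^sub>y\<parallel>\<close> and then \<open>\<parallel>\<nabla>u\<^sub>x\<^sub>y\<parallel> \<le> C \<parallel>u\<^sub>x\<parallel>\<close>. With the weight
  \<open>\<rho> = exp (- (\<beta> \<bullet> z) / \<alpha>)\<close> the operator is in divergence form, so \<open>(L u, \<rho> u)\<close> controls
  \<open>\<parallel>\<nabla>u\<parallel>\<^sup>2\<close>. As \<open>L u\<close> is orthogonal to piecewise constants, \<open>\<rho> u\<close> may be replaced by its
  oscillation on the elements, whence \<open>\<parallel>u\<^sub>x\<parallel>\<^sup>2 \<le> C h \<parallel>\<nabla>u\<^sub>x\<^sub>y\<parallel>\<^sup>2\<close>. For small \<open>h\<close> this forces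
  \<open>u = 0\<close>. Existence follows because integrating piecewise monomials twice in each
  variable embeds the test polynomials into the trial space, so the linear system is square.\<close>

subsection \<open>Integrals over a product grid\<close>

text \<open>Testing with u_xxyy alone does not decide the matter: u_xy need not vanish on the sides
  of the rectangle, so the convection terms do not integrate to zero, and what they leave, a
  multiple of the squared norm of u_xy, need not be absorbed. Hence the second ingredient, which
  gains a factor h. That factor comes from pairing a sup norm with an L1 norm. The oscillation of
  the weighted solution on a cell is at most h times the sup of its gradient, and the sups of u,
  u_x, u_y are controlled by the L1 norm of u_xxy and u_xyy. The reason is elementary: u_y vanishes
  at both ends of a horizontal line, so u_xy has mean zero there and is bounded by the integral of
  |u_xxy| along that line; the other direction is symmetric. The same L1 norm bounds the L1 norm of
  L u, and Cauchy-Schwarz returns to the L2 norm. No inverse estimate enters, so the constants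
  depend only on the rectangle and the coefficients. Piecewise functions are families of
  polynomials, one per cell, each defined on the whole plane; continuity of values and of normal
  derivatives becomes an identity between polynomials along whole lines.\<close>

definition line_sum :: "(nat \<Rightarrow> real) \<Rightarrow> nat \<Rightarrow> (nat \<Rightarrow> real \<Rightarrow> real) \<Rightarrow> real" where
  "line_sum x M f = (\<Sum>i<M. integral {x i..x (Suc i)} (f i))"

text \<open>Each cell carries its own function on the whole plane and integrates it over that cell
  only. An edge is thus seen from both sides without one-sided limits or one-sided
  derivatives.\<close>

definition cell_sum :: "(nat \<Rightarrow> real) \<Rightarrow> nat \<Rightarrow> (nat \<Rightarrow> real) \<Rightarrow> nat \<Rightarrow> (nat \<Rightarrow> nat \<Rightarrow> plane \<Rightarrow> real) \<Rightarrow> real" where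
  "cell_sum x M y N F = (\<Sum>i<M. \<Sum>j<N. integral (cbox (x i, y j) (x (Suc i), y (Suc j))) (F i j))"

lemma grid_less: "grid a b M x \<Longrightarrow> i < M \<Longrightarrow> x i < x (Suc i)"
  by (auto simp: grid_def)

lemma grid_mono:
  assumes "grid a b M x" "i \<le> j" "j \<le> M"
  shows "x i \<le> x j"
  using assms(2,3)
proof (induction j rule: dec_induct)
  case (step n)
  then show ?case using grid_less[OF assms(1), of n] by auto
qed simp

lemma grid_bounds:
  assumes "grid a b M x" "i \<le> M"
  shows "a \<le> x i" "x i \<le> b"
  using grid_mono[OF assms(1), of 0 i] grid_mono[OF assms(1), of i M] assms
  by (auto simp: grid_def)

lemma grid_pos: "grid a b M x \<Longrightarrow> a < b \<Longrightarrow> M > 0"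
  by (cases M) (auto simp: grid_def)

lemma cont_integrable: "continuous_on UNIV f \<Longrightarrow> f integrable_on {u..v::real}" for f :: "real \<Rightarrow> real"
  by (meson continuous_on_subset integrable_continuous_real top_greatest)

lemma line_sum_cmult: "line_sum x M (\<lambda>i s. c * f i s) = c * line_sum x M f"
  unfolding line_sum_def by (simp add: sum_distrib_left)

lemma line_sum_mono:
  assumes "\<And>i. continuous_on UNIV (f i)" "\<And>i. continuous_on UNIV (g i)"
    and "\<And>i s. i < M \<Longrightarrow> s \<in> {x i..x (Suc i)} \<Longrightarrow> f i s \<le> g i s"
  shows "line_sum x M f \<le> line_sum x M g"
  unfolding line_sum_def
  by (intro sum_mono integral_le cont_integrable assms) auto

lemma line_sum_const:
  assumes "grid a b M x"
  shows "line_sum x M (\<lambda>i s. c) = c * (b - a)"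
proof -
  have "line_sum x M (\<lambda>i s. c) = (\<Sum>i<M. c * (x (Suc i) - x i))"
    unfolding line_sum_def using grid_less[OF assms] by (intro sum.cong) (auto simp: less_imp_le)
  also have "\<dots> = c * (x M - x 0)"
    unfolding sum_distrib_left[symmetric] by (simp add: sum_lessThan_telescope)
  finally show ?thesis using assms by (simp add: grid_def)
qed

lemma telescope_junction:
  fixes f :: "nat \<Rightarrow> real \<Rightarrow> real"
  assumes "M > 0" "\<And>i. Suc i < M \<Longrightarrow> f i (x (Suc i)) = f (Suc i) (x (Suc i))"
  shows "(\<Sum>i<M. f i (x (Suc i)) - f i (x i)) = f (M - 1) (x M) - f 0 (x 0)"
  using assms
proof (induction M)
  case (Suc M)
  show ?case
  proof (cases M)
    case (Suc n)
    have "f n (x (Suc n)) = f (Suc n) (x (Suc n))" using Suc.prems Suc by auto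
    then show ?thesis using Suc.IH Suc.prems Suc by simp
  qed auto
qed simp

lemma ftc:
  assumes "u \<le> v" "\<And>s. (f has_real_derivative f' s) (at s)" "continuous_on UNIV f'"
  shows "integral {u..v} f' = f v - f u"
proof -
  have "(f' has_integral (f v - f u)) {u..v}"
    by (rule fundamental_theorem_of_calculus[OF assms(1)])
      (use assms(2) in \<open>auto simp: has_real_derivative_iff_has_vector_derivative[symmetric]
          intro: has_field_derivative_at_within\<close>)
  then show ?thesis by blast
qed

lemma line_sum_deriv:
  assumes g: "grid a b M x" and "M > 0"
    and d: "\<And>i s. (f i has_real_derivative f' i s) (at s)" "\<And>i. continuous_on UNIV (f' i)"
    and jn: "\<And>i. Suc i < M \<Longrightarrow> f i (x (Suc i)) = f (Suc i) (x (Suc i))"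
  shows "line_sum x M f' = f (M - 1) b - f 0 a"
proof -
  have "line_sum x M f' = (\<Sum>i<M. f i (x (Suc i)) - f i (x i))"
    unfolding line_sum_def by (intro sum.cong refl ftc less_imp_le d grid_less[OF g]) auto
  also have "\<dots> = f (M - 1) (x M) - f 0 (x 0)"
    by (rule telescope_junction) fact+
  finally show ?thesis using g by (simp add: grid_def)
qed

lemma abs_diff_le_integral:
  assumes "u \<le> s" "s \<le> v" "\<And>s. (f has_real_derivative f' s) (at s)" "continuous_on UNIV f'"
  shows "\<bar>f s - f u\<bar> \<le> integral {u..v} (\<lambda>s. \<bar>f' s\<bar>)"
proof -
  have c: "continuous_on UNIV (\<lambda>s. \<bar>f' s\<bar>)" using assms(4) by (intro continuous_intros)
  have "\<bar>f s - f u\<bar> = \<bar>integral {u..s} f'\<bar>"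
    using ftc[OF assms(1,3,4)] by simp
  also have "\<dots> \<le> integral {u..s} (\<lambda>s. \<bar>f' s\<bar>)"
    using integral_norm_bound_integral[OF cont_integrable[OF assms(4)] cont_integrable[OF c], of u s]
    by simp
  also have "\<dots> \<le> integral {u..v} (\<lambda>s. \<bar>f' s\<bar>)"
    by (intro integral_subset_le cont_integrable c) (use assms in auto)
  finally show ?thesis .
qed

text \<open>The pieces join continuously, so the increments over successive intervals add up, and
  each is at most the integral of |f'| over its interval. This is the one-dimensional embedding
  behind all sup bounds below.\<close>

lemma variation_bound:
  assumes g: "grid a b M x"
    and d: "\<And>i s. (f i has_real_derivative f' i s) (at s)" "\<And>i. continuous_on UNIV (f' i)"
    and jn: "\<And>i. Suc i < M \<Longrightarrow> f i (x (Suc i)) = f (Suc i) (x (Suc i))"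
    and i: "i < M" "s \<in> {x i..x (Suc i)}"
  shows "\<bar>f i s - f 0 a\<bar> \<le> line_sum x M (\<lambda>i s. \<bar>f' i s\<bar>)"
proof -
  let ?I = "\<lambda>i. integral {x i..x (Suc i)} (\<lambda>s. \<bar>f' i s\<bar>)"
  have x0: "x 0 = a" using g by (simp add: grid_def)
  have nn: "?I i \<ge> 0" for i
    by (rule integral_nonneg) (use d in \<open>auto intro!: cont_integrable continuous_intros\<close>)
  have loc: "\<bar>f i s - f i (x i)\<bar> \<le> ?I i" if "s \<in> {x i..x (Suc i)}" for i s
    by (rule abs_diff_le_integral) (use that d in auto)
  \<comment> \<open>Claimed for all points of the interval, so that the induction step can use it at
    the right end, where the next piece takes over.\<close>
  have "\<forall>s\<in>{x i..x (Suc i)}. \<bar>f i s - f 0 a\<bar> \<le> (\<Sum>i'\<le>i. ?I i')" using i(1)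
  proof (induction i)
    case 0
    then show ?case using loc[of _ 0] x0 by auto
  next
    case (Suc i)
    show ?case
    proof
      fix s assume s: "s \<in> {x (Suc i)..x (Suc (Suc i))}"
      have "\<bar>f i (x (Suc i)) - f 0 a\<bar> \<le> (\<Sum>i'\<le>i. ?I i')"
        using Suc grid_less[OF g, of i] by auto
      moreover have "\<bar>f (Suc i) s - f (Suc i) (x (Suc i))\<bar> \<le> ?I (Suc i)" using loc s by blast
      moreover have "f i (x (Suc i)) = f (Suc i) (x (Suc i))" using jn Suc by blast
      ultimately show "\<bar>f (Suc i) s - f 0 a\<bar> \<le> (\<Sum>i'\<le>Suc i. ?I i')" by simp
    qed
  qed
  then have "\<bar>f i s - f 0 a\<bar> \<le> (\<Sum>i'\<le>i. ?I i')" using i by blast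
  also have "\<dots> \<le> (\<Sum>i'<M. ?I i')" using i nn by (intro sum_mono2) auto
  finally show ?thesis by (simp add: line_sum_def)
qed

text \<open>Any two values differ by at most twice the variation, as both are within one variation
  of \<open>f 0 a\<close>. Comparing \<open>f\<close> with the constants
  \<open>f i s - 2 * ?V\<close> and \<open>f i s + 2 * ?V\<close> under the vanishing integral then
  forces \<open>f i s\<close> into the stated range.\<close>

lemma mean_zero_bound:
  assumes g: "grid a b M x" and "a < b"
    and d: "\<And>i s. (f i has_real_derivative f' i s) (at s)" "\<And>i. continuous_on UNIV (f' i)"
    and jn: "\<And>i. Suc i < M \<Longrightarrow> f i (x (Suc i)) = f (Suc i) (x (Suc i))"
    and mean: "line_sum x M f = 0"
    and i: "i < M" "s \<in> {x i..x (Suc i)}"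
  shows "\<bar>f i s\<bar> \<le> 2 * line_sum x M (\<lambda>i s. \<bar>f' i s\<bar>)"
proof -
  let ?V = "line_sum x M (\<lambda>i s. \<bar>f' i s\<bar>)"
  have c: "continuous_on UNIV (f i)" for i using d(1)
    by (meson DERIV_continuous_on has_field_derivative_at_within)
  have b: "\<bar>f i s - f i' s'\<bar> \<le> 2 * ?V" if "i' < M" "s' \<in> {x i'..x (Suc i')}" for i' s'
    using variation_bound[OF g d jn i] variation_bound[OF g d jn that] by linarith
  have "line_sum x M (\<lambda>_ _. f i s - 2 * ?V) \<le> line_sum x M f"
    by (intro line_sum_mono c continuous_on_const) (use b in \<open>force simp: abs_le_iff\<close>)
  moreover have "line_sum x M f \<le> line_sum x M (\<lambda>_ _. f i s + 2 * ?V)"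
    by (intro line_sum_mono c continuous_on_const) (use b in \<open>force simp: abs_le_iff\<close>)
  ultimately have "(f i s - 2 * ?V) * (b - a) \<le> 0" "0 \<le> (f i s + 2 * ?V) * (b - a)"
    unfolding line_sum_const[OF g] using mean by auto
  then show ?thesis using \<open>a < b\<close> by (simp add: mult_le_0_iff zero_le_mult_iff)
qed

abbreviation cont_fam :: "(nat \<Rightarrow> nat \<Rightarrow> plane \<Rightarrow> real) \<Rightarrow> bool" where
  "cont_fam F \<equiv> \<forall>i j. continuous_on UNIV (F i j)"

lemma cont_integrable2: "continuous_on UNIV f \<Longrightarrow> f integrable_on cbox u v" for f :: "plane \<Rightarrow> real"
  by (meson continuous_on_subset integrable_continuous top_greatest)

lemma cont_slice1: "continuous_on UNIV f \<Longrightarrow> continuous_on S (\<lambda>s. f (s, t))" for f :: "plane \<Rightarrow> real"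
  by (rule continuous_on_compose2[of UNIV f]) (auto intro!: continuous_intros)

lemma cont_slice2: "continuous_on UNIV f \<Longrightarrow> continuous_on S (\<lambda>t. f (s, t))" for f :: "plane \<Rightarrow> real"
  by (rule continuous_on_compose2[of UNIV f]) (auto intro!: continuous_intros)

lemma cont_line_sum_y:
  assumes "\<And>j. continuous_on UNIV (F j)"
  shows "continuous_on UNIV (\<lambda>s. line_sum y N (\<lambda>j t. F j (s, t)))"
proof -
  have "continuous_on UNIV (\<lambda>s. integral (cbox (y j) (y (Suc j))) (\<lambda>t. F j (s, t)))" for j
    by (rule integral_continuous_on_param)
      (use assms in \<open>auto simp: case_prod_beta intro: continuous_on_subset\<close>)
  then show ?thesis unfolding line_sum_def by (auto intro!: continuous_on_sum)
qed

lemma cell_sum_xy: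
  assumes "cont_fam F"
  shows "cell_sum x M y N F = line_sum x M (\<lambda>i s. line_sum y N (\<lambda>j t. F i j (s, t)))"
proof -
  have c: "continuous_on UNIV (\<lambda>s. integral (cbox (y j) (y (Suc j))) (\<lambda>t. F i j (s, t)))" for i j
    by (rule integral_continuous_on_param)
      (use assms in \<open>auto simp: case_prod_beta intro: continuous_on_subset\<close>)
  have "(\<Sum>j<N. integral (cbox (x i, y j) (x (Suc i), y (Suc j))) (F i j))
     = integral {x i..x (Suc i)} (\<lambda>s. \<Sum>j<N. integral {y j..y (Suc j)} (\<lambda>t. F i j (s, t)))" for i
  proof -
    have "(\<Sum>j<N. integral (cbox (x i, y j) (x (Suc i), y (Suc j))) (F i j))
      = (\<Sum>j<N. integral {x i..x (Suc i)} (\<lambda>s. integral {y j..y (Suc j)} (\<lambda>t. F i j (s, t))))"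
      using assms by (intro sum.cong refl)
        (subst integral_prod_continuous, auto intro: continuous_on_subset)
    also have "\<dots> = integral {x i..x (Suc i)} (\<lambda>s. \<Sum>j<N. integral {y j..y (Suc j)} (\<lambda>t. F i j (s, t)))"
      by (subst integral_sum) (use c in \<open>auto intro!: cont_integrable\<close>)
    finally show ?thesis .
  qed
  then show ?thesis unfolding cell_sum_def line_sum_def by simp
qed

text \<open>Transposing the plane exchanges the two grids; through it statements about y are read
  off from those about x.\<close>

lemma cell_sum_swap:
  assumes "cont_fam F"
  shows "cell_sum y N x M (\<lambda>j i z. F i j (prod.swap z)) = cell_sum x M y N F"
proof -
  have "integral (cbox (y j, x i) (y (Suc j), x (Suc i))) (\<lambda>z. F i j (prod.swap z))
      = integral (cbox (x i, y j) (x (Suc i), y (Suc j))) (F i j)" for i j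
  proof -
    have c: "continuous_on (cbox (x i, y j) (x (Suc i), y (Suc j))) (F i j)"
      using assms by (auto intro: continuous_on_subset)
    have c': "continuous_on (cbox (y j, x i) (y (Suc j), x (Suc i))) (\<lambda>z. F i j (prod.swap z))"
      by (rule continuous_on_compose2[of UNIV "F i j"]) (use assms continuous_on_swap in auto)
    have c2: "continuous_on (cbox (x i, y j) (x (Suc i), y (Suc j))) (\<lambda>(s,t). F i j (s,t))"
      using c by simp
    have "integral (cbox (y j, x i) (y (Suc j), x (Suc i))) (\<lambda>z. F i j (prod.swap z))
        = integral (cbox (y j) (y (Suc j))) (\<lambda>t. integral (cbox (x i) (x (Suc i))) (\<lambda>s. F i j (s, t)))"
      by (subst integral_prod_continuous[OF c']) simp
    then show ?thesis
      using integral_swap_continuous[OF c2] integral_prod_continuous[OF c] by simp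
  qed
  then show ?thesis unfolding cell_sum_def by (subst sum.swap) simp
qed

lemma cell_sum_add:
  assumes "cont_fam F" "cont_fam G"
  shows "cell_sum x M y N (\<lambda>i j z. F i j z + G i j z) = cell_sum x M y N F + cell_sum x M y N G"
  unfolding cell_sum_def sum.distrib[symmetric]
  using assms by (intro sum.cong refl integral_add cont_integrable2) auto

lemma cell_sum_diff:
  assumes "cont_fam F" "cont_fam G"
  shows "cell_sum x M y N (\<lambda>i j z. F i j z - G i j z) = cell_sum x M y N F - cell_sum x M y N G"
  unfolding cell_sum_def sum_subtractf[symmetric]
  using assms by (intro sum.cong refl integral_diff cont_integrable2) auto

lemma cell_sum_cmult: "cell_sum x M y N (\<lambda>i j z. c * F i j z) = c * cell_sum x M y N F"
  unfolding cell_sum_def by (simp add: sum_distrib_left)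

lemma cell_sum_mono:
  assumes "cont_fam F" "cont_fam G"
    and "\<And>i j s t. i < M \<Longrightarrow> j < N \<Longrightarrow> s \<in> {x i..x (Suc i)} \<Longrightarrow> t \<in> {y j..y (Suc j)} \<Longrightarrow> F i j (s, t) \<le> G i j (s, t)"
  shows "cell_sum x M y N F \<le> cell_sum x M y N G"
  unfolding cell_sum_def
  by (intro sum_mono integral_le cont_integrable2) (use assms in auto)

lemma cell_sum_nonneg:
  assumes "cont_fam F"
    and "\<And>i j s t. i < M \<Longrightarrow> j < N \<Longrightarrow> s \<in> {x i..x (Suc i)} \<Longrightarrow> t \<in> {y j..y (Suc j)} \<Longrightarrow> 0 \<le> F i j (s, t)"
  shows "0 \<le> cell_sum x M y N F"
proof -
  have "cell_sum x M y N (\<lambda>_ _ _. 0) \<le> cell_sum x M y N F" by (rule cell_sum_mono) (use assms in auto)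
  then show ?thesis by (simp add: cell_sum_def)
qed

lemma cell_sum_const:
  assumes "grid a b M x" "grid c d N y"
  shows "cell_sum x M y N (\<lambda>i j z. k) = k * (b - a) * (d - c)"
  by (subst cell_sum_xy) (auto simp: line_sum_const[OF assms(1)] line_sum_const[OF assms(2)])

text \<open>Expanding the nonnegative variance of |F| about its mean \<open>m\<close> over the
  rectangle gives the inequality.\<close>

lemma cell_sum_cauchy_schwarz:
  assumes "grid a b M x" "grid c d N y" "a < b" "c < d" and F: "cont_fam F"
  shows "(cell_sum x M y N (\<lambda>i j z. \<bar>F i j z\<bar>))\<^sup>2 \<le> (b - a) * (d - c) * cell_sum x M y N (\<lambda>i j z. (F i j z)\<^sup>2)"
proof -
  let ?A = "cell_sum x M y N (\<lambda>i j z. \<bar>F i j z\<bar>)" and ?S = "(b - a) * (d - c)"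
  define m where "m = ?A / ?S"
  have S: "?S > 0" using assms by simp
  have cf: "cont_fam (\<lambda>i j z. (F i j z)\<^sup>2)" "cont_fam (\<lambda>i j z. 2 * m * \<bar>F i j z\<bar>)" 
    using F by (auto intro!: continuous_intros)
  have "0 \<le> cell_sum x M y N (\<lambda>i j z. (\<bar>F i j z\<bar> - m)\<^sup>2)"
    using F by (intro cell_sum_nonneg) (auto intro!: continuous_intros)
  also have "(\<lambda>i j z. (\<bar>F i j z\<bar> - m)\<^sup>2) = (\<lambda>i j z. (F i j z)\<^sup>2 - 2 * m * \<bar>F i j z\<bar> + m\<^sup>2)"
    by (auto simp: fun_eq_iff power2_eq_square algebra_simps)
  also have "cell_sum x M y N \<dots> = cell_sum x M y N (\<lambda>i j z. (F i j z)\<^sup>2) - 2 * m * ?A + m\<^sup>2 * ?S"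
  proof -
    have "cell_sum x M y N (\<lambda>i j z. (F i j z)\<^sup>2 - 2 * m * \<bar>F i j z\<bar> + m\<^sup>2)
       = cell_sum x M y N (\<lambda>i j z. (F i j z)\<^sup>2 - 2 * m * \<bar>F i j z\<bar>) + cell_sum x M y N (\<lambda>i j z. m\<^sup>2)"
      using F by (intro cell_sum_add) (auto intro!: continuous_intros)
    also have "cell_sum x M y N (\<lambda>i j z. (F i j z)\<^sup>2 - 2 * m * \<bar>F i j z\<bar>) = cell_sum x M y N (\<lambda>i j z. (F i j z)\<^sup>2) - 2 * m * ?A"
      using cell_sum_diff[OF cf] by (simp add: cell_sum_cmult)
    finally show ?thesis by (simp add: cell_sum_const[OF assms(1,2)] mult.assoc)
  qed
  finally have 1: "0 \<le> cell_sum x M y N (\<lambda>i j z. (F i j z)\<^sup>2) - 2 * m * ?A + m\<^sup>2 * ?S" .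
  have "?A = m * ?S" using S unfolding m_def by (metis less_irrefl nonzero_eq_divide_eq)
  with 1 have "m\<^sup>2 * ?S \<le> cell_sum x M y N (\<lambda>i j z. (F i j z)\<^sup>2)" by (simp add: power2_eq_square)
  then have "?S * (m\<^sup>2 * ?S) \<le> ?S * cell_sum x M y N (\<lambda>i j z. (F i j z)\<^sup>2)"
    using S by (intro mult_left_mono) auto
  moreover have "?A\<^sup>2 = ?S * (m\<^sup>2 * ?S)"
    using \<open>?A = m * ?S\<close> by (simp add: power2_eq_square)
  ultimately show ?thesis by simp
qed

subsection \<open>Matching families of polynomials\<close>

text \<open>Separate degrees in the two variables, because \<open>dx\<close> and \<open>dy\<close>
  each lower only one of them; \<open>Q r\<close> is the diagonal case.\<close>

definition Pol :: "nat \<Rightarrow> nat \<Rightarrow> (plane \<Rightarrow> real) set" where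
  "Pol m n = {p. \<exists>C :: nat \<Rightarrow> nat \<Rightarrow> real. \<forall>s t. p (s, t) = (\<Sum>i\<le>m. \<Sum>j\<le>n. C i j * s ^ i * t ^ j)}"

definition polyfun :: "(plane \<Rightarrow> real) \<Rightarrow> bool" where
  "polyfun p \<longleftrightarrow> (\<exists>m n. p \<in> Pol m n)"

lemma Q_eq_Pol: "Q r = Pol r r"
  by (simp add: Q_def Pol_def)

lemma Pol_eq: "p \<in> Pol m n \<longleftrightarrow> (\<exists>C. p = (\<lambda>z. \<Sum>i\<le>m. \<Sum>j\<le>n. C i j * fst z ^ i * snd z ^ j))"
  by (auto simp: Pol_def fun_eq_iff)

text \<open>The dependence on the other variable is an arbitrary \<open>g\<close>, so that the
  formula also covers a sum already differentiated in y; commuting mixed derivatives rests on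
  this.\<close>

lemma dx_sum_form:
  "dx (\<lambda>z. \<Sum>i\<le>m. \<Sum>j\<le>n. C i j * fst z ^ i * g j (snd z)) =
     (\<lambda>z. \<Sum>i\<le>m. \<Sum>j\<le>n. C i j * (of_nat i * fst z ^ (i - 1)) * g j (snd z))"
proof
  fix z :: plane
  have "((\<lambda>s. \<Sum>i\<le>m. \<Sum>j\<le>n. C i j * s ^ i * g j (snd z)) has_real_derivative
    (\<Sum>i\<le>m. \<Sum>j\<le>n. C i j * (of_nat i * fst z ^ (i - 1)) * g j (snd z))) (at (fst z))"
    by (auto intro!: derivative_eq_intros sum.cong simp: mult_ac)
  then show "dx (\<lambda>z. \<Sum>i\<le>m. \<Sum>j\<le>n. C i j * fst z ^ i * g j (snd z)) z
     = (\<Sum>i\<le>m. \<Sum>j\<le>n. C i j * (of_nat i * fst z ^ (i - 1)) * g j (snd z))"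
    by (simp add: dx_def DERIV_imp_deriv)
qed

lemma dy_sum_form:
  "dy (\<lambda>z. \<Sum>i\<le>m. \<Sum>j\<le>n. C i j * g i (fst z) * snd z ^ j) =
     (\<lambda>z. \<Sum>i\<le>m. \<Sum>j\<le>n. C i j * g i (fst z) * (of_nat j * snd z ^ (j - 1)))"
proof
  fix z :: plane
  have "((\<lambda>t. \<Sum>i\<le>m. \<Sum>j\<le>n. C i j * g i (fst z) * t ^ j) has_real_derivative
    (\<Sum>i\<le>m. \<Sum>j\<le>n. C i j * g i (fst z) * (of_nat j * snd z ^ (j - 1)))) (at (snd z))"
    by (auto intro!: derivative_eq_intros sum.cong simp: mult_ac)
  then show "dy (\<lambda>z. \<Sum>i\<le>m. \<Sum>j\<le>n. C i j * g i (fst z) * snd z ^ j) z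
     = (\<Sum>i\<le>m. \<Sum>j\<le>n. C i j * g i (fst z) * (of_nat j * snd z ^ (j - 1)))"
    by (simp add: dy_def DERIV_imp_deriv)
qed

lemma dx_swap: "dx (\<lambda>z. p (prod.swap z)) = (\<lambda>z. dy p (prod.swap z))"
  by (auto simp: fun_eq_iff dx_def dy_def)

lemma dy_swap: "dy (\<lambda>z. p (prod.swap z)) = (\<lambda>z. dx p (prod.swap z))"
  by (auto simp: fun_eq_iff dx_def dy_def)

lemma Pol_swap: "p \<in> Pol m n \<Longrightarrow> (\<lambda>z. p (prod.swap z)) \<in> Pol n m"
proof -
  assume "p \<in> Pol m n"
  then obtain C where C: "\<And>s t. p (s, t) = (\<Sum>i\<le>m. \<Sum>j\<le>n. C i j * s ^ i * t ^ j)"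
    by (auto simp: Pol_def)
  have "p (prod.swap (s, t)) = (\<Sum>i\<le>n. \<Sum>j\<le>m. C j i * s ^ i * t ^ j)" for s t
    by (simp add: C mult_ac) (rule sum.swap)
  then show ?thesis unfolding Pol_def mem_Collect_eq by (intro exI[of _ "\<lambda>i j. C j i"]) auto
qed

lemma Pol_dx:
  assumes "p \<in> Pol m n"
  shows "dx p \<in> Pol (m - 1) n"
proof -
  obtain C where p: "p = (\<lambda>z. \<Sum>i\<le>m. \<Sum>j\<le>n. C i j * fst z ^ i * snd z ^ j)"
    using assms by (auto simp: Pol_eq)
  have d: "dx p = (\<lambda>z. \<Sum>i\<le>m. \<Sum>j\<le>n. C i j * (of_nat i * fst z ^ (i - 1)) * snd z ^ j)"
    unfolding p by (rule dx_sum_form)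
  show ?thesis
  proof (cases m)
    case 0
    then show ?thesis unfolding d Pol_eq by (intro exI[of _ "\<lambda>i j. 0"]) simp
  next
    case (Suc k)
    then show ?thesis unfolding d Pol_eq
      by (intro exI[of _ "\<lambda>i j. C (Suc i) j * of_nat (Suc i)"])
        (simp add: sum.atMost_Suc_shift mult_ac del: of_nat_Suc sum.atMost_Suc)
  qed
qed

lemma Pol_dy: "p \<in> Pol m n \<Longrightarrow> dy p \<in> Pol m (n - 1)"
  using Pol_swap[OF Pol_dx[OF Pol_swap]] by (simp add: dx_swap)

lemma dx_dy_commute:
  assumes "polyfun p"
  shows "dy (dx p) = dx (dy p)"
proof -
  obtain m n C where p: "p = (\<lambda>z. \<Sum>i\<le>m. \<Sum>j\<le>n. C i j * fst z ^ i * snd z ^ j)"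
    using assms by (auto simp: Pol_eq polyfun_def)
  show ?thesis
    unfolding p dx_sum_form[where g="\<lambda>j t. t ^ j"] dy_sum_form[where g="\<lambda>i s. s ^ i"]
    using dx_sum_form[where m=m and n=n and C=C and g="\<lambda>j t. of_nat j * t ^ (j - 1)"]
      dy_sum_form[where m=m and n=n and C=C and g="\<lambda>i s. of_nat i * s ^ (i - 1)"] by simp
qed

lemma polyfun_dx [simp]: "polyfun p \<Longrightarrow> polyfun (dx p)"
  and polyfun_dy [simp]: "polyfun p \<Longrightarrow> polyfun (dy p)"
  using Pol_dx Pol_dy unfolding polyfun_def by blast+

lemma polyfun_swap [simp]: "polyfun p \<Longrightarrow> polyfun (\<lambda>z. p (prod.swap z))"
  using Pol_swap unfolding polyfun_def by blast

lemma Pol_continuous: "p \<in> Pol m n \<Longrightarrow> continuous_on S p"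
  unfolding Pol_eq by (auto intro!: continuous_intros)

lemma polyfun_continuous [simp]: "polyfun p \<Longrightarrow> continuous_on S p"
  using Pol_continuous by (auto simp: polyfun_def)

lemma polyfun_der_x:
  assumes "polyfun p"
  shows "((\<lambda>s. p (s, t)) has_real_derivative dx p (s, t)) (at s)"
proof -
  obtain m n C where p: "p = (\<lambda>z. \<Sum>i\<le>m. \<Sum>j\<le>n. C i j * fst z ^ i * snd z ^ j)"
    using assms by (auto simp: Pol_eq polyfun_def)
  show ?thesis
    unfolding p dx_sum_form[where g="\<lambda>j t. t ^ j"]
    by (auto intro!: derivative_eq_intros sum.cong simp: mult_ac)
qed

lemma polyfun_der_y:
  assumes "polyfun p"
  shows "((\<lambda>t. p (s, t)) has_real_derivative dy p (s, t)) (at t)"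
  using polyfun_der_x[OF polyfun_swap[OF assms], of s t] by (simp add: dx_swap)

text \<open>The index running along the interface is not restricted: families of polynomials are
  extended by zero outside the grid.\<close>

definition matches_x :: "(nat \<Rightarrow> real) \<Rightarrow> nat \<Rightarrow> (nat \<Rightarrow> nat \<Rightarrow> plane \<Rightarrow> real) \<Rightarrow> bool" where
  "matches_x x M F \<longleftrightarrow> (\<forall>i j t. Suc i < M \<longrightarrow> F i j (x (Suc i), t) = F (Suc i) j (x (Suc i), t))"

definition matches_y :: "(nat \<Rightarrow> real) \<Rightarrow> nat \<Rightarrow> (nat \<Rightarrow> nat \<Rightarrow> plane \<Rightarrow> real) \<Rightarrow> bool" where
  "matches_y y N F \<longleftrightarrow> (\<forall>i j s. Suc j < N \<longrightarrow> F i j (s, y (Suc j)) = F i (Suc j) (s, y (Suc j)))"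

definition vanishes_x :: "real \<Rightarrow> real \<Rightarrow> nat \<Rightarrow> (nat \<Rightarrow> nat \<Rightarrow> plane \<Rightarrow> real) \<Rightarrow> bool" where
  "vanishes_x a b M F \<longleftrightarrow> (\<forall>j t. F 0 j (a, t) = 0 \<and> F (M - 1) j (b, t) = 0)"

definition vanishes_y :: "real \<Rightarrow> real \<Rightarrow> nat \<Rightarrow> (nat \<Rightarrow> nat \<Rightarrow> plane \<Rightarrow> real) \<Rightarrow> bool" where
  "vanishes_y c d N F \<longleftrightarrow> (\<forall>i s. F i 0 (s, c) = 0 \<and> F i (N - 1) (s, d) = 0)"

text \<open>The two traces agree for every \<open>t\<close>, so they are the same function of
  \<open>t\<close> and have the same tangential derivative. Hence all tangential derivatives inherit
  matching and boundary zeros for free, whereas normal derivatives need an assumption.\<close>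

lemma matches_x_dy: "matches_x x M F \<Longrightarrow> matches_x x M (\<lambda>i j. dy (F i j))"
  by (simp add: matches_x_def dy_def)

lemma matches_y_dx: "matches_y y N F \<Longrightarrow> matches_y y N (\<lambda>i j. dx (F i j))"
  by (simp add: matches_y_def dx_def)

lemma vanishes_x_dy: "vanishes_x a b M F \<Longrightarrow> vanishes_x a b M (\<lambda>i j. dy (F i j))"
  by (simp add: vanishes_x_def dy_def)

lemma vanishes_y_dx: "vanishes_y c d N F \<Longrightarrow> vanishes_y c d N (\<lambda>i j. dx (F i j))"
  by (simp add: vanishes_y_def dx_def)

section \<open>Divergence theorem and integration by parts over the grid\<close>

locale product_grid =
  fixes a b c d :: real and M :: nat and x :: "nat \<Rightarrow> real" and N :: nat and y :: "nat \<Rightarrow> real"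
  assumes ab: "a < b" and cd: "c < d" and gx: "grid a b M x" and gy: "grid c d N y"
begin

abbreviation "csum \<equiv> cell_sum x M y N"

lemma M0: "M > 0" and N0: "N > 0"
  using grid_pos[OF gx ab] grid_pos[OF gy cd] .

lemma cell_sum_yx:
  assumes "cont_fam F"
  shows "csum F = line_sum y N (\<lambda>j t. line_sum x M (\<lambda>i s. F i j (s, t)))"
proof -
  have c: "cont_fam (\<lambda>j i z. F i j (prod.swap z))"
  proof safe
    fix i j show "continuous_on UNIV (\<lambda>z. F i j (prod.swap z))"
      by (rule continuous_on_compose2[of UNIV "F i j"]) (use assms continuous_on_swap in auto)
  qed
  show ?thesis unfolding cell_sum_swap[OF assms, symmetric] cell_sum_xy[OF c] by simp
qed

lemma cell_sum_dx_zero: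
  assumes "cont_fam F'" "\<And>i j s t. ((\<lambda>s. F i j (s, t)) has_real_derivative F' i j (s, t)) (at s)"
    and "matches_x x M F" "vanishes_x a b M F"
  shows "csum F' = 0"
proof -
  have "line_sum x M (\<lambda>i s. F' i j (s, t)) = F (M - 1) j (b, t) - F 0 j (a, t)" for j t
    by (rule line_sum_deriv[OF gx M0, where f="\<lambda>i s. F i j (s, t)"])
      (use assms in \<open>auto simp: matches_x_def intro!: cont_slice1\<close>)
  then show ?thesis unfolding cell_sum_yx[OF assms(1)] using assms(4) by (simp add: vanishes_x_def line_sum_def)
qed

lemma cell_sum_dy_zero:
  assumes "cont_fam F'" "\<And>i j s t. ((\<lambda>t. F i j (s, t)) has_real_derivative F' i j (s, t)) (at t)"
    and "matches_y y N F" "vanishes_y c d N F"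
  shows "csum F' = 0"
proof -
  have "line_sum y N (\<lambda>j t. F' i j (s, t)) = F i (N - 1) (s, d) - F i 0 (s, c)" for i s
    by (rule line_sum_deriv[OF gy N0, where f="\<lambda>j t. F i j (s, t)"])
      (use assms in \<open>auto simp: matches_y_def intro!: cont_slice2\<close>)
  then show ?thesis unfolding cell_sum_xy[OF assms(1)] using assms(4) by (simp add: vanishes_y_def line_sum_def)
qed

text \<open>The x-derivative of the product integrates to zero: inner edges cancel by matching,
  outer ones by the zero of \<open>F\<close>. Only one factor has to vanish on the boundary, so
  \<open>G\<close> may be a derivative whose boundary values are unknown.\<close>

lemma cell_sum_parts_x:
  assumes F: "\<And>i j. polyfun (F i j)" and G: "\<And>i j. polyfun (G i j)"
    and "matches_x x M F" "matches_x x M G" "vanishes_x a b M F"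
  shows "csum (\<lambda>i j z. F i j z * dx (G i j) z) = - csum (\<lambda>i j z. dx (F i j) z * G i j z)"
proof -
  have c1: "cont_fam (\<lambda>i j z. F i j z * dx (G i j) z)"
    and c2: "cont_fam (\<lambda>i j z. dx (F i j) z * G i j z)"
    using F G by (auto intro!: continuous_on_mult)
  have "csum (\<lambda>i j z. F i j z * dx (G i j) z + dx (F i j) z * G i j z) = 0"
    by (rule cell_sum_dx_zero[where F="\<lambda>i j z. F i j z * G i j z"])
      (use assms c1 c2 in \<open>auto simp: matches_x_def vanishes_x_def intro!: continuous_on_add derivative_eq_intros polyfun_der_x\<close>)
  then show ?thesis using cell_sum_add[OF c1 c2] by simp
qed

lemma cell_sum_parts_y:
  assumes F: "\<And>i j. polyfun (F i j)" and G: "\<And>i j. polyfun (G i j)"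
    and "matches_y y N F" "matches_y y N G" "vanishes_y c d N F"
  shows "csum (\<lambda>i j z. F i j z * dy (G i j) z) = - csum (\<lambda>i j z. dy (F i j) z * G i j z)"
proof -
  have c1: "cont_fam (\<lambda>i j z. F i j z * dy (G i j) z)"
    and c2: "cont_fam (\<lambda>i j z. dy (F i j) z * G i j z)"
    using F G by (auto intro!: continuous_on_mult)
  have "csum (\<lambda>i j z. F i j z * dy (G i j) z + dy (F i j) z * G i j z) = 0"
    by (rule cell_sum_dy_zero[where F="\<lambda>i j z. F i j z * G i j z"])
      (use assms c1 c2 in \<open>auto simp: matches_y_def vanishes_y_def intro!: continuous_on_add derivative_eq_intros polyfun_der_y\<close>)
  then show ?thesis using cell_sum_add[OF c1 c2] by simp
qed

end

text \<open>The pieces of a function in \<open>V_h0\<close>, with the degree left open: the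
  estimates hold with constants independent of it.\<close>

locale trial_family = product_grid +
  fixes U :: "nat \<Rightarrow> nat \<Rightarrow> plane \<Rightarrow> real"
  assumes poly [simp]: "\<And>i j. polyfun (U i j)"
    and match_x: "matches_x x M U" and match_dx: "matches_x x M (\<lambda>i j. dx (U i j))" and vanish_x: "vanishes_x a b M U"
    and match_y: "matches_y y N U" and match_dy: "matches_y y N (\<lambda>i j. dy (U i j))" and vanish_y: "vanishes_y c d N U"
begin

lemma swap: "trial_family c d a b N y M x (\<lambda>j i z. U i j (prod.swap z))"
  using match_x match_dx vanish_x match_y match_dy vanish_y ab cd gx gy
  by unfold_locales (auto simp: matches_x_def matches_y_def vanishes_x_def vanishes_y_def dx_swap dy_swap)

text \<open>Normal form for mixed derivatives: every \<open>dx\<close> stands outside every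
  \<open>dy\<close>.\<close>

lemma commute [simp]: "dy (dx (U i j)) = dx (dy (U i j))"
   "dy (dx (dy (U i j))) = dx (dy (dy (U i j)))"
   "dy (dx (dx (U i j))) = dx (dx (dy (U i j)))"
   "dy (dx (dx (dy (U i j)))) = dx (dx (dy (dy (U i j))))"
  by (simp_all add: dx_dy_commute)

lemmas matches_x_facts = match_x match_dx matches_x_dy[OF match_x] matches_x_dy[OF matches_x_dy[OF match_x]]
  matches_x_dy[OF match_dx, simplified] matches_x_dy[OF matches_x_dy[OF match_dx], simplified]
lemmas vanishes_x_facts = vanish_x vanishes_x_dy[OF vanish_x] vanishes_x_dy[OF vanishes_x_dy[OF vanish_x]]
lemmas matches_y_facts = match_y match_dy matches_y_dx[OF match_y] matches_y_dx[OF matches_y_dx[OF match_y]]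
  matches_y_dx[OF match_dy] matches_y_dx[OF matches_y_dx[OF match_dy]]
lemmas vanishes_y_facts = vanish_y vanishes_y_dx[OF vanish_y] vanishes_y_dx[OF vanishes_y_dx[OF vanish_y]]

text \<open>One y-derivative is moved over. u_xx is tangential to the horizontal edges, hence
  matches across them and vanishes on the sides y = c and y = d; its jumps across vertical edges do
  not matter, as the integration by parts is in y only.\<close>

lemma energy_xx:
  "csum (\<lambda>i j z. dx (dx (U i j)) z * dx (dx (dy (dy (U i j)))) z) = - csum (\<lambda>i j z. (dx (dx (dy (U i j))) z)\<^sup>2)"
  using cell_sum_parts_y[of "\<lambda>i j. dx (dx (U i j))" "\<lambda>i j. dx (dx (dy (U i j)))"] matches_y_facts vanishes_y_facts
  by (simp add: power2_eq_square)

lemma energy_yy: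
  "csum (\<lambda>i j z. dy (dy (U i j)) z * dx (dx (dy (dy (U i j)))) z) = - csum (\<lambda>i j z. (dx (dy (dy (U i j))) z)\<^sup>2)"
  using cell_sum_parts_x[of "\<lambda>i j. dy (dy (U i j))" "\<lambda>i j. dx (dy (dy (U i j)))"] matches_x_facts vanishes_x_facts
  by (simp add: power2_eq_square)

lemma mixed_sq:
  "csum (\<lambda>i j z. dx (U i j) z * dx (dy (dy (U i j))) z) = - csum (\<lambda>i j z. (dx (dy (U i j)) z)\<^sup>2)"
  using cell_sum_parts_y[of "\<lambda>i j. dx (U i j)" "\<lambda>i j. dx (dy (U i j))"] matches_y_facts vanishes_y_facts
  by (simp add: power2_eq_square)

text \<open>Two integrations by parts, first in x and then in y, give a positive sign; so for
  \<gamma> >= 0 the reaction term is on the good side of the energy balance.\<close>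

lemma energy_0:
  "csum (\<lambda>i j z. U i j z * dx (dx (dy (dy (U i j)))) z) = csum (\<lambda>i j z. (dx (dy (U i j)) z)\<^sup>2)"
  using cell_sum_parts_x[of "\<lambda>i j. U i j" "\<lambda>i j. dx (dy (dy (U i j)))"] matches_x_facts vanishes_x_facts mixed_sq
  by simp

lemma energy_x:
  "csum (\<lambda>i j z. dx (U i j) z * dx (dx (dy (dy (U i j)))) z) = - csum (\<lambda>i j z. dx (dy (U i j)) z * dx (dx (dy (U i j))) z)"
  using cell_sum_parts_y[of "\<lambda>i j. dx (U i j)" "\<lambda>i j. dx (dx (dy (U i j)))"] matches_y_facts vanishes_y_facts
  by simp

lemma energy_y:
  "csum (\<lambda>i j z. dy (U i j) z * dx (dx (dy (dy (U i j)))) z) = - csum (\<lambda>i j z. dx (dy (U i j)) z * dx (dy (dy (U i j))) z)"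
  using cell_sum_parts_x[of "\<lambda>i j. dy (U i j)" "\<lambda>i j. dx (dy (dy (U i j)))"] matches_x_facts vanishes_x_facts
  by simp

section \<open>Sup and L1 bounds by third mixed derivatives\<close>

lemma cont_abs: "(\<And>i j. polyfun (F i j)) \<Longrightarrow> cont_fam (\<lambda>i j z. \<bar>F i j z\<bar>)"
  by (auto intro!: continuous_on_rabs)

text \<open>On a horizontal line u_y vanishes at both ends, so its x-derivative u_xy has integral
  zero there; u_xy is continuous across vertical edges because u_x matches and \<open>dy\<close> is
  tangential. Then \<open>mean_zero_bound\<close> applies.\<close>

lemma sup_mixed:
  assumes "i < M" "s \<in> {x i..x (Suc i)}"
  shows "\<bar>dx (dy (U i j)) (s, t)\<bar> \<le> 2 * line_sum x M (\<lambda>i s. \<bar>dx (dx (dy (U i j))) (s, t)\<bar>)"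
proof (rule mean_zero_bound[OF gx ab, where f="\<lambda>i s. dx (dy (U i j)) (s, t)"])
  have "line_sum x M (\<lambda>i s. dx (dy (U i j)) (s, t)) = dy (U (M - 1) j) (b, t) - dy (U 0 j) (a, t)"
    by (rule line_sum_deriv[OF gx M0, where f="\<lambda>i s. dy (U i j) (s, t)"])
      (use matches_x_facts in \<open>auto simp: matches_x_def intro!: polyfun_der_x cont_slice1\<close>)
  also have "\<dots> = 0" using vanishes_x_facts by (simp add: vanishes_x_def)
  finally show "line_sum x M (\<lambda>i s. dx (dy (U i j)) (s, t)) = 0" .
qed (use matches_x_facts assms in \<open>auto simp: matches_x_def intro!: polyfun_der_x cont_slice1\<close>)

lemma line_sum_abs_y:
  assumes F: "\<And>i j. polyfun (F i j)" and "matches_y y N F" "vanishes_y c d N F" and j: "j < N" "t \<in> {y j..y (Suc j)}"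
  shows "\<bar>F i j (s, t)\<bar> \<le> line_sum y N (\<lambda>j t. \<bar>dy (F i j) (s, t)\<bar>)"
proof -
  have "\<bar>F i j (s, t) - F i 0 (s, c)\<bar> \<le> line_sum y N (\<lambda>j t. \<bar>dy (F i j) (s, t)\<bar>)"
    by (rule variation_bound[OF gy, where f="\<lambda>j t. F i j (s, t)"])
      (use assms in \<open>auto simp: matches_y_def intro!: polyfun_der_y cont_slice2\<close>)
  then show ?thesis using assms by (simp add: vanishes_y_def)
qed

lemma cont_line_sum_x:
  assumes "\<And>i. continuous_on UNIV (F i)"
  shows "continuous_on UNIV (\<lambda>t. line_sum x M (\<lambda>i s. F i (s, t :: real)) :: real)"
proof -
  have "continuous_on UNIV (\<lambda>z. F i (prod.swap z))" for i
    by (rule continuous_on_compose2[of UNIV "F i"]) (use assms continuous_on_swap in auto)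
  from cont_line_sum_y[OF this, of x M] show ?thesis by simp
qed

text \<open>u_x vanishes on the side y = c, so it is at most the integral of |u_xy| along a vertical
  line; bounding u_xy there by a horizontal integral of |u_xxy| produces an integral over the whole
  rectangle.\<close>

lemma sup_dx:
  assumes "i < M" "s \<in> {x i..x (Suc i)}" "j < N" "t \<in> {y j..y (Suc j)}"
  shows "\<bar>dx (U i j) (s, t)\<bar> \<le> 2 * csum (\<lambda>i j z. \<bar>dx (dx (dy (U i j))) z\<bar>)"
proof -
  have c: "cont_fam (\<lambda>i j z. \<bar>dx (dx (dy (U i j))) z\<bar>)" by (rule cont_abs) simp
  have "\<bar>dx (U i j) (s, t)\<bar> \<le> line_sum y N (\<lambda>j t. \<bar>dx (dy (U i j)) (s, t)\<bar>)"
    using line_sum_abs_y[of "\<lambda>i j. dx (U i j)"] matches_y_facts vanishes_y_facts assms by simp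
  also have "\<dots> \<le> line_sum y N (\<lambda>j t. 2 * line_sum x M (\<lambda>i s. \<bar>dx (dx (dy (U i j))) (s, t)\<bar>))"
    using c by (intro line_sum_mono sup_mixed assms continuous_on_rabs cont_slice2 polyfun_continuous
        continuous_on_mult continuous_on_const
        cont_line_sum_x[of "\<lambda>i z. \<bar>dx (dx (dy (U i j))) z\<bar>" for j]) auto
  also have "\<dots> = 2 * csum (\<lambda>i j z. \<bar>dx (dx (dy (U i j))) z\<bar>)"
    using cell_sum_yx[OF c] by (simp add: line_sum_cmult)
  finally show ?thesis .
qed

text \<open>u_xx is zero on y = c and continuous in y, hence bounded by the vertical integral of
  |u_xxy|, which does not depend on t; integrating over t gives the factor d - c.\<close>

lemma L1_dxx:
  "csum (\<lambda>i j z. \<bar>dx (dx (U i j)) z\<bar>) \<le> (d - c) * csum (\<lambda>i j z. \<bar>dx (dx (dy (U i j))) z\<bar>)"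
proof -
  have c: "cont_fam (\<lambda>i j z. \<bar>dx (dx (dy (U i j))) z\<bar>)" "cont_fam (\<lambda>i j z. \<bar>dx (dx (U i j)) z\<bar>)"
    by (rule cont_abs, simp)+
  let ?I = "\<lambda>i s. line_sum y N (\<lambda>j t. \<bar>dx (dx (dy (U i j))) (s, t)\<bar>)"
  have b: "\<bar>dx (dx (U i j)) (s, t)\<bar> \<le> ?I i s" if "j < N" "t \<in> {y j..y (Suc j)}" for i j s t
    using line_sum_abs_y[of "\<lambda>i j. dx (dx (U i j))"] matches_y_facts vanishes_y_facts that by simp
  have "line_sum y N (\<lambda>j t. \<bar>dx (dx (U i j)) (s, t)\<bar>) \<le> line_sum y N (\<lambda>j t. ?I i s)" for i s
    by (intro line_sum_mono b continuous_on_const continuous_on_rabs cont_slice2 polyfun_continuous) auto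
  then have "line_sum y N (\<lambda>j t. \<bar>dx (dx (U i j)) (s, t)\<bar>) \<le> (d - c) * ?I i s" for i s
    unfolding line_sum_const[OF gy] by (simp add: mult.commute)
  then have "line_sum x M (\<lambda>i s. line_sum y N (\<lambda>j t. \<bar>dx (dx (U i j)) (s, t)\<bar>)) \<le> line_sum x M (\<lambda>i s. (d - c) * ?I i s)"
    using c by (intro line_sum_mono continuous_on_mult continuous_on_const
        cont_line_sum_y[of "\<lambda>j z. \<bar>dx (dx (dy (U i j))) z\<bar>" for i]
        cont_line_sum_y[of "\<lambda>j z. \<bar>dx (dx (U i j)) z\<bar>" for i]) auto
  then show ?thesis unfolding cell_sum_xy[OF c(1)] cell_sum_xy[OF c(2)] line_sum_cmult .
qed

lemma sup_U:
  assumes "i < M" "s \<in> {x i..x (Suc i)}" "j < N" "t \<in> {y j..y (Suc j)}"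
  shows "\<bar>U i j (s, t)\<bar> \<le> 2 * csum (\<lambda>i j z. \<bar>dx (dx (dy (U i j))) z\<bar>) * (b - a)"
proof -
  have "\<bar>U i j (s, t) - U 0 j (a, t)\<bar> \<le> line_sum x M (\<lambda>i s. \<bar>dx (U i j) (s, t)\<bar>)"
    by (rule variation_bound[OF gx, where f="\<lambda>i s. U i j (s, t)"])
      (use assms match_x in \<open>auto simp: matches_x_def intro!: polyfun_der_x cont_slice1\<close>)
  also have "\<dots> \<le> line_sum x M (\<lambda>i s. 2 * csum (\<lambda>i j z. \<bar>dx (dx (dy (U i j))) z\<bar>))"
    using assms by (intro line_sum_mono sup_dx continuous_on_const continuous_on_rabs cont_slice1 polyfun_continuous) auto
  finally show ?thesis using vanish_x unfolding line_sum_const[OF gx] by (simp add: vanishes_x_def)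
qed

end

subsection \<open>Energy estimates\<close>

text \<open>\<open>diff_op\<close> on a single polynomial, with \<alpha> taken out of the
  derivatives. It is continuous everywhere, also on the edges, where \<open>diff_op\<close> of a
  trial function may be unspecified; \<open>diff_op_cell\<close> identifies the two inside a
  cell.\<close>

definition cd_op :: "real \<Rightarrow> real \<Rightarrow> real \<Rightarrow> real \<Rightarrow> (plane \<Rightarrow> real) \<Rightarrow> plane \<Rightarrow> real" where
  "cd_op \<alpha> b1 b2 \<gamma> p z = - \<alpha> * (dx (dx p) z + dy (dy p) z) + b1 * dx p z + b2 * dy p z + \<gamma> * p z"

lemma cd_op_continuous: "polyfun p \<Longrightarrow> continuous_on S (cd_op \<alpha> b1 b2 \<gamma> p)"
  unfolding cd_op_def
  by (intro continuous_on_add continuous_on_mult continuous_on_const polyfun_continuous) auto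

lemma young: "e > 0 \<Longrightarrow> u * v \<le> e / 2 * u\<^sup>2 + 1 / (2 * e) * v\<^sup>2" for u v e :: real
proof -
  assume e: "e > 0"
  have "0 \<le> (e * u - v)\<^sup>2 / (2 * e)" using e by simp
  also have "\<dots> = e / 2 * u\<^sup>2 + 1 / (2 * e) * v\<^sup>2 - u * v"
    using e by (simp add: power2_eq_square field_simps)
  finally show ?thesis by simp
qed

lemma cell_sum_young:
  assumes e: "e > 0" and F: "cont_fam F" and G: "cont_fam G"
  shows "cell_sum x M y N (\<lambda>i j z. F i j z * G i j z) \<le> e / 2 * cell_sum x M y N (\<lambda>i j z. (F i j z)\<^sup>2) + 1 / (2 * e) * cell_sum x M y N (\<lambda>i j z. (G i j z)\<^sup>2)"
proof -
  have "cell_sum x M y N (\<lambda>i j z. F i j z * G i j z) \<le> cell_sum x M y N (\<lambda>i j z. e / 2 * (F i j z)\<^sup>2 + 1 / (2 * e) * (G i j z)\<^sup>2)"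
    using F G e by (intro cell_sum_mono young) (auto intro!: continuous_intros)
  also have "\<dots> = cell_sum x M y N (\<lambda>i j z. e / 2 * (F i j z)\<^sup>2) + cell_sum x M y N (\<lambda>i j z. 1 / (2 * e) * (G i j z)\<^sup>2)"
    using F G e by (intro cell_sum_add) (auto intro!: continuous_intros)
  finally show ?thesis unfolding cell_sum_cmult .
qed

lemma cell_sum_lincomb5:
  assumes "cont_fam F1" "cont_fam F2" "cont_fam F3" "cont_fam F4" "cont_fam F5"
  shows "cell_sum x M y N (\<lambda>i j z. c1 * F1 i j z + c2 * F2 i j z + c3 * F3 i j z + c4 * F4 i j z + c5 * F5 i j z)
    = c1 * cell_sum x M y N F1 + c2 * cell_sum x M y N F2 + c3 * cell_sum x M y N F3 + c4 * cell_sum x M y N F4 + c5 * cell_sum x M y N F5"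
proof -
  have c: "cont_fam (\<lambda>i j z. c * F i j z)" if "cont_fam F" for c F
    using that by (auto intro!: continuous_intros)
  have p: "cont_fam (\<lambda>i j z. F i j z + G i j z)" if "cont_fam F" "cont_fam G" for F G
    using that by (auto intro!: continuous_intros)
  note cc = assms[THEN c]
  show ?thesis
    by (subst cell_sum_add, (intro p cc; fact?)+, subst cell_sum_add, (intro p cc; fact?)+, subst cell_sum_add, (intro p cc; fact?)+,
        subst cell_sum_add, (intro p cc; fact?)+) (simp add: cell_sum_cmult)
qed

context trial_family
begin

text \<open>The L1 norm and the squared L2 norm of the gradient of u_xy. Pointwise bounds come out
  in the first, orthogonality to u_xxyy in the second, and \<open>L1_mixed_sq\<close> leads from one
  to the other.\<close>

definition "L1_mixed = csum (\<lambda>i j z. \<bar>dx (dx (dy (U i j))) z\<bar>) + csum (\<lambda>i j z. \<bar>dx (dy (dy (U i j))) z\<bar>)"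
definition "energy = csum (\<lambda>i j z. (dx (dx (dy (U i j))) z)\<^sup>2) + csum (\<lambda>i j z. (dx (dy (dy (U i j))) z)\<^sup>2)"

lemma cont_sq: "(\<And>i j. polyfun (F i j)) \<Longrightarrow> cont_fam (\<lambda>i j z. (F i j z)\<^sup>2)"
  by (auto intro!: continuous_on_power)

lemma cont_poly: "(\<And>i j. polyfun (F i j)) \<Longrightarrow> cont_fam F"
  by auto

lemma cont_prod: "(\<And>i j. polyfun (F i j)) \<Longrightarrow> (\<And>i j. polyfun (G i j)) \<Longrightarrow> cont_fam (\<lambda>i j z. F i j z * G i j z)"
  by (auto intro!: continuous_on_mult)

lemma cell_sum_abs_nonneg: "(\<And>i j. polyfun (F i j)) \<Longrightarrow> csum (\<lambda>i j z. \<bar>F i j z\<bar>) \<ge> 0"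
  by (rule cell_sum_nonneg[OF cont_abs]) auto

lemma cell_sum_sq_nonneg: "(\<And>i j. polyfun (F i j)) \<Longrightarrow> csum (\<lambda>i j z. (F i j z)\<^sup>2) \<ge> 0"
  by (rule cell_sum_nonneg[OF cont_sq]) auto

lemma L1_mixed_ge: "L1_mixed \<ge> 0" "csum (\<lambda>i j z. \<bar>dx (dx (dy (U i j))) z\<bar>) \<le> L1_mixed"
    "csum (\<lambda>i j z. \<bar>dx (dy (dy (U i j))) z\<bar>) \<le> L1_mixed"
  using cell_sum_abs_nonneg[of "\<lambda>i j. dx (dx (dy (U i j)))"] cell_sum_abs_nonneg[of "\<lambda>i j. dx (dy (dy (U i j)))"]
  unfolding L1_mixed_def by auto

lemma energy_nonneg: "energy \<ge> 0"
  using cell_sum_sq_nonneg[of "\<lambda>i j. dx (dx (dy (U i j)))"] cell_sum_sq_nonneg[of "\<lambda>i j. dx (dy (dy (U i j)))"]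
  unfolding energy_def by auto

lemma L1_mixed_sq: "L1_mixed\<^sup>2 \<le> 2 * ((b - a) * (d - c)) * energy"
proof -
  let ?S1 = "csum (\<lambda>i j z. \<bar>dx (dx (dy (U i j))) z\<bar>)" and ?S2 = "csum (\<lambda>i j z. \<bar>dx (dy (dy (U i j))) z\<bar>)"
  have "?S1\<^sup>2 \<le> (b - a) * (d - c) * csum (\<lambda>i j z. (dx (dx (dy (U i j))) z)\<^sup>2)"
       "?S2\<^sup>2 \<le> (b - a) * (d - c) * csum (\<lambda>i j z. (dx (dy (dy (U i j))) z)\<^sup>2)"
    by (intro cell_sum_cauchy_schwarz gx gy ab cd cont_poly; simp)+
  moreover have "L1_mixed\<^sup>2 \<le> 2 * (?S1\<^sup>2 + ?S2\<^sup>2)"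
    unfolding L1_mixed_def using zero_le_power2[of "?S1 - ?S2"] by (simp add: power2_eq_square algebra_simps)
  ultimately show ?thesis unfolding energy_def by (simp add: algebra_simps)
qed

lemma cell_sum_swapped:
  assumes "\<And>i j. polyfun (F i j)"
  shows "cell_sum y N x M (\<lambda>j i z. \<bar>F i j (prod.swap z)\<bar>) = csum (\<lambda>i j z. \<bar>F i j z\<bar>)"
  using cell_sum_swap[OF cont_abs[of F, OF assms], of y N x M] by simp

lemma sup_bounds:
  assumes "i < M" "s \<in> {x i..x (Suc i)}" "j < N" "t \<in> {y j..y (Suc j)}"
  shows "\<bar>U i j (s, t)\<bar> \<le> 2 * L1_mixed * (b - a)" "\<bar>dx (U i j) (s, t)\<bar> \<le> 2 * L1_mixed" "\<bar>dy (U i j) (s, t)\<bar> \<le> 2 * L1_mixed"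
proof -
  interpret sw: trial_family c d a b N y M x "\<lambda>j i z. U i j (prod.swap z)" by (rule swap)
  have "\<bar>U i j (s, t)\<bar> \<le> 2 * csum (\<lambda>i j z. \<bar>dx (dx (dy (U i j))) z\<bar>) * (b - a)"
    by (rule sup_U) (use assms in auto)
  also have "\<dots> \<le> 2 * L1_mixed * (b - a)"
    using L1_mixed_ge(2) ab by (intro mult_right_mono) auto
  finally show "\<bar>U i j (s, t)\<bar> \<le> 2 * L1_mixed * (b - a)" .
  show "\<bar>dx (U i j) (s, t)\<bar> \<le> 2 * L1_mixed" using sup_dx[OF assms] L1_mixed_ge(2) by linarith
  have "\<bar>dy (U i j) (s, t)\<bar> \<le> 2 * csum (\<lambda>i j z. \<bar>dx (dy (dy (U i j))) z\<bar>)"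
    using sw.sup_dx[of j t i s] assms cell_sum_swapped[of "\<lambda>i j. dx (dy (dy (U i j)))"]
    by (simp add: dx_swap dy_swap)
  then show "\<bar>dy (U i j) (s, t)\<bar> \<le> 2 * L1_mixed" using L1_mixed_ge(3) by linarith
qed

lemma L1_second:
  "csum (\<lambda>i j z. \<bar>dx (dx (U i j)) z\<bar>) \<le> (d - c) * L1_mixed"
  "csum (\<lambda>i j z. \<bar>dy (dy (U i j)) z\<bar>) \<le> (b - a) * L1_mixed"
proof -
  interpret sw: trial_family c d a b N y M x "\<lambda>j i z. U i j (prod.swap z)" by (rule swap)
  show "csum (\<lambda>i j z. \<bar>dx (dx (U i j)) z\<bar>) \<le> (d - c) * L1_mixed"
    using L1_dxx mult_left_mono[OF L1_mixed_ge(2), of "d - c"] cd by linarith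
  have "csum (\<lambda>i j z. \<bar>dy (dy (U i j)) z\<bar>) \<le> (b - a) * csum (\<lambda>i j z. \<bar>dx (dy (dy (U i j))) z\<bar>)"
    using sw.L1_dxx cell_sum_swapped[of "\<lambda>i j. dx (dy (dy (U i j)))"] cell_sum_swapped[of "\<lambda>i j. dy (dy (U i j))"]
    by (simp add: dx_swap dy_swap)
  then show "csum (\<lambda>i j z. \<bar>dy (dy (U i j)) z\<bar>) \<le> (b - a) * L1_mixed"
    using mult_left_mono[OF L1_mixed_ge(3), of "b - a"] ab by linarith
qed

text \<open>With \<open>?Z\<close> the squared norm of u_xy, the test by u_xxyy reads
  \<open>\<alpha> * energy + \<gamma> * ?Z = b1 * ?P1 + b2 * ?P2\<close>. Absorbing half of the
  energy leaves \<open>energy \<le> (K - 1) * ?Z\<close>. Then \<open>?Z\<close> is interpolated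
  between u_x and u_xyy, and the energy part is absorbed once more; each of the two stages costs a
  factor \<open>K\<close>. The summand 1 in \<open>K\<close> keeps it positive when the convection
  vanishes.\<close>

lemma energy_estimate:
  assumes al: "\<alpha> > 0" and ga: "\<gamma> \<ge> 0"
    and orth: "csum (\<lambda>i j z. cd_op \<alpha> b1 b2 \<gamma> (U i j) z * dx (dx (dy (dy (U i j)))) z) = 0"
    and K: "K = (b1\<^sup>2 + b2\<^sup>2) / \<alpha>\<^sup>2 + 1"
  shows "energy \<le> K\<^sup>2 * csum (\<lambda>i j z. (dx (U i j) z)\<^sup>2)"
proof -
  let ?Z = "csum (\<lambda>i j z. (dx (dy (U i j)) z)\<^sup>2)"
  let ?E1 = "csum (\<lambda>i j z. (dx (dx (dy (U i j))) z)\<^sup>2)" and ?E2 = "csum (\<lambda>i j z. (dx (dy (dy (U i j))) z)\<^sup>2)"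
  let ?P1 = "csum (\<lambda>i j z. dx (dy (U i j)) z * dx (dx (dy (U i j))) z)"
  let ?P2 = "csum (\<lambda>i j z. dx (dy (U i j)) z * dx (dy (dy (U i j))) z)"
  let ?Q = "\<lambda>i j. dx (dx (dy (dy (U i j))))"
  have K1: "K \<ge> 1" unfolding K by simp
  have Z0: "?Z \<ge> 0" and E0: "?E1 \<ge> 0" "?E2 \<ge> 0" and Ux0: "csum (\<lambda>i j z. (dx (U i j) z)\<^sup>2) \<ge> 0"
    by (rule cell_sum_sq_nonneg, simp)+
  have "0 = csum (\<lambda>i j z. (-\<alpha>) * (dx (dx (U i j)) z * ?Q i j z) + (-\<alpha>) * (dy (dy (U i j)) z * ?Q i j z)
      + b1 * (dx (U i j) z * ?Q i j z) + b2 * (dy (U i j) z * ?Q i j z) + \<gamma> * (U i j z * ?Q i j z))"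
    unfolding orth[symmetric] cd_op_def by (simp add: algebra_simps)
  also have "\<dots> = (-\<alpha>) * (- ?E1) + (-\<alpha>) * (- ?E2) + b1 * (- ?P1) + b2 * (- ?P2) + \<gamma> * ?Z"
    by (subst cell_sum_lincomb5) (simp_all only: energy_xx energy_yy energy_x energy_y energy_0,
      (rule cont_prod; simp)+)
  finally have eq: "\<alpha> * energy + \<gamma> * ?Z = b1 * ?P1 + b2 * ?P2" unfolding energy_def by (simp add: algebra_simps)
  \<comment> \<open>Young's inequality with parameter \<alpha>, so that the two convection terms
    together use up exactly half of \<open>\<alpha> * energy\<close>.\<close>
  have y: "bb * csum (\<lambda>i j z. dx (dy (U i j)) z * W i j z) \<le> \<alpha> / 2 * csum (\<lambda>i j z. (W i j z)\<^sup>2) + bb\<^sup>2 / (2 * \<alpha>) * ?Z"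
    if "\<And>i j. polyfun (W i j)" for W bb
  proof -
    have "cont_fam (\<lambda>i j z. bb * dx (dy (U i j)) z)"
      by (auto intro!: continuous_on_mult continuous_on_const)
    from cell_sum_young[OF al cont_poly[of W, OF that] this, of x M y N]
    show ?thesis
      by (simp add: power_mult_distrib cell_sum_cmult mult_ac
          cell_sum_cmult[of x M y N bb "\<lambda>i j z. dx (dy (U i j)) z * W i j z", symmetric])
  qed
  have "b1 * ?P1 \<le> \<alpha> / 2 * ?E1 + b1\<^sup>2 / (2 * \<alpha>) * ?Z" "b2 * ?P2 \<le> \<alpha> / 2 * ?E2 + b2\<^sup>2 / (2 * \<alpha>) * ?Z"
    by (rule y, simp)+
  with eq have "\<alpha> * energy + \<gamma> * ?Z \<le> \<alpha> / 2 * energy + (b1\<^sup>2 + b2\<^sup>2) / (2 * \<alpha>) * ?Z"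
    unfolding energy_def by (simp add: algebra_simps add_divide_distrib)
  moreover have "\<gamma> * ?Z \<ge> 0" using ga Z0 by simp
  ultimately have "\<alpha> / 2 * energy \<le> (b1\<^sup>2 + b2\<^sup>2) / (2 * \<alpha>) * ?Z" by linarith
  then have "(2 / \<alpha>) * (\<alpha> / 2 * energy) \<le> (2 / \<alpha>) * ((b1\<^sup>2 + b2\<^sup>2) / (2 * \<alpha>) * ?Z)"
    using al by (intro mult_left_mono) auto
  then have "energy \<le> (K - 1) * ?Z" using al by (simp add: K power2_eq_square)
  then have EK: "energy \<le> K * ?Z" using Z0 by (simp add: algebra_simps)
  have cU: "cont_fam (\<lambda>i j. dx (U i j))" "cont_fam (\<lambda>i j z. - dx (dy (dy (U i j))) z)"
    by (auto intro!: continuous_on_minus)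
  have "?Z = csum (\<lambda>i j z. dx (U i j) z * (- dx (dy (dy (U i j))) z))"
    using mixed_sq cell_sum_cmult[of x M y N "-1" "\<lambda>i j z. dx (U i j) z * dx (dy (dy (U i j))) z"] by simp
  \<comment> \<open>Young's inequality with parameter \<open>K\<close>: as
    \<open>?E2 \<le> energy \<le> K * ?Z\<close>, the last term becomes \<open>?Z / 2\<close> and
    moves to the left.\<close>
  also have "\<dots> \<le> K / 2 * csum (\<lambda>i j z. (dx (U i j) z)\<^sup>2) + 1 / (2 * K) * ?E2"
    using cell_sum_young[OF _ cU, of K x M y N] K1 by simp
  also have "1 / (2 * K) * ?E2 \<le> 1 / (2 * K) * (K * ?Z)"
    using K1 EK E0 unfolding energy_def by (intro mult_left_mono) auto
  also have "\<dots> = ?Z / 2" using K1 by simp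
  finally have "?Z \<le> K * csum (\<lambda>i j z. (dx (U i j) z)\<^sup>2)" by (simp add: field_simps)
  then have "K * ?Z \<le> K * (K * csum (\<lambda>i j z. (dx (U i j) z)\<^sup>2))" using K1 by (intro mult_left_mono) auto
  with EK show ?thesis by (simp add: power2_eq_square mult.assoc)
qed

end

section \<open>Exponential weight, coercivity and oscillation on cells\<close>

definition rho :: "real \<Rightarrow> real \<Rightarrow> real \<Rightarrow> plane \<Rightarrow> real" where
  "rho \<alpha> b1 b2 z = exp (- (b1 * fst z + b2 * snd z) / \<alpha>)"

lemma rho_continuous: "continuous_on S (rho \<alpha> b1 b2)"
  unfolding rho_def divide_inverse by (intro continuous_intros)

lemma rho_der_x: "((\<lambda>s. rho \<alpha> b1 b2 (s, t)) has_real_derivative rho \<alpha> b1 b2 (s, t) * (- b1 / \<alpha>)) (at s)"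
  unfolding rho_def by (auto intro!: derivative_eq_intros simp: divide_inverse)

lemma rho_der_y: "((\<lambda>t. rho \<alpha> b1 b2 (s, t)) has_real_derivative rho \<alpha> b1 b2 (s, t) * (- b2 / \<alpha>)) (at t)"
  unfolding rho_def by (auto intro!: derivative_eq_intros simp: divide_inverse)

context trial_family
begin

lemma cell_in_box:
  assumes "i < M" "s \<in> {x i..x (Suc i)}" "j < N" "t \<in> {y j..y (Suc j)}"
  shows "s \<in> {a..b}" "t \<in> {c..d}"
  using assms grid_bounds[OF gx, of i] grid_bounds[OF gx, of "Suc i"]
    grid_bounds[OF gy, of j] grid_bounds[OF gy, of "Suc j"] by auto

text \<open>\<open>?H\<close> is the x-derivative of rho u u_x and \<open>?K\<close> the
  y-derivative of rho u u_y, so both integrate to zero. The gradient of rho is - rho \<beta> /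
  \<alpha>, hence adding \<open>\<alpha> * (?H + ?K)\<close> to the integrand cancels the convection
  and the second derivatives pointwise and leaves a weighted sum of squares.\<close>

lemma weighted_coercive:
  assumes al: "\<alpha> > 0" and ga: "\<gamma> \<ge> 0"
    and r0: "\<And>s t. s \<in> {a..b} \<Longrightarrow> t \<in> {c..d} \<Longrightarrow> r0 \<le> rho \<alpha> b1 b2 (s, t)"
  shows "\<alpha> * r0 * csum (\<lambda>i j z. (dx (U i j) z)\<^sup>2) \<le>
    csum (\<lambda>i j z. cd_op \<alpha> b1 b2 \<gamma> (U i j) z * (rho \<alpha> b1 b2 z * U i j z))"
proof -
  let ?r = "rho \<alpha> b1 b2"
  let ?H = "\<lambda>i j z. ?r z * (- b1 / \<alpha>) * (U i j z * dx (U i j) z) + ?r z * ((dx (U i j) z)\<^sup>2 + U i j z * dx (dx (U i j)) z)"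
  let ?K = "\<lambda>i j z. ?r z * (- b2 / \<alpha>) * (U i j z * dy (U i j) z) + ?r z * ((dy (U i j) z)\<^sup>2 + U i j z * dy (dy (U i j)) z)"
  let ?G = "\<lambda>i j z. cd_op \<alpha> b1 b2 \<gamma> (U i j) z * (?r z * U i j z)"
  have cH: "cont_fam ?H" and cK: "cont_fam ?K"
    by (intro allI continuous_on_add continuous_on_mult continuous_on_power continuous_on_const
        rho_continuous polyfun_continuous; simp)+
  have cG: "cont_fam ?G"
    by (auto intro!: continuous_on_mult rho_continuous cd_op_continuous)
  have "csum ?H = 0"
  proof (rule cell_sum_dx_zero[OF cH, where F="\<lambda>i j z. ?r z * (U i j z * dx (U i j) z)"])
    show "((\<lambda>s. ?r (s, t) * (U i j (s, t) * dx (U i j) (s, t))) has_real_derivative ?H i j (s, t)) (at s)" for i j s t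
      by (auto intro!: derivative_eq_intros rho_der_x polyfun_der_x simp: power2_eq_square)
  qed (use match_x match_dx vanish_x in \<open>auto simp: matches_x_def vanishes_x_def\<close>)
  moreover have "csum ?K = 0"
  proof (rule cell_sum_dy_zero[OF cK, where F="\<lambda>i j z. ?r z * (U i j z * dy (U i j) z)"])
    show "((\<lambda>t. ?r (s, t) * (U i j (s, t) * dy (U i j) (s, t))) has_real_derivative ?K i j (s, t)) (at t)" for i j s t
      by (auto intro!: derivative_eq_intros rho_der_y polyfun_der_y simp: power2_eq_square)
  qed (use match_y match_dy vanish_y in \<open>auto simp: matches_y_def vanishes_y_def\<close>)
  ultimately have "csum ?G = csum (\<lambda>i j z. ?G i j z + \<alpha> * (?H i j z + ?K i j z))"
  proof -
    have cHK: "cont_fam (\<lambda>i j z. \<alpha> * (?H i j z + ?K i j z))"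
      by (intro allI continuous_on_mult[OF continuous_on_const continuous_on_add]
          cH[rule_format] cK[rule_format])
    show ?thesis
      unfolding cell_sum_add[OF cG cHK] cell_sum_cmult cell_sum_add[OF cH cK] \<open>csum ?H = 0\<close> \<open>csum ?K = 0\<close> by simp
  qed
  also have "(\<lambda>i j z. ?G i j z + \<alpha> * (?H i j z + ?K i j z)) =
      (\<lambda>i j z. ?r z * (\<gamma> * (U i j z)\<^sup>2 + \<alpha> * ((dx (U i j) z)\<^sup>2 + (dy (U i j) z)\<^sup>2)))"
    using al by (auto simp: fun_eq_iff cd_op_def power2_eq_square field_simps)
  finally have eq: "csum ?G = csum (\<lambda>i j z. ?r z * (\<gamma> * (U i j z)\<^sup>2 + \<alpha> * ((dx (U i j) z)\<^sup>2 + (dy (U i j) z)\<^sup>2)))" .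
  \<comment> \<open>The squares of u and u_y are nonnegative and dropped;
    \<open>energy_estimate\<close> asks for u_x only.\<close>
  have "csum (\<lambda>i j z. \<alpha> * r0 * (dx (U i j) z)\<^sup>2) \<le> csum ?G"
    unfolding eq
  proof (rule cell_sum_mono)
    fix i j s t assume "i < M" "j < N" "s \<in> {x i..x (Suc i)}" "t \<in> {y j..y (Suc j)}"
    then have "r0 \<le> ?r (s, t)" using cell_in_box r0 by blast
    then have "r0 * (\<alpha> * (dx (U i j) (s, t))\<^sup>2) \<le> ?r (s, t) * (\<alpha> * (dx (U i j) (s, t))\<^sup>2)"
      using al by (intro mult_right_mono) auto
    also have "\<dots> \<le> ?r (s, t) * (\<gamma> * (U i j (s, t))\<^sup>2 + \<alpha> * ((dx (U i j) (s, t))\<^sup>2 + (dy (U i j) (s, t))\<^sup>2))"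
      using al ga by (intro mult_left_mono) (auto simp: algebra_simps rho_def)
    finally show "\<alpha> * r0 * (dx (U i j) (s, t))\<^sup>2 \<le> ?r (s, t) * (\<gamma> * (U i j (s, t))\<^sup>2 + \<alpha> * ((dx (U i j) (s, t))\<^sup>2 + (dy (U i j) (s, t))\<^sup>2))"
      by (simp add: mult_ac)
  qed (intro allI continuous_on_add continuous_on_mult continuous_on_power continuous_on_const
        rho_continuous polyfun_continuous; simp)+
  then show ?thesis unfolding cell_sum_cmult .
qed

text \<open>Second derivatives are controlled only in L1, by \<open>L1_second\<close>; the lower
  order terms are bounded pointwise by the constant \<open>?k\<close>, which contributes
  \<open>?k\<close> times the area.\<close>

lemma L1_cd_op:
  assumes al: "\<alpha> > 0" and ga: "\<gamma> \<ge> 0"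
  shows "csum (\<lambda>i j z. \<bar>cd_op \<alpha> b1 b2 \<gamma> (U i j) z\<bar>) \<le>
    (\<alpha> * ((d - c) + (b - a)) + (2 * (\<bar>b1\<bar> + \<bar>b2\<bar>) + 2 * \<gamma> * (b - a)) * (b - a) * (d - c)) * L1_mixed"
proof -
  let ?k = "(2 * (\<bar>b1\<bar> + \<bar>b2\<bar>) + 2 * \<gamma> * (b - a)) * L1_mixed"
  have c: "cont_fam (\<lambda>i j z. \<alpha> * \<bar>dx (dx (U i j)) z\<bar>)" "cont_fam (\<lambda>i j z. \<alpha> * \<bar>dy (dy (U i j)) z\<bar>)"
    "cont_fam (\<lambda>i j z. \<alpha> * \<bar>dx (dx (U i j)) z\<bar> + \<alpha> * \<bar>dy (dy (U i j)) z\<bar>)"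
    by (auto intro!: continuous_on_add continuous_on_mult continuous_on_rabs continuous_on_const)
  have "csum (\<lambda>i j z. \<bar>cd_op \<alpha> b1 b2 \<gamma> (U i j) z\<bar>) \<le>
    csum (\<lambda>i j z. \<alpha> * \<bar>dx (dx (U i j)) z\<bar> + \<alpha> * \<bar>dy (dy (U i j)) z\<bar> + ?k)"
  proof (rule cell_sum_mono)
    fix i j s t assume A: "i < M" "j < N" "s \<in> {x i..x (Suc i)}" "t \<in> {y j..y (Suc j)}"
    let ?z = "(s, t)"
    note sb = sup_bounds[OF A(1,3,2,4)]
    have "\<bar>cd_op \<alpha> b1 b2 \<gamma> (U i j) ?z\<bar> \<le> \<bar>\<alpha> * dx (dx (U i j)) ?z\<bar> + \<bar>\<alpha> * dy (dy (U i j)) ?z\<bar>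
      + \<bar>b1 * dx (U i j) ?z\<bar> + \<bar>b2 * dy (U i j) ?z\<bar> + \<bar>\<gamma> * U i j ?z\<bar>"
      unfolding cd_op_def by (simp add: algebra_simps)
    also have "\<dots> = \<alpha> * \<bar>dx (dx (U i j)) ?z\<bar> + \<alpha> * \<bar>dy (dy (U i j)) ?z\<bar>
      + \<bar>b1\<bar> * \<bar>dx (U i j) ?z\<bar> + \<bar>b2\<bar> * \<bar>dy (U i j) ?z\<bar> + \<gamma> * \<bar>U i j ?z\<bar>"
      using al ga by (simp add: abs_mult)
    also have "\<dots> \<le> \<alpha> * \<bar>dx (dx (U i j)) ?z\<bar> + \<alpha> * \<bar>dy (dy (U i j)) ?z\<bar>
      + \<bar>b1\<bar> * (2 * L1_mixed) + \<bar>b2\<bar> * (2 * L1_mixed) + \<gamma> * (2 * L1_mixed * (b - a))"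
      using sb ga by (intro add_mono mult_left_mono order_refl) auto
    also have "\<dots> = \<alpha> * \<bar>dx (dx (U i j)) ?z\<bar> + \<alpha> * \<bar>dy (dy (U i j)) ?z\<bar> + ?k"
      by (simp add: algebra_simps)
    finally show "\<bar>cd_op \<alpha> b1 b2 \<gamma> (U i j) ?z\<bar> \<le> \<alpha> * \<bar>dx (dx (U i j)) ?z\<bar> + \<alpha> * \<bar>dy (dy (U i j)) ?z\<bar> + ?k" .
  qed (use c in \<open>auto intro!: continuous_on_add continuous_on_const continuous_on_rabs cd_op_continuous\<close>)
  also have "\<dots> = \<alpha> * csum (\<lambda>i j z. \<bar>dx (dx (U i j)) z\<bar>) + \<alpha> * csum (\<lambda>i j z. \<bar>dy (dy (U i j)) z\<bar>) + ?k * (b - a) * (d - c)"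
    by (subst cell_sum_add[OF c(3)]) (auto simp: cell_sum_add[OF c(1,2)] cell_sum_cmult cell_sum_const[OF gx gy])
  also have "\<dots> \<le> \<alpha> * ((d - c) * L1_mixed) + \<alpha> * ((b - a) * L1_mixed) + ?k * (b - a) * (d - c)"
    using L1_second al by (intro add_mono mult_left_mono order_refl) auto
  finally show ?thesis by (simp add: algebra_simps)
qed

text \<open>The point is reached from the lower left corner by a horizontal and then a vertical
  segment inside the cell, each of length at most \<open>h\<close>. The two partial derivatives of
  the weighted function are bounded by the sup bounds, and the 4 is the sum of the two constants
  2.\<close>

lemma oscillation:
  assumes al: "\<alpha> > 0"
    and R: "\<And>s t. s \<in> {a..b} \<Longrightarrow> t \<in> {c..d} \<Longrightarrow> rho \<alpha> b1 b2 (s, t) \<le> R"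
    and h: "\<And>i. i < M \<Longrightarrow> x (Suc i) - x i \<le> h" "\<And>j. j < N \<Longrightarrow> y (Suc j) - y j \<le> h"
    and cell: "i < M" "s \<in> {x i..x (Suc i)}" "j < N" "t \<in> {y j..y (Suc j)}"
  shows "\<bar>rho \<alpha> b1 b2 (s, t) * U i j (s, t) - rho \<alpha> b1 b2 (x i, y j) * U i j (x i, y j)\<bar>
    \<le> h * (R * (2 * (\<bar>b1\<bar> + \<bar>b2\<bar>) / \<alpha> * (b - a) + 4)) * L1_mixed"
proof -
  let ?r = "rho \<alpha> b1 b2"
  \<comment> \<open>Both partial derivatives in one statement: \<open>bb\<close> is
    \<open>b1\<close> or \<open>b2\<close>, and \<open>D\<close> is the corresponding derivative of
    \<open>U i j\<close>.\<close>
  have grad: "\<bar>?r (s, t) * (- bb / \<alpha>) * U i j (s, t) + ?r (s, t) * D\<bar> \<le> R * (2 * \<bar>bb\<bar> / \<alpha> * (b - a) + 2) * L1_mixed"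
    if "s \<in> {x i..x (Suc i)}" "t \<in> {y j..y (Suc j)}" "\<bar>D\<bar> \<le> 2 * L1_mixed" for s t bb D
  proof -
    have r: "0 \<le> ?r (s, t)" "?r (s, t) \<le> R"
      using R[OF cell_in_box] cell that by (auto simp: rho_def)
    have "\<bar>(- bb / \<alpha>) * U i j (s, t) + D\<bar> \<le> \<bar>bb\<bar> / \<alpha> * \<bar>U i j (s, t)\<bar> + \<bar>D\<bar>"
      using al by (intro order_trans[OF abs_triangle_ineq]) (simp add: abs_mult)
    also have "\<dots> \<le> \<bar>bb\<bar> / \<alpha> * (2 * L1_mixed * (b - a)) + 2 * L1_mixed"
      using sup_bounds(1)[OF cell(1) that(1) cell(3) that(2)] that(3) al
      by (intro add_mono mult_left_mono) auto
    also have "\<dots> = (2 * \<bar>bb\<bar> / \<alpha> * (b - a) + 2) * L1_mixed"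
      using al by (simp add: field_simps)
    finally have *: "\<bar>(- bb / \<alpha>) * U i j (s, t) + D\<bar> \<le> (2 * \<bar>bb\<bar> / \<alpha> * (b - a) + 2) * L1_mixed" .
    have "\<bar>?r (s, t) * (- bb / \<alpha>) * U i j (s, t) + ?r (s, t) * D\<bar> = ?r (s, t) * \<bar>(- bb / \<alpha>) * U i j (s, t) + D\<bar>"
    proof -
      have "?r (s, t) * (- bb / \<alpha>) * U i j (s, t) + ?r (s, t) * D = ?r (s, t) * ((- bb / \<alpha>) * U i j (s, t) + D)"
        by (simp only: distrib_left mult.assoc)
      then show ?thesis using r(1) by (simp only: abs_mult abs_of_nonneg)
    qed
    also have "\<dots> \<le> R * ((2 * \<bar>bb\<bar> / \<alpha> * (b - a) + 2) * L1_mixed)"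
      using r * by (intro mult_mono) auto
    finally show ?thesis by (simp add: mult.assoc)
  qed
  have dfx: "((\<lambda>s. ?r (s, t) * U i j (s, t)) has_real_derivative ?r (s, t) * (- b1 / \<alpha>) * U i j (s, t) + ?r (s, t) * dx (U i j) (s, t)) (at s within S)" for s t S
    by (rule has_field_derivative_at_within)
      (auto intro!: derivative_eq_intros rho_der_x polyfun_der_x)
  have dfy: "((\<lambda>t. ?r (s, t) * U i j (s, t)) has_real_derivative ?r (s, t) * (- b2 / \<alpha>) * U i j (s, t) + ?r (s, t) * dy (U i j) (s, t)) (at t within S)" for s t S
    by (rule has_field_derivative_at_within)
      (auto intro!: derivative_eq_intros rho_der_y polyfun_der_y)
  \<comment> \<open>The bound in \<open>grad\<close> for \<open>D = 0\<close> dominates an absolute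
    value, so it is nonnegative.\<close>
  have B: "0 \<le> R * (2 * \<bar>bb\<bar> / \<alpha> * (b - a) + 2) * L1_mixed" for bb
    by (rule order_trans[OF abs_ge_zero grad[OF cell(2,4), of 0 bb]]) (use L1_mixed_ge(1) in simp)
  have corner: "x i \<in> {x i..x (Suc i)}" "y j \<in> {y j..y (Suc j)}"
    using cell by auto
  have "\<bar>?r (s, y j) * U i j (s, y j) - ?r (x i, y j) * U i j (x i, y j)\<bar> \<le> (R * (2 * \<bar>b1\<bar> / \<alpha> * (b - a) + 2) * L1_mixed) * \<bar>s - x i\<bar>"
    using field_differentiable_bound[of "{x i..x (Suc i)}" "\<lambda>s. ?r (s, y j) * U i j (s, y j)", OF _ dfx, of _ s "x i"]
      grad[OF _ corner(2) sup_bounds(2)] cell corner by auto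
  also have "\<dots> \<le> (R * (2 * \<bar>b1\<bar> / \<alpha> * (b - a) + 2) * L1_mixed) * h"
    using h(1)[OF cell(1)] cell by (intro mult_left_mono B) auto
  finally have 1: "\<bar>?r (s, y j) * U i j (s, y j) - ?r (x i, y j) * U i j (x i, y j)\<bar> \<le> (R * (2 * \<bar>b1\<bar> / \<alpha> * (b - a) + 2) * L1_mixed) * h" .
  have "\<bar>?r (s, t) * U i j (s, t) - ?r (s, y j) * U i j (s, y j)\<bar> \<le> (R * (2 * \<bar>b2\<bar> / \<alpha> * (b - a) + 2) * L1_mixed) * \<bar>t - y j\<bar>"
    using field_differentiable_bound[of "{y j..y (Suc j)}" "\<lambda>t. ?r (s, t) * U i j (s, t)", OF _ dfy, of _ t "y j"]
      grad[OF cell(2) _ sup_bounds(3)] cell corner by auto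
  also have "\<dots> \<le> (R * (2 * \<bar>b2\<bar> / \<alpha> * (b - a) + 2) * L1_mixed) * h"
    using h(2)[OF cell(3)] cell by (intro mult_left_mono B) auto
  finally have "\<bar>?r (s, t) * U i j (s, t) - ?r (x i, y j) * U i j (x i, y j)\<bar> \<le>
     (R * (2 * \<bar>b1\<bar> / \<alpha> * (b - a) + 2) * L1_mixed) * h + (R * (2 * \<bar>b2\<bar> / \<alpha> * (b - a) + 2) * L1_mixed) * h"
    using 1 by linarith
  also have "\<dots> = h * (R * (2 * (\<bar>b1\<bar> + \<bar>b2\<bar>) / \<alpha> * (b - a) + 4)) * L1_mixed"
    by (simp add: algebra_simps add_divide_distrib)
  finally show ?thesis .
qed

text \<open>The sup norm of the oscillation and the L1 norm of L u are each a constant times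
  \<open>L1_mixed\<close>, the first with a factor \<open>h\<close>. Their product is at most a
  multiple of \<open>h * energy\<close>, while \<open>energy_estimate\<close> bounds
  \<open>energy\<close> by the quantity just estimated. So the same number stands on both
  sides.\<close>

lemma discrete_stability:
  assumes al: "\<alpha> > 0" and ga: "\<gamma> \<ge> 0"
    and R: "\<And>s t. s \<in> {a..b} \<Longrightarrow> t \<in> {c..d} \<Longrightarrow> rho \<alpha> b1 b2 (s, t) \<le> R"
    and r0: "\<And>s t. s \<in> {a..b} \<Longrightarrow> t \<in> {c..d} \<Longrightarrow> r0 \<le> rho \<alpha> b1 b2 (s, t)"
    and h: "\<And>i. i < M \<Longrightarrow> x (Suc i) - x i \<le> h" "\<And>j. j < N \<Longrightarrow> y (Suc j) - y j \<le> h" "h > 0"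
    and orth: "csum (\<lambda>i j z. cd_op \<alpha> b1 b2 \<gamma> (U i j) z * dx (dx (dy (dy (U i j)))) z) = 0"
      "\<And>k. csum (\<lambda>i j z. cd_op \<alpha> b1 b2 \<gamma> (U i j) z * k i j) = 0"
    and C: "kL = \<alpha> * ((d - c) + (b - a)) + (2 * (\<bar>b1\<bar> + \<bar>b2\<bar>) + 2 * \<gamma> * (b - a)) * (b - a) * (d - c)"
      "kV = R * (2 * (\<bar>b1\<bar> + \<bar>b2\<bar>) / \<alpha> * (b - a) + 4)" "K = (b1\<^sup>2 + b2\<^sup>2) / \<alpha>\<^sup>2 + 1"
    and r0pos: "r0 > 0"
  shows "\<alpha> * r0 * energy \<le> h * (K\<^sup>2 * kV * kL * (2 * ((b - a) * (d - c)))) * energy"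
proof -
  let ?X = "csum (\<lambda>i j z. (dx (U i j) z)\<^sup>2)"
  let ?L = "\<lambda>i j. cd_op \<alpha> b1 b2 \<gamma> (U i j)"
  let ?r = "rho \<alpha> b1 b2"
  \<comment> \<open>Constant on each cell, so orthogonality allows it to be subtracted; the corner
    value serves in place of a cell mean.\<close>
  define V where "V i j = ?r (x i, y j) * U i j (x i, y j)" for i j
  have kL: "kL \<ge> 0" unfolding C using al ga ab cd by simp
  have "R \<ge> 0" using R[of a c] ab cd by (simp add: rho_def) (meson exp_ge_zero order_trans)
  then have kV: "kV \<ge> 0" unfolding C using al ab by simp
  have cL: "cont_fam ?L" by (simp add: cd_op_continuous)
  have cd1: "cont_fam (\<lambda>i j z. ?L i j z * (?r z * U i j z))" "cont_fam (\<lambda>i j z. ?L i j z * V i j)"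
    by (auto intro!: continuous_on_mult continuous_on_const rho_continuous cd_op_continuous)
  have "\<alpha> * r0 * ?X \<le> csum (\<lambda>i j z. ?L i j z * (?r z * U i j z))"
    by (rule weighted_coercive[OF al ga r0])
  also have "\<dots> = csum (\<lambda>i j z. ?L i j z * (?r z * U i j z - V i j))"
    unfolding right_diff_distrib cell_sum_diff[OF cd1] orth(2) by simp
  also have "\<dots> \<le> csum (\<lambda>i j z. h * kV * L1_mixed * \<bar>?L i j z\<bar>)"
  proof (rule cell_sum_mono)
    fix i j s t assume A: "i < M" "j < N" "s \<in> {x i..x (Suc i)}" "t \<in> {y j..y (Suc j)}"
    have "\<bar>?r (s, t) * U i j (s, t) - V i j\<bar> \<le> h * kV * L1_mixed"
      unfolding V_def C by (rule oscillation) (use al R h A in auto)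
    then have "\<bar>?L i j (s, t)\<bar> * \<bar>?r (s, t) * U i j (s, t) - V i j\<bar> \<le> \<bar>?L i j (s, t)\<bar> * (h * kV * L1_mixed)"
      by (rule mult_left_mono) simp
    moreover have "?L i j (s, t) * (?r (s, t) * U i j (s, t) - V i j) \<le> \<bar>?L i j (s, t)\<bar> * \<bar>?r (s, t) * U i j (s, t) - V i j\<bar>"
      by (metis abs_ge_self abs_mult)
    ultimately show "?L i j (s, t) * (?r (s, t) * U i j (s, t) - V i j) \<le> h * kV * L1_mixed * \<bar>?L i j (s, t)\<bar>"
      by (simp add: mult_ac)
  qed (auto intro!: continuous_on_mult continuous_on_const continuous_on_diff continuous_on_rabs rho_continuous cd_op_continuous)
  also have "\<dots> = h * kV * L1_mixed * csum (\<lambda>i j z. \<bar>?L i j z\<bar>)" by (rule cell_sum_cmult)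
  also have "\<dots> \<le> h * kV * L1_mixed * (kL * L1_mixed)"
    using L1_cd_op[OF al ga, of b1 b2] kV L1_mixed_ge(1) h(3) unfolding C(1) by (intro mult_left_mono) auto
  also have "\<dots> = h * kV * kL * L1_mixed\<^sup>2" by (simp add: power2_eq_square)
  also have "\<dots> \<le> h * kV * kL * (2 * ((b - a) * (d - c)) * energy)"
    using L1_mixed_sq kL kV h(3) by (intro mult_left_mono) auto
  finally have "K\<^sup>2 * (\<alpha> * r0 * ?X) \<le> K\<^sup>2 * (h * kV * kL * (2 * ((b - a) * (d - c)) * energy))"
    by (rule mult_left_mono) simp
  moreover have "\<alpha> * r0 * energy \<le> \<alpha> * r0 * (K\<^sup>2 * ?X)"
    using energy_estimate[OF al ga orth(1) C(3)] al r0pos by (intro mult_left_mono) auto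
  ultimately show ?thesis by (simp add: mult_ac)
qed

lemma zero_if_energy_zero:
  assumes "energy = 0" "i < M" "s \<in> {x i..x (Suc i)}" "j < N" "t \<in> {y j..y (Suc j)}"
  shows "U i j (s, t) = 0"
proof -
  have "L1_mixed = 0" using L1_mixed_sq assms(1) by simp
  then show ?thesis using sup_bounds(1)[OF assms(2-)] by simp
qed

end

text \<open>The bounds of the weight are its extrema over the compact rectangle, and every other
  constant is explicit in the rectangle and the coefficients. So \<open>h0\<close> is fixed before
  the mesh and the family, and is independent of the polynomial degree as well.\<close>

theorem uniform_stability:
  assumes "a < b" "c < d" and al: "\<alpha> > 0" and ga: "\<gamma> \<ge> 0"
  shows "\<exists>h0>0. \<forall>M N x y U. trial_family a b c d M x N y U \<longrightarrow>
    (\<forall>i<M. x (Suc i) - x i \<le> h0) \<longrightarrow> (\<forall>j<N. y (Suc j) - y j \<le> h0) \<longrightarrow>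
    cell_sum x M y N (\<lambda>i j z. cd_op \<alpha> b1 b2 \<gamma> (U i j) z * dx (dx (dy (dy (U i j)))) z) = 0 \<longrightarrow>
    (\<forall>k. cell_sum x M y N (\<lambda>i j z. cd_op \<alpha> b1 b2 \<gamma> (U i j) z * k i j) = 0) \<longrightarrow>
    (\<forall>i<M. \<forall>j<N. \<forall>s\<in>{x i..x (Suc i)}. \<forall>t\<in>{y j..y (Suc j)}. U i j (s, t) = 0)"
proof -
  define r where "r z = exp (- (b1 * fst z + b2 * snd z) / \<alpha>)" for z :: plane
  have cr: "continuous_on S r" for S
    unfolding r_def divide_inverse by (intro continuous_intros)
  have ne: "cbox (a, c) (b, d) \<noteq> {}" using assms by (simp add: cbox_Pair_eq)
  obtain z0 where z0: "\<And>z. z \<in> cbox (a, c) (b, d) \<Longrightarrow> r z0 \<le> r z"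
    using continuous_attains_inf[OF compact_cbox ne cr] by blast
  obtain z1 where z1: "\<And>z. z \<in> cbox (a, c) (b, d) \<Longrightarrow> r z \<le> r z1"
    using continuous_attains_sup[OF compact_cbox ne cr] by blast
  define kL where "kL = \<alpha> * ((d - c) + (b - a)) + (2 * (\<bar>b1\<bar> + \<bar>b2\<bar>) + 2 * \<gamma> * (b - a)) * (b - a) * (d - c)"
  define kV where "kV = r z1 * (2 * (\<bar>b1\<bar> + \<bar>b2\<bar>) / \<alpha> * (b - a) + 4)"
  define K where "K = (b1\<^sup>2 + b2\<^sup>2) / \<alpha>\<^sup>2 + 1"
  define C where "C = K\<^sup>2 * kV * kL * (2 * ((b - a) * (d - c)))"
  have r0: "r z0 > 0" "r z1 > 0" by (simp_all add: r_def)
  have "kL \<ge> 0" "kV \<ge> 0" unfolding kL_def kV_def using assms r0 by simp_all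
  then have C: "C \<ge> 0" unfolding C_def using assms by simp
  \<comment> \<open>Makes \<open>h0 * C\<close> strictly smaller than
    \<open>\<alpha> * r z0\<close>; the added 1 avoids a division by zero if \<open>C\<close>
    vanishes.\<close>
  define h0 where "h0 = \<alpha> * r z0 / (2 * (C + 1))"
  have h0: "h0 > 0" unfolding h0_def using al r0 C by simp
  have small: "h0 * C < \<alpha> * r z0"
  proof -
    have "h0 * C = \<alpha> * r z0 * (C / (2 * (C + 1)))" by (simp add: h0_def)
    also have "\<dots> < \<alpha> * r z0 * 1"
      using al r0 C by (intro mult_strict_left_mono) auto
    finally show ?thesis by simp
  qed
  show ?thesis
  proof (intro exI[of _ h0] conjI h0 allI impI ballI)
    fix M N x y U i j s t
    assume tf: "trial_family a b c d M x N y U" and h: "\<forall>i<M. x (Suc i) - x i \<le> h0" "\<forall>j<N. y (Suc j) - y j \<le> h0"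
      and o: "cell_sum x M y N (\<lambda>i j z. cd_op \<alpha> b1 b2 \<gamma> (U i j) z * dx (dx (dy (dy (U i j)))) z) = 0"
        "\<forall>k. cell_sum x M y N (\<lambda>i j z. cd_op \<alpha> b1 b2 \<gamma> (U i j) z * k i j) = 0"
      and cell: "i < M" "j < N" "s \<in> {x i..x (Suc i)}" "t \<in> {y j..y (Suc j)}"
    interpret trial_family a b c d M x N y U by fact
    have "\<alpha> * r z0 * energy \<le> h0 * (K\<^sup>2 * kV * kL * (2 * ((b - a) * (d - c)))) * energy"
      by (rule discrete_stability[OF al ga, where R="r z1" and ?b1.0=b1 and ?b2.0=b2])
        (use z0 z1 h o r0 h0 kL_def kV_def K_def in \<open>auto simp: rho_def r_def cbox_Pair_eq\<close>)
    then have "(\<alpha> * r z0 - h0 * C) * energy \<le> 0" unfolding C_def by (simp add: algebra_simps)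
    then have "energy = 0" using small energy_nonneg by (simp add: mult_le_0_iff)
    then show "U i j (s, t) = 0" using zero_if_energy_zero cell by blast
  qed
qed

subsection \<open>Square linear systems\<close>

text \<open>Gaussian elimination by induction on the equations: a row that is zero on
  \<open>S\<close> is dropped, any other row has a pivot \<open>p\<close>, which eliminates one
  unknown from the remaining rows.\<close>

lemma underdetermined_system:
  fixes A :: "'i \<Rightarrow> 'j \<Rightarrow> real"
  assumes "finite I" "finite S" "card I < card S"
  shows "\<exists>c. (\<forall>i\<in>I. (\<Sum>j\<in>S. A i j * c j) = 0) \<and> (\<exists>j\<in>S. c j \<noteq> 0)"
  using assms
proof (induction I arbitrary: A S rule: finite_induct)
  case empty
  then show ?case by (intro exI[of _ "\<lambda>_. 1"]) (auto simp: card_gt_0_iff)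
next
  case (insert r I)
  show ?case
  proof (cases "\<forall>j\<in>S. A r j = 0")
    case True
    obtain c where "\<forall>i\<in>I. (\<Sum>j\<in>S. A i j * c j) = 0" "\<exists>j\<in>S. c j \<noteq> 0"
      using insert.IH[of S A] insert.prems insert.hyps by auto
    with True show ?thesis by (intro exI[of _ c]) auto
  next
    case False
    then obtain p where p: "p \<in> S" "A r p \<noteq> 0" by blast
    define S' where "S' = S - {p}"
    have S': "finite S'" "p \<notin> S'" "S = insert p S'" using p insert.prems by (auto simp: S'_def)
    have "card I < card S'" using S' insert.prems insert.hyps by simp
    then obtain c where c: "\<forall>i\<in>I. (\<Sum>j\<in>S'. (A i j - A i p * A r j / A r p) * c j) = 0" "\<exists>j\<in>S'. c j \<noteq> 0"
      using insert.IH[of S' "\<lambda>i j. A i j - A i p * A r j / A r p"] S' by auto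
    \<comment> \<open>Back substitution: the pivot unknown is solved for from row
      \<open>r\<close>.\<close>
    define e where "e = c(p := - (\<Sum>j\<in>S'. A r j * c j) / A r p)"
    have e: "(\<Sum>j\<in>S. A i j * e j) = A i p * (- (\<Sum>j\<in>S'. A r j * c j) / A r p) + (\<Sum>j\<in>S'. A i j * c j)" for i
    proof -
      have "(\<Sum>j\<in>S'. A i j * e j) = (\<Sum>j\<in>S'. A i j * c j)"
        using S'(2) by (intro sum.cong) (auto simp: e_def)
      then show ?thesis using S' by (simp add: e_def)
    qed
    have "(\<Sum>j\<in>S. A i j * e j) = 0" if "i \<in> I" for i
    proof -
      have "0 = (\<Sum>j\<in>S'. A i j * c j - A i p / A r p * (A r j * c j))"
        using c(1) that by (simp add: algebra_simps)
      also have "\<dots> = (\<Sum>j\<in>S'. A i j * c j) - A i p / A r p * (\<Sum>j\<in>S'. A r j * c j)"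
        by (simp add: sum_subtractf sum_distrib_left)
      finally show ?thesis unfolding e by simp
    qed
    moreover have "(\<Sum>j\<in>S. A r j * e j) = 0" unfolding e using p by simp
    moreover have "\<exists>j\<in>S. e j \<noteq> 0" using c(2) S' by (auto simp: e_def)
    ultimately show ?thesis by (intro exI[of _ e]) auto
  qed
qed

text \<open>The negated right-hand side is appended as an extra column \<open>None\<close>, which
  gives one unknown more than equations. A nontrivial solution has a nonzero \<open>None\<close>
  entry, since otherwise injectivity kills it, and dividing by this entry solves the system.\<close>

lemma square_system_solvable:
  fixes A :: "'i \<Rightarrow> 'i \<Rightarrow> real"
  assumes fin: "finite I"
    and inj: "\<And>c. (\<forall>i\<in>I. (\<Sum>j\<in>I. A i j * c j) = 0) \<Longrightarrow> \<forall>j\<in>I. c j = 0"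
  shows "\<exists>c. \<forall>i\<in>I. (\<Sum>j\<in>I. A i j * c j) = b i"
proof -
  let ?B = "\<lambda>i oj. case oj of None \<Rightarrow> - b i | Some j \<Rightarrow> A i j"
  let ?S = "insert None (Some ` I)"
  have "card I < card ?S" using fin by (simp add: card_image)
  then obtain c where c: "\<forall>i\<in>I. (\<Sum>j\<in>?S. ?B i j * c j) = 0" "\<exists>j\<in>?S. c j \<noteq> 0"
    using underdetermined_system[of I ?S ?B] fin by auto
  have eq: "(\<Sum>j\<in>I. A i j * c (Some j)) = b i * c None" if "i \<in> I" for i
    using c(1) that fin by (simp add: sum.reindex)
  have "c None \<noteq> 0"
  proof
    assume 0: "c None = 0"
    then have "\<forall>j\<in>I. c (Some j) = 0" using eq inj[of "\<lambda>j. c (Some j)"] by simp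
    with c(2) 0 show False by auto
  qed
  then show ?thesis using eq
    by (intro exI[of _ "\<lambda>j. c (Some j) / c None"]) (simp flip: sum_divide_distrib)
qed

subsection \<open>From trial functions to matching families\<close>

lemma polynomial_zero_on_interval:
  fixes c :: "nat \<Rightarrow> real"
  assumes "l < r" "\<And>t. l < t \<Longrightarrow> t < r \<Longrightarrow> (\<Sum>j\<le>n. c j * t ^ j) = 0" "j \<le> n"
  shows "c j = 0"
proof (rule ccontr)
  assume "c j \<noteq> 0"
  then have "finite {t. (\<Sum>j\<le>n. c j * t ^ j) = 0}"
    using polyfun_finite_roots[where n=n and c=c] assms(3) by blast
  moreover have "{l<..<r} \<subseteq> {t. (\<Sum>j\<le>n. c j * t ^ j) = 0}" using assms(2) by auto
  ultimately show False using infinite_Ioo[OF assms(1)] finite_subset by blast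
qed

lemma polyfun_zero [simp]: "polyfun (\<lambda>_. 0)"
  unfolding polyfun_def Pol_def by (intro exI[of _ 0]) (auto intro!: exI[of _ "\<lambda>_ _. 0"])

lemma Pol_diff:
  assumes "p \<in> Pol m n" "q \<in> Pol m n"
  shows "(\<lambda>z. p z - q z) \<in> Pol m n"
proof -
  obtain C D where "\<forall>s t. p (s, t) = (\<Sum>i\<le>m. \<Sum>j\<le>n. C i j * s ^ i * t ^ j)"
     "\<forall>s t. q (s, t) = (\<Sum>i\<le>m. \<Sum>j\<le>n. D i j * s ^ i * t ^ j)"
    using assms unfolding Pol_def by blast
  then show ?thesis unfolding Pol_def
    by (auto intro!: exI[of _ "\<lambda>i j. C i j - D i j"] simp: sum_subtractf algebra_simps)
qed

lemma polyfun_slice: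
  assumes "polyfun p"
  shows "\<exists>n c. \<forall>t. p (s, t) = (\<Sum>j\<le>n. c j * t ^ j)"
proof -
  obtain m n C where C: "\<forall>s t. p (s, t) = (\<Sum>i\<le>m. \<Sum>j\<le>n. C i j * s ^ i * t ^ j)"
    using assms unfolding Pol_def polyfun_def by blast
  show ?thesis
    by (intro exI[of _ n] exI[of _ "\<lambda>j. \<Sum>i\<le>m. C i j * s ^ i"])
      (simp add: C sum_distrib_right sum.swap[of _ "{..n}" "{..m}"])
qed

lemma sum_extend_degree:
  fixes c :: "nat \<Rightarrow> real"
  assumes "n \<le> n'"
  shows "(\<Sum>j\<le>n. c j * t ^ j) = (\<Sum>j\<le>n'. (if j \<le> n then c j else 0) * t ^ j)"
  using assms by (intro sum.mono_neutral_cong_left) auto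

text \<open>Restricted to a line both sides are polynomials in \<open>t\<close>, and their
  difference has infinitely many zeros. This extends agreement on an open edge to the whole line, as
  the matching predicates demand.\<close>

lemma polyfun_agree_on_line:
  assumes "polyfun p" "polyfun q" "l < r" "\<And>t. l < t \<Longrightarrow> t < r \<Longrightarrow> p (s, t) = q (s, t)"
  shows "p (s, t) = q (s, t)"
proof -
  obtain n1 c1 n2 c2 where c: "\<And>t. p (s, t) = (\<Sum>j\<le>n1. c1 j * t ^ j)" "\<And>t. q (s, t) = (\<Sum>j\<le>n2. c2 j * t ^ j)"
    using polyfun_slice[OF assms(1), of s] polyfun_slice[OF assms(2), of s] by blast
  let ?n = "max n1 n2"
  let ?c = "\<lambda>j. (if j \<le> n1 then c1 j else 0) - (if j \<le> n2 then c2 j else 0)"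
  have e: "p (s, t) - q (s, t) = (\<Sum>j\<le>?n. ?c j * t ^ j)" for t
    unfolding c sum_extend_degree[of n1 ?n c1, simplified] sum_extend_degree[of n2 ?n c2, simplified]
      left_diff_distrib sum_subtractf ..
  have "?c j = 0" if "j \<le> ?n" for j
    by (rule polynomial_zero_on_interval[OF assms(3) _ that]) (use e assms(4) in \<open>simp flip: e\<close>)
  then have "p (s, t) - q (s, t) = 0" unfolding e by (intro sum.neutral) auto
  then show ?thesis by simp
qed

text \<open>The point may be an end of the interval: the derivative within a nondegenerate closed
  interval is already unique, so agreement on one side determines the two-sided derivative of
  \<open>f\<close>.\<close>

lemma derivative_unique_interval:
  fixes f p :: "real \<Rightarrow> real"
  assumes "(f has_real_derivative D) (at s)" "(p has_real_derivative E) (at s)"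
    "l < r" "s \<in> {l..r}" "\<And>s. s \<in> {l..r} \<Longrightarrow> f s = p s"
  shows "D = E"
proof -
  have p: "(p has_vector_derivative E) (at s within cbox l r)"
    using assms(2) has_field_derivative_at_within has_real_derivative_iff_has_vector_derivative by blast
  have "(f has_vector_derivative D) (at s within cbox l r)"
    using assms(1) has_field_derivative_at_within has_real_derivative_iff_has_vector_derivative by blast
  then have "(p has_vector_derivative D) (at s within cbox l r)"
    by (rule has_vector_derivative_transform[rotated 2]) (use assms in auto)
  then show ?thesis
    using vector_derivative_unique_within_closed_interval[OF assms(3) _ _ p] assms(4) by simp
qed

definition cell :: "(nat \<Rightarrow> real) \<Rightarrow> (nat \<Rightarrow> real) \<Rightarrow> nat \<Rightarrow> nat \<Rightarrow> plane set" where
  "cell x y i j = cbox (x i, y j) (x (Suc i), y (Suc j))"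

lemma mem_cell: "(s, t) \<in> cell x y i j \<longleftrightarrow> s \<in> {x i..x (Suc i)} \<and> t \<in> {y j..y (Suc j)}"
  by (simp add: cell_def cbox_Pair_eq)

lemma elem_eq_cell: "elem x y (Suc i) (Suc j) = cell x y i j"
  by (simp add: elem_def cell_def cbox_Pair_eq)

lemma T_h_cells: "T_h M x N y = (\<lambda>(i, j). cell x y i j) ` ({..<M} \<times> {..<N})"
proof -
  have "i \<in> {1..M} \<longleftrightarrow> (\<exists>i'<M. i = Suc i')" for i M
    by (cases i) auto
  then show ?thesis unfolding T_h_def elem_eq_cell[symmetric] by (auto simp: image_iff)
qed

context product_grid
begin

text \<open>At an inner vertical edge \<open>u\<close> has a two-sided x-derivative, and each
  neighbouring polynomial must reproduce it from its own side. Only open edges are examined; mesh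
  vertices and the rest of the line follow by polynomial continuation.\<close>

lemma junction_x:
  assumes poly: "\<And>i j. polyfun (U i j)" and out: "\<And>i j. \<not> (i < M \<and> j < N) \<Longrightarrow> U i j = (\<lambda>_. 0)"
    and agree: "\<And>i j z. i < M \<Longrightarrow> j < N \<Longrightarrow> z \<in> cell x y i j \<Longrightarrow> u z = U i j z"
    and diff: "\<And>s t. a < s \<Longrightarrow> s < b \<Longrightarrow> c < t \<Longrightarrow> t < d \<Longrightarrow> \<exists>D. ((\<lambda>s. u (s, t)) has_real_derivative D) (at s)"
    and bd: "\<And>t. c < t \<Longrightarrow> t < d \<Longrightarrow> u (a, t) = 0 \<and> u (b, t) = 0"
  shows "matches_x x M U" "matches_x x M (\<lambda>i j. dx (U i j))" "vanishes_x a b M U"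
proof -
  have yin: "c < t" "t < d" if "j < N" "y j < t" "t < y (Suc j)" for j t
    using grid_bounds[OF gy, of j] grid_bounds[OF gy, of "Suc j"] that by auto
  show "matches_x x M U" unfolding matches_x_def
  proof (intro allI impI)
    fix i j t assume i: "Suc i < M"
    show "U i j (x (Suc i), t) = U (Suc i) j (x (Suc i), t)"
    proof (cases "j < N")
      case True
      show ?thesis
      proof (rule polyfun_agree_on_line[OF poly poly grid_less[OF gy True]])
        fix t assume t: "y j < t" "t < y (Suc j)"
        show "U i j (x (Suc i), t) = U (Suc i) j (x (Suc i), t)"
          using agree[of i j "(x (Suc i), t)"] agree[of "Suc i" j "(x (Suc i), t)"] i True t
            grid_less[OF gx, of i] grid_less[OF gx, of "Suc i"] by (auto simp: mem_cell)
      qed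
    qed (simp add: out)
  qed
  show "matches_x x M (\<lambda>i j. dx (U i j))" unfolding matches_x_def
  proof (intro allI impI)
    fix i j t assume i: "Suc i < M"
    show "dx (U i j) (x (Suc i), t) = dx (U (Suc i) j) (x (Suc i), t)"
    proof (cases "j < N")
      case True
      show ?thesis
      proof (rule polyfun_agree_on_line[OF polyfun_dx[OF poly] polyfun_dx[OF poly] grid_less[OF gy True]])
        fix t assume t: "y j < t" "t < y (Suc j)"
        have xx: "x i < x (Suc i)" "x (Suc i) < x (Suc (Suc i))"
          using grid_less[OF gx, of i] grid_less[OF gx, of "Suc i"] i by auto
        have "a < x (Suc i)" "x (Suc i) < b"
          using grid_bounds[OF gx, of i] grid_bounds[OF gx, of "Suc (Suc i)"] i xx by auto
        then obtain D where D: "((\<lambda>s. u (s, t)) has_real_derivative D) (at (x (Suc i)))"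
          using diff yin[OF True t] by blast
        have "D = dx (U i j) (x (Suc i), t)"
          by (rule derivative_unique_interval[OF D polyfun_der_x[OF poly] xx(1)])
            (use agree i True t xx in \<open>auto simp: mem_cell\<close>)
        moreover have "D = dx (U (Suc i) j) (x (Suc i), t)"
          by (rule derivative_unique_interval[OF D polyfun_der_x[OF poly] xx(2)])
            (use agree i True t xx in \<open>auto simp: mem_cell\<close>)
        ultimately show "dx (U i j) (x (Suc i), t) = dx (U (Suc i) j) (x (Suc i), t)" by simp
      qed
    qed (simp add: out)
  qed
  have ends: "x 0 = a" "x M = b" using gx by (auto simp: grid_def)
  have "U 0 j (a, t) = 0 \<and> U (M - 1) j (b, t) = 0" for j t
  proof (cases "j < N")
    case True
    have "U 0 j (a, t) = (\<lambda>_. 0) (a, t)"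
    proof (rule polyfun_agree_on_line[OF poly polyfun_zero grid_less[OF gy True]])
      fix t assume t: "y j < t" "t < y (Suc j)"
      show "U 0 j (a, t) = 0"
        using agree[of 0 j "(a, t)"] M0 True t bd[OF yin[OF True t]] grid_less[OF gx M0] ends
        by (auto simp: mem_cell)
    qed
    moreover have "U (M - 1) j (b, t) = (\<lambda>_. 0) (b, t)"
    proof (rule polyfun_agree_on_line[OF poly polyfun_zero grid_less[OF gy True]])
      fix t assume t: "y j < t" "t < y (Suc j)"
      show "U (M - 1) j (b, t) = 0"
        using agree[of "M - 1" j "(b, t)"] M0 True t bd[OF yin[OF True t]] grid_less[OF gx, of "M - 1"] ends
        by (auto simp: mem_cell)
    qed
    ultimately show ?thesis by simp
  qed (simp add: out)
  then show "vanishes_x a b M U" by (simp add: vanishes_x_def)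
qed

lemma closure_Omega: "closure (Omega a b c d) = {a..b} \<times> {c..d}"
  using ab cd by (simp add: Omega_def closure_Times)

lemma frontier_Omega: "frontier (Omega a b c d) = {a..b} \<times> {c..d} - {a<..<b} \<times> {c<..<d}"
  unfolding frontier_def closure_Omega by (simp add: Omega_def interior_Times)

text \<open>The conditions in y come from \<open>junction_x\<close> on the transposed grid.\<close>

lemma trial_family_of_agree:
  assumes poly: "\<And>i j. polyfun (U i j)" and out: "\<And>i j. \<not> (i < M \<and> j < N) \<Longrightarrow> U i j = (\<lambda>_. 0)"
    and agree: "\<And>i j z. i < M \<Longrightarrow> j < N \<Longrightarrow> z \<in> cell x y i j \<Longrightarrow> u z = U i j z"
    and u: "u \<in> V_h0 (Omega a b c d) (T_h M x N y) k"
  shows "trial_family a b c d M x N y U"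
proof -
  have diff: "u differentiable (at z)" if "z \<in> {a<..<b} \<times> {c<..<d}" for z
    using u that unfolding V_h0_def V_h_def C1_def Omega_def by blast
  have bd: "u z = 0" if "z \<in> {a..b} \<times> {c..d} - {a<..<b} \<times> {c<..<d}" for z
    using u that frontier_Omega by (auto simp: V_h0_def)
  have dfx: "\<exists>D. ((\<lambda>s. u (s, t)) has_real_derivative D) (at s)"
    and dfy: "\<exists>D. ((\<lambda>t. u (s, t)) has_real_derivative D) (at t)"
    if "a < s" "s < b" "c < t" "t < d" for s t
  proof -
    have du: "u differentiable (at (s, t))" using diff that by auto
    have "(\<lambda>s. u (s, t)) differentiable (at s)"
      by (rule differentiable_compose[of u "\<lambda>s. (s, t)"]) (use du in \<open>auto intro!: derivative_intros simp: differentiable_def\<close>)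
    then show "\<exists>D. ((\<lambda>s. u (s, t)) has_real_derivative D) (at s)"
      by (simp add: real_differentiable_def)
    have "(\<lambda>t. u (s, t)) differentiable (at t)"
      by (rule differentiable_compose[of u "\<lambda>t. (s, t)"]) (use du in \<open>auto intro!: derivative_intros simp: differentiable_def\<close>)
    then show "\<exists>D. ((\<lambda>t. u (s, t)) has_real_derivative D) (at t)"
      by (simp add: real_differentiable_def)
  qed
  interpret sw: product_grid c d a b N y M x using ab cd gx gy by unfold_locales
  have "matches_x x M U" "matches_x x M (\<lambda>i j. dx (U i j))" "vanishes_x a b M U"
    by (rule junction_x[of U u]; use poly out agree dfx bd ab cd in auto)+
  moreover have "matches_x y N (\<lambda>j i z. U i j (prod.swap z))" "matches_x y N (\<lambda>j i. dx (\<lambda>z. U i j (prod.swap z)))"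
      "vanishes_x c d N (\<lambda>j i z. U i j (prod.swap z))"
    by (rule sw.junction_x[of "\<lambda>j i z. U i j (prod.swap z)" "\<lambda>z. u (prod.swap z)"];
        use poly out agree dfy bd ab cd in \<open>auto simp: mem_cell\<close>)+
  ultimately show ?thesis
    by unfold_locales (auto simp: poly matches_x_def matches_y_def vanishes_x_def vanishes_y_def dx_swap)
qed

lemma family_exists:
  assumes u: "u \<in> V_h0 (Omega a b c d) (T_h M x N y) k"
  shows "\<exists>U. (\<forall>i j. U i j \<in> Pol k k) \<and> (\<forall>i<M. \<forall>j<N. \<forall>z\<in>cell x y i j. u z = U i j z) \<and>
    trial_family a b c d M x N y U"
proof -
  have "\<exists>p\<in>Pol k k. \<forall>z\<in>cell x y i j. u z = p z" if "i < M" "j < N" for i j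
    using u that by (auto simp: V_h0_def V_h_def T_h_cells Q_eq_Pol)
  then obtain P where P: "\<And>i j. i < M \<Longrightarrow> j < N \<Longrightarrow> P i j \<in> Pol k k \<and> (\<forall>z\<in>cell x y i j. u z = P i j z)"
    by metis
  define U where "U i j = (if i < M \<and> j < N then P i j else (\<lambda>_. 0))" for i j
  have Z: "(\<lambda>_. 0) \<in> Pol k k" unfolding Pol_def by (auto intro!: exI[of _ "\<lambda>_ _. 0"])
  have U: "U i j \<in> Pol k k" for i j using P Z by (simp add: U_def)
  have "trial_family a b c d M x N y U"
  proof (rule trial_family_of_agree[OF _ _ _ u])
    show "polyfun (U i j)" for i j using U unfolding polyfun_def by blast
  qed (use P in \<open>auto simp: U_def\<close>)
  then show ?thesis using U P by (intro exI[of _ U]) (auto simp: U_def)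
qed

end

subsection \<open>Tensor product trial functions\<close>

text \<open>On the \<open>i\<close>-th interval \<open>g\<close> is a double primitive of \<open>s\<^sup>m\<close>; it is continued affinely with
  continuous slope to the other intervals. Its degree is \<open>m + 2\<close>, which is where the test space degree
  \<open>k - 2\<close> comes from.\<close>

definition basis1 :: "real \<Rightarrow> real \<Rightarrow> nat \<Rightarrow> (nat \<Rightarrow> real) \<Rightarrow> nat \<Rightarrow> nat \<Rightarrow> nat \<Rightarrow> (real \<Rightarrow> real) \<Rightarrow> (real \<Rightarrow> real) \<Rightarrow> bool" where
  "basis1 a b M x k i m g g' \<longleftrightarrow>
     (\<forall>s\<in>{a<..<b}. (g has_real_derivative g' s) (at s)) \<and> continuous_on {a<..<b} g' \<and> g a = 0 \<and> g b = 0 \<and>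
     (\<forall>i'<M. \<exists>C. \<forall>s\<in>{x i'..x (Suc i')}. g s = (\<Sum>n\<le>k. C n * s ^ n)) \<and>
     (\<forall>i'<M. \<forall>s\<in>{x i'<..<x (Suc i')}. (g' has_real_derivative (if i' = i then s ^ m else 0)) (at s))"

lemma affine_plus_power:
  fixes A B D :: real
  assumes "e \<le> k" "1 \<le> k"
  shows "\<exists>C. \<forall>s. A + B * s + D * s ^ e = (\<Sum>n\<le>k. C n * s ^ n)"
proof -
  have "(\<Sum>n\<le>k. ((if n = 0 then A else 0) + (if n = 1 then B else 0) + (if n = e then D else 0)) * s ^ n)
     = A + B * s + D * s ^ e" for s
  proof -
    have *: "(\<Sum>n\<le>k. (if n = r then E else 0) * s ^ n) = E * s ^ r" if "r \<le> k" for r E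
    proof -
      have "(\<Sum>n\<le>k. (if n = r then E else 0) * s ^ n) = (\<Sum>n\<le>k. if n = r then E * s ^ n else 0)"
        by (intro sum.cong) auto
      then show ?thesis using that by simp
    qed
    show ?thesis unfolding distrib_right sum.distrib using *[of 0 A] *[of 1 B] *[of e D] assms by simp
  qed
  from this[symmetric] show ?thesis
    by (intro exI[of _ "\<lambda>n. (if n = 0 then A else 0) + (if n = 1 then B else 0) + (if n = e then D else 0)"] allI)
qed

lemma basis1_exists:
  assumes gx: "grid a b M x" and ab: "a < b" and i: "i < M" and m: "m + 2 \<le> k"
  shows "\<exists>g g'. basis1 a b M x k i m g g'"
proof -
  define H where "H s = s ^ (m + 1) / real (m + 1)" for s :: real
  \<comment> \<open>Clipping the argument to the i-th interval makes the slope continuous: it equals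
    \<open>H\<close> on that interval and is constant on either side.\<close>
  define e where "e s = H (max (x i) (min (x (Suc i)) s))" for s
  have e: "continuous_on S e" for S unfolding e_def H_def by (intro continuous_intros) auto
  obtain E where E: "\<And>s. s \<in> {a..b} \<Longrightarrow> (E has_vector_derivative e s) (at s within {a..b})"
    using antiderivative_continuous[OF e] by blast
  \<comment> \<open>The slope of the chord of \<open>E\<close>; subtracting the chord makes
    \<open>g\<close> vanish at both ends and changes no second derivative.\<close>
  define \<kappa> where "\<kappa> = (E b - E a) / (b - a)"
  define g where "g s = E s - E a - \<kappa> * (s - a)" for s
  define g' where "g' s = e s - \<kappa>" for s
  have dE: "(E has_real_derivative e s) (at s)" if "s \<in> {a<..<b}" for s
    using E[of s] that at_within_Icc_at[of a s b]
    by (simp add: has_real_derivative_iff_has_vector_derivative)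
  have sub: "a \<le> x i'" "x (Suc i') \<le> b" "x i' < x (Suc i')" if "i' < M" for i'
    using grid_bounds[OF gx, of i'] grid_bounds[OF gx, of "Suc i'"] grid_less[OF gx that] that by auto
  have clip: "e s = (if i' = i then H s else if i' < i then H (x i) else H (x (Suc i)))"
    if "i' < M" "s \<in> {x i'..x (Suc i')}" for i' s
  proof -
    consider "i' = i" | "i' < i" | "i < i'" by linarith
    then show ?thesis
    proof cases
      case 2
      then have "x (Suc i') \<le> x i" using grid_mono[OF gx, of "Suc i'" i] i by auto
      then show ?thesis using 2 that sub[OF i] by (simp add: e_def)
    next
      case 3
      then have "x (Suc i) \<le> x i'" using grid_mono[OF gx, of "Suc i" i'] that by auto
      then show ?thesis using 3 that sub[OF i] by (simp add: e_def min_def max_def)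
    qed (use that sub[OF i] in \<open>auto simp: e_def\<close>)
  qed
  have dH: "((\<lambda>s. s ^ (m + 2) / real ((m + 1) * (m + 2))) has_real_derivative H s) (at s within S)" for s S
  proof (rule DERIV_cong)
    show "((\<lambda>s. s ^ (m + 2) / real ((m + 1) * (m + 2))) has_real_derivative
        real (m + 2) * s ^ (m + 1) / real ((m + 1) * (m + 2))) (at s within S)"
      using DERIV_cdivide[OF DERIV_pow[of "m + 2" s S], of "real ((m + 1) * (m + 2))"] by simp
    have "real (m + 2) \<noteq> 0" by simp
    then show "real (m + 2) * s ^ (m + 1) / real ((m + 1) * (m + 2)) = H s"
      unfolding H_def of_nat_mult by (metis mult.commute mult_divide_mult_cancel_left)
  qed
  have dH': "(H has_real_derivative s ^ m) (at s)" for s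
  proof (rule DERIV_cong)
    show "(H has_real_derivative real (m + 1) * s ^ m / real (m + 1)) (at s)"
      unfolding H_def using DERIV_cdivide[OF DERIV_pow[of "m + 1" s UNIV], of "real (m + 1)"] by simp
  qed simp
  have pieces: "\<exists>C. \<forall>s\<in>{x i'..x (Suc i')}. g s = (\<Sum>n\<le>k. C n * s ^ n)" if i': "i' < M" for i'
  proof -
    \<comment> \<open>The slope of \<open>E\<close> off the i-th interval, and below the leading
      coefficient of the double primitive of s^m on it; \<open>E\<close> differs from this
      polynomial by a constant on each interval.\<close>
    define B where "B = (if i' < i then H (x i) else if i' = i then 0 else H (x (Suc i)))"
    define D where "D = (if i' = i then 1 / real ((m + 1) * (m + 2)) else 0)"
    have "\<exists>A. \<forall>s\<in>{x i'..x (Suc i')}. E s - (B * s + D * s ^ (m + 2)) = A"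
    proof (rule has_field_derivative_zero_constant)
      fix s assume s: "s \<in> {x i'..x (Suc i')}"
      have "(E has_real_derivative e s) (at s within {x i'..x (Suc i')})"
        using E[of s] s sub[OF i'] unfolding has_real_derivative_iff_has_vector_derivative
        by (rule_tac has_vector_derivative_within_subset[of E _ s "{a..b}"]) auto
      moreover have "((\<lambda>s. B * s + D * s ^ (m + 2)) has_real_derivative e s) (at s within {x i'..x (Suc i')})"
      proof (cases "i' = i")
        case True
        then show ?thesis using dH[of s] clip[OF i' s] by (simp add: B_def D_def)
      next
        case False
        then show ?thesis using clip[OF i' s] by (auto simp: B_def D_def intro!: derivative_eq_intros)
      qed
      ultimately show "((\<lambda>s. E s - (B * s + D * s ^ (m + 2))) has_real_derivative 0) (at s within {x i'..x (Suc i')})"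
        using DERIV_diff by fastforce
    qed simp
    then obtain A where A: "\<And>s. s \<in> {x i'..x (Suc i')} \<Longrightarrow> E s = A + (B * s + D * s ^ (m + 2))"
      by (auto simp: algebra_simps)
    obtain C where C: "\<And>s. (A - E a + \<kappa> * a) + (B - \<kappa>) * s + D * s ^ (m + 2) = (\<Sum>n\<le>k. C n * s ^ n)"
      using affine_plus_power[OF m, of "A - E a + \<kappa> * a" "B - \<kappa>" D] m by auto
    show ?thesis using A by (intro exI[of _ C]) (simp add: g_def C[symmetric] algebra_simps)
  qed
  have second: "(g' has_real_derivative (if i' = i then s ^ m else 0)) (at s)"
    if i': "i' < M" and s: "s \<in> {x i'<..<x (Suc i')}" for i' s
  proof -
    define r where "r s = (if i' = i then H s else if i' < i then H (x i) else H (x (Suc i)))" for s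
    have "(r has_real_derivative (if i' = i then s ^ m else 0)) (at s)"
    proof (cases "i' = i")
      case True
      then have "r = H" by (auto simp: r_def)
      then show ?thesis using dH' True by simp
    next
      case False
      then have "r = (\<lambda>_. if i' < i then H (x i) else H (x (Suc i)))" by (auto simp: r_def)
      then show ?thesis using False by simp
    qed
    then have "(e has_real_derivative (if i' = i then s ^ m else 0)) (at s)"
      by (rule has_field_derivative_transform_within_open[of r _ s "{x i'<..<x (Suc i')}"])
        (use s clip[OF i'] in \<open>auto simp: r_def\<close>)
    then show ?thesis unfolding g'_def by (auto intro!: derivative_eq_intros)
  qed
  have "basis1 a b M x k i m g g'"
    unfolding basis1_def
  proof (intro conjI ballI)
    show "(g has_real_derivative g' s) (at s)" if "s \<in> {a<..<b}" for s
      unfolding g_def g'_def using dE[OF that] by (auto intro!: derivative_eq_intros)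
    show "continuous_on {a<..<b} g'" unfolding g'_def by (intro continuous_intros e)
    show "g a = 0" "g b = 0" using ab by (simp_all add: g_def \<kappa>_def)
  qed (use pieces second in auto)
  then show ?thesis by blast
qed

lemma Pol_zero: "(\<lambda>_. 0) \<in> Pol m n"
  unfolding Pol_def by (auto intro!: exI[of _ "\<lambda>_ _. 0"])

lemma Pol_add:
  assumes "p \<in> Pol m n" "q \<in> Pol m n"
  shows "(\<lambda>z. p z + q z) \<in> Pol m n"
proof -
  obtain C D where "\<forall>s t. p (s, t) = (\<Sum>i\<le>m. \<Sum>j\<le>n. C i j * s ^ i * t ^ j)"
     "\<forall>s t. q (s, t) = (\<Sum>i\<le>m. \<Sum>j\<le>n. D i j * s ^ i * t ^ j)"
    using assms unfolding Pol_def by blast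
  then show ?thesis unfolding Pol_def
    by (auto intro!: exI[of _ "\<lambda>i j. C i j + D i j"] simp: sum.distrib algebra_simps)
qed

lemma Pol_cmult:
  assumes "p \<in> Pol m n"
  shows "(\<lambda>z. r * p z) \<in> Pol m n"
proof -
  obtain C where "\<forall>s t. p (s, t) = (\<Sum>i\<le>m. \<Sum>j\<le>n. C i j * s ^ i * t ^ j)"
    using assms unfolding Pol_def by blast
  then show ?thesis unfolding Pol_def
    by (auto intro!: exI[of _ "\<lambda>i j. r * C i j"] simp: sum_distrib_left algebra_simps)
qed

lemma Pol_sum:
  assumes "finite I" "\<And>i. i \<in> I \<Longrightarrow> P i \<in> Pol m n"
  shows "(\<lambda>z. \<Sum>i\<in>I. r i * P i z) \<in> Pol m n"
  using assms
proof (induction I rule: finite_induct)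
  case (insert x F)
  then show ?case using Pol_add[OF Pol_cmult[of "P x" m n "r x"], of "\<lambda>z. \<Sum>i\<in>F. r i * P i z"] by simp
qed (simp add: Pol_zero)

lemma Pol_tensor: "(\<lambda>z. (\<Sum>i\<le>m. C i * fst z ^ i) * (\<Sum>j\<le>n. D j * snd z ^ j)) \<in> Pol m n"
  unfolding Pol_def
  by (auto intro!: exI[of _ "\<lambda>i j. C i * D j"] simp: sum_product mult_ac)

lemma deriv_zero_interval:
  assumes "(f has_real_derivative D) (at s)" "s \<in> {l<..<r}" "\<And>s. s \<in> {l<..<r} \<Longrightarrow> f s = (0::real)"
  shows "D = 0"
proof -
  have "((\<lambda>_. 0) has_real_derivative D) (at s)"
    by (rule has_field_derivative_transform_within_open[OF assms(1), of "{l<..<r}"]) (use assms in auto)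
  then show ?thesis using DERIV_unique DERIV_const by blast
qed

text \<open>A cell together with a pair of exponents. It labels the trial functions as well as the
  test monomials, which makes the system square.\<close>

definition index_set :: "nat \<Rightarrow> nat \<Rightarrow> nat \<Rightarrow> (nat \<times> nat \<times> nat \<times> nat) set" where
  "index_set M N r = {..<M} \<times> {..<N} \<times> {..r} \<times> {..r}"

lemma finite_index_set [simp]: "finite (index_set M N r)"
  by (simp add: index_set_def)

context product_grid
begin

text \<open>Products of one-dimensional functions: inside the cells,
  \<open>\<Phi> (i, j, m, n)\<close> has u_xxyy equal to s^m t^n on cell (i, j) and to zero on all
  other cells. Independence of the piecewise monomials therefore carries over to the
  \<open>\<Phi>\<close>.\<close>

lemma trial_functions:
  assumes k: "k \<ge> 2"
  defines "I \<equiv> index_set M N (k - 2)" and "\<Omega> \<equiv> Omega a b c d"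
  obtains \<Phi> :: "nat \<times> nat \<times> nat \<times> nat \<Rightarrow> plane \<Rightarrow> real" and P where
    "\<And>c. restrict (\<lambda>z. \<Sum>\<kappa>\<in>I. c \<kappa> * \<Phi> \<kappa> z) (closure \<Omega>) \<in> V_h0 \<Omega> (T_h M x N y) k"
    "\<And>\<kappa> i j. \<kappa> \<in> I \<Longrightarrow> P \<kappa> i j \<in> Pol k k"
    "\<And>\<kappa> i j z. \<kappa> \<in> I \<Longrightarrow> i < M \<Longrightarrow> j < N \<Longrightarrow> z \<in> cell x y i j \<Longrightarrow> \<Phi> \<kappa> z = P \<kappa> i j z"
    "\<And>c \<kappa>. (\<And>z. z \<in> closure \<Omega> \<Longrightarrow> (\<Sum>\<kappa>\<in>I. c \<kappa> * \<Phi> \<kappa> z) = 0) \<Longrightarrow> \<kappa> \<in> I \<Longrightarrow> c \<kappa> = 0"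
proof -
  have ex: "\<exists>g g'. i < M \<longrightarrow> m \<le> k - 2 \<longrightarrow> basis1 a b M x k i m g g'" for i m
    using basis1_exists[OF gx ab, of i m k] k by (cases "i < M \<and> m \<le> k - 2") auto
  obtain G G' where G: "\<And>i m. i < M \<Longrightarrow> m \<le> k - 2 \<Longrightarrow> basis1 a b M x k i m (G i m) (G' i m)"
    using ex by metis
  have ex: "\<exists>g g'. i < N \<longrightarrow> m \<le> k - 2 \<longrightarrow> basis1 c d N y k i m g g'" for i m
    using basis1_exists[OF gy cd, of i m k] k by (cases "i < N \<and> m \<le> k - 2") auto
  obtain L L' where L: "\<And>i m. i < N \<Longrightarrow> m \<le> k - 2 \<Longrightarrow> basis1 c d N y k i m (L i m) (L' i m)"
    using ex by metis
  define \<Phi> where "\<Phi> = (\<lambda>(i, j, m, n) z. G i m (fst z) * L j n (snd z))"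
  have ex: "\<exists>p\<in>Pol k k. i' < M \<longrightarrow> j' < N \<longrightarrow> \<kappa> \<in> I \<longrightarrow> (\<forall>z\<in>cell x y i' j'. \<Phi> \<kappa> z = p z)" for \<kappa> i' j'
  proof (cases "i' < M \<and> j' < N \<and> \<kappa> \<in> I")
    case True
    obtain i j m n where \<kappa>: "\<kappa> = (i, j, m, n)" by (cases \<kappa>)
    then have ij: "i < M" "j < N" "m \<le> k - 2" "n \<le> k - 2" using True by (auto simp: I_def index_set_def)
    obtain C where C: "\<And>s. s \<in> {x i'..x (Suc i')} \<Longrightarrow> G i m s = (\<Sum>n\<le>k. C n * s ^ n)"
      using G[OF ij(1,3)] True unfolding basis1_def by blast
    obtain D where D: "\<And>s. s \<in> {y j'..y (Suc j')} \<Longrightarrow> L j n s = (\<Sum>n\<le>k. D n * s ^ n)"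
      using L[OF ij(2,4)] True unfolding basis1_def by blast
    show ?thesis using C D
      by (intro bexI[OF _ Pol_tensor[where m=k and n=k and C=C and D=D]]) (auto simp: \<Phi>_def \<kappa> mem_cell)
  qed (use Pol_zero in blast)
  define P where "P \<kappa> i j = (SOME p. p \<in> Pol k k \<and>
    (i < M \<longrightarrow> j < N \<longrightarrow> \<kappa> \<in> I \<longrightarrow> (\<forall>z\<in>cell x y i j. \<Phi> \<kappa> z = p z)))" for \<kappa> i j
  have P': "P \<kappa> i j \<in> Pol k k \<and> (i < M \<longrightarrow> j < N \<longrightarrow> \<kappa> \<in> I \<longrightarrow> (\<forall>z\<in>cell x y i j. \<Phi> \<kappa> z = P \<kappa> i j z))" for \<kappa> i j
  proof -
    have "\<exists>p. p \<in> Pol k k \<and> (i < M \<longrightarrow> j < N \<longrightarrow> \<kappa> \<in> I \<longrightarrow> (\<forall>z\<in>cell x y i j. \<Phi> \<kappa> z = p z))"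
      using ex[where i'=i and j'=j and \<kappa>=\<kappa>] by blast
    then show ?thesis unfolding P_def by (rule someI_ex)
  qed
  have P: "P \<kappa> i j \<in> Pol k k"
    "i < M \<Longrightarrow> j < N \<Longrightarrow> \<kappa> \<in> I \<Longrightarrow> z \<in> cell x y i j \<Longrightarrow> \<Phi> \<kappa> z = P \<kappa> i j z" for \<kappa> i j z
    using P'[of \<kappa> i j] by blast+
  have fin: "finite I" by (simp add: I_def)
  have der: "(G i m has_real_derivative G' i m s) (at s)" "(L j n has_real_derivative L' j n t) (at t)"
    if "(i, j, m, n) \<in> I" "s \<in> {a<..<b}" "t \<in> {c<..<d}" for i j m n s t
    using G[of i m] L[of j n] that by (auto simp: basis1_def I_def index_set_def)
  have V: "restrict (\<lambda>z. \<Sum>\<kappa>\<in>I. e \<kappa> * \<Phi> \<kappa> z) (closure \<Omega>) \<in> V_h0 \<Omega> (T_h M x N y) k" for e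
  proof -
    let ?F = "\<lambda>z. \<Sum>\<kappa>\<in>I. e \<kappa> * \<Phi> \<kappa> z"
    let ?u = "restrict ?F (closure \<Omega>)"
    have cl: "closure \<Omega> = {a..b} \<times> {c..d}" unfolding \<Omega>_def by (rule closure_Omega)
    have op: "open \<Omega>" "\<Omega> = {a<..<b} \<times> {c<..<d}" by (simp_all add: \<Omega>_def Omega_def open_Times)
    have sub: "\<Omega> \<subseteq> closure \<Omega>" by (rule closure_subset)
    have dF: "?F differentiable (at z)" if "z \<in> \<Omega>" for z
    proof (intro differentiable_sum fin ballI differentiable_mult differentiable_const)
      fix \<kappa> assume "\<kappa> \<in> I"
      obtain i j m n where \<kappa>: "\<kappa> = (i, j, m, n)" by (cases \<kappa>)
      have "G i m differentiable (at (fst z))" "L j n differentiable (at (snd z))"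
        using der[of i j m n "fst z" "snd z"] \<open>\<kappa> \<in> I\<close> \<kappa> that op
        by (auto simp: real_differentiable_def)
      then have "(\<lambda>z. G i m (fst z)) differentiable (at z)" "(\<lambda>z. L j n (snd z)) differentiable (at z)"
        by (simp_all add: differentiable_compose[OF _ bounded_linear_imp_differentiable]
            bounded_linear_fst bounded_linear_snd)
      then show "\<Phi> \<kappa> differentiable (at z)" by (simp add: \<Phi>_def \<kappa>)
    qed
    have du: "?u differentiable (at z)" if zO: "z \<in> \<Omega>" for z
    proof -
      obtain D where "(?F has_derivative D) (at z)" using dF[OF zO] by (auto simp: differentiable_def)
      then have "(?u has_derivative D) (at z)"
        by (rule has_derivative_transform_within_open[OF _ op(1) zO]) (use sub in auto)
      then show ?thesis by (auto simp: differentiable_def)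
    qed
    have dxu: "dx ?u z = (\<Sum>(i, j, m, n)\<in>I. e (i, j, m, n) * (G' i m (fst z) * L j n (snd z)))" if "z \<in> \<Omega>" for z
    proof -
      have "((\<lambda>s. ?F (s, snd z)) has_real_derivative (\<Sum>\<kappa>\<in>I. case \<kappa> of (i, j, m, n) \<Rightarrow> e (i, j, m, n) * (G' i m (fst z) * L j n (snd z)))) (at (fst z))"
        using der that op by (intro DERIV_sum) (auto simp: \<Phi>_def intro!: derivative_eq_intros)
      then have "((\<lambda>s. ?u (s, snd z)) has_real_derivative (\<Sum>\<kappa>\<in>I. case \<kappa> of (i, j, m, n) \<Rightarrow> e (i, j, m, n) * (G' i m (fst z) * L j n (snd z)))) (at (fst z))"
        by (rule has_field_derivative_transform_within_open[of _ _ _ "{a<..<b}"])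
          (use that op cl in auto)
      then show ?thesis by (simp add: dx_def DERIV_imp_deriv)
    qed
    have dyu: "dy ?u z = (\<Sum>(i, j, m, n)\<in>I. e (i, j, m, n) * (G i m (fst z) * L' j n (snd z)))" if "z \<in> \<Omega>" for z
    proof -
      have "((\<lambda>t. ?F (fst z, t)) has_real_derivative (\<Sum>\<kappa>\<in>I. case \<kappa> of (i, j, m, n) \<Rightarrow> e (i, j, m, n) * (G i m (fst z) * L' j n (snd z)))) (at (snd z))"
        using der that op by (intro DERIV_sum) (auto simp: \<Phi>_def intro!: derivative_eq_intros)
      then have "((\<lambda>t. ?u (fst z, t)) has_real_derivative (\<Sum>\<kappa>\<in>I. case \<kappa> of (i, j, m, n) \<Rightarrow> e (i, j, m, n) * (G i m (fst z) * L' j n (snd z)))) (at (snd z))"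
        by (rule has_field_derivative_transform_within_open[of _ _ _ "{c<..<d}"])
          (use that op cl in auto)
      then show ?thesis by (simp add: dy_def DERIV_imp_deriv)
    qed
    have cont: "continuous_on \<Omega> (\<lambda>z. G i m (fst z))" "continuous_on \<Omega> (\<lambda>z. G' i m (fst z))"
      "continuous_on \<Omega> (\<lambda>z. L j n (snd z))" "continuous_on \<Omega> (\<lambda>z. L' j n (snd z))" if "(i, j, m, n) \<in> I" for i j m n
    proof -
      have "continuous_on {a<..<b} (G i m)" "continuous_on {a<..<b} (G' i m)"
          "continuous_on {c<..<d} (L j n)" "continuous_on {c<..<d} (L' j n)"
        using G[of i m] L[of j n] that
        by (auto simp: basis1_def I_def index_set_def intro!: DERIV_isCont continuous_at_imp_continuous_on)
      note this[THEN continuous_on_compose2]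
      note cc = this(1,2)[OF continuous_on_fst[OF continuous_on_id]] this(3,4)[OF continuous_on_snd[OF continuous_on_id]]
      show "continuous_on \<Omega> (\<lambda>z. G i m (fst z))" "continuous_on \<Omega> (\<lambda>z. G' i m (fst z))"
        "continuous_on \<Omega> (\<lambda>z. L j n (snd z))" "continuous_on \<Omega> (\<lambda>z. L' j n (snd z))"
        unfolding op(2) by ((rule cc, auto)[1])+
    qed
    have "continuous_on \<Omega> (dx ?u)"
    proof (rule iffD2[OF continuous_on_cong[OF refl dxu]])
      show "continuous_on \<Omega> (\<lambda>z. \<Sum>(i, j, m, n)\<in>I. e (i, j, m, n) * (G' i m (fst z) * L j n (snd z)))"
        using cont by (auto intro!: continuous_on_sum continuous_on_mult continuous_on_const)
    qed
    moreover have "continuous_on \<Omega> (dy ?u)"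
    proof (rule iffD2[OF continuous_on_cong[OF refl dyu]])
      show "continuous_on \<Omega> (\<lambda>z. \<Sum>(i, j, m, n)\<in>I. e (i, j, m, n) * (G i m (fst z) * L' j n (snd z)))"
        using cont by (auto intro!: continuous_on_sum continuous_on_mult continuous_on_const)
    qed
    ultimately have "?u \<in> C1 \<Omega>" using du by (simp add: C1_def)
    moreover have "\<exists>p\<in>Q k. \<forall>z\<in>\<tau>. ?u z = p z" if \<tau>: "\<tau> \<in> T_h M x N y" for \<tau>
    proof -
      obtain i j where ij: "i < M" "j < N" "\<tau> = cell x y i j" using \<tau> by (auto simp: T_h_cells)
      have "\<tau> \<subseteq> closure \<Omega>"
        using grid_bounds[OF gx, of i] grid_bounds[OF gx, of "Suc i"] ij
          grid_bounds[OF gy, of j] grid_bounds[OF gy, of "Suc j"] by (auto simp: cl mem_cell)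
      then have "\<forall>z\<in>\<tau>. ?u z = (\<Sum>\<kappa>\<in>I. e \<kappa> * P \<kappa> i j z)"
        using P(2)[OF ij(1,2)] ij(3) by (auto intro!: sum.cong)
      moreover have "(\<lambda>z. \<Sum>\<kappa>\<in>I. e \<kappa> * P \<kappa> i j z) \<in> Q k"
        unfolding Q_eq_Pol by (intro Pol_sum fin P)
      ultimately show ?thesis by (rule_tac bexI)
    qed
    moreover have "?u z = 0" if "z \<in> frontier \<Omega>" for z
    proof -
      have z: "z \<in> {a..b} \<times> {c..d}" "z \<notin> {a<..<b} \<times> {c<..<d}"
        using that frontier_Omega by (auto simp: \<Omega>_def)
      then have "fst z \<in> {a, b} \<or> snd z \<in> {c, d}" by (cases z) auto
      then have "\<Phi> \<kappa> z = 0" if "\<kappa> \<in> I" for \<kappa>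
        using G L that by (auto simp: \<Phi>_def I_def index_set_def basis1_def)
      then show ?thesis using z cl by simp
    qed
    ultimately show ?thesis by (auto simp: V_h0_def V_h_def)
  qed
  have inj: "e \<kappa> = 0" if z: "\<And>z. z \<in> closure \<Omega> \<Longrightarrow> (\<Sum>\<kappa>\<in>I. e \<kappa> * \<Phi> \<kappa> z) = 0" and \<kappa>: "\<kappa> \<in> I" for e \<kappa>
  proof -
    obtain i0 j0 m0 n0 where \<kappa>0: "\<kappa> = (i0, j0, m0, n0)" by (cases \<kappa>)
    then have i0: "i0 < M" "j0 < N" "m0 \<le> k - 2" "n0 \<le> k - 2" using \<kappa> by (auto simp: I_def index_set_def)
    let ?X = "{x i0<..<x (Suc i0)}" and ?Y = "{y j0<..<y (Suc j0)}"
    have XY: "?X \<subseteq> {a<..<b}" "?Y \<subseteq> {c<..<d}"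
      using grid_bounds[OF gx, of i0] grid_bounds[OF gx, of "Suc i0"] i0
          grid_bounds[OF gy, of j0] grid_bounds[OF gy, of "Suc j0"] by auto
    have d2: "(G' i m has_real_derivative (if i0 = i then s ^ m else 0)) (at s)"
      "(L' j n has_real_derivative (if j0 = j then t ^ n else 0)) (at t)"
      if "(i, j, m, n) \<in> I" "s \<in> ?X" "t \<in> ?Y" for i j m n s t
      using G[of i m] L[of j n] i0 that by (auto simp: basis1_def I_def index_set_def)
    \<comment> \<open>A vanishing combination is differentiated twice in s and then twice in t on
      the open cell of \<kappa>. The second derivatives remove all terms belonging to other
      intervals, and a polynomial with the coefficients of this cell is left.\<close>
    have s0: "(\<Sum>(i, j, m, n)\<in>I. e (i, j, m, n) * (G i m s * L j n t)) = 0" if "s \<in> ?X" "t \<in> ?Y" for s t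
      using z[of "(s, t)"] closure_Omega that XY unfolding \<Omega>_def \<Phi>_def by (force simp: case_prod_beta)
    have s1: "(\<Sum>(i, j, m, n)\<in>I. e (i, j, m, n) * (G' i m s * L j n t)) = 0" if "s \<in> ?X" "t \<in> ?Y" for s t
      by (rule deriv_zero_interval[where f="\<lambda>s. \<Sum>(i, j, m, n)\<in>I. e (i, j, m, n) * (G i m s * L j n t)", OF DERIV_sum that(1)])
        (use that s0 XY in \<open>auto intro!: derivative_eq_intros der\<close>)
    have s2: "(\<Sum>(i, j, m, n)\<in>I. e (i, j, m, n) * ((if i0 = i then s ^ m else 0) * L j n t)) = 0" if "s \<in> ?X" "t \<in> ?Y" for s t
      by (rule deriv_zero_interval[where f="\<lambda>s. \<Sum>(i, j, m, n)\<in>I. e (i, j, m, n) * (G' i m s * L j n t)", OF DERIV_sum that(1)])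
        (use that s1 XY in \<open>auto intro!: derivative_eq_intros d2\<close>)
    have s3: "(\<Sum>(i, j, m, n)\<in>I. e (i, j, m, n) * ((if i0 = i then s ^ m else 0) * L' j n t)) = 0" if "s \<in> ?X" "t \<in> ?Y" for s t
      by (rule deriv_zero_interval[where f="\<lambda>t. \<Sum>(i, j, m, n)\<in>I. e (i, j, m, n) * ((if i0 = i then s ^ m else 0) * L j n t)", OF DERIV_sum that(2)])
        (use that s2 XY in \<open>auto intro!: derivative_eq_intros der\<close>)
    have s4: "(\<Sum>(i, j, m, n)\<in>I. e (i, j, m, n) * ((if i0 = i then s ^ m else 0) * (if j0 = j then t ^ n else 0))) = 0" if "s \<in> ?X" "t \<in> ?Y" for s t
      by (rule deriv_zero_interval[where f="\<lambda>t. \<Sum>(i, j, m, n)\<in>I. e (i, j, m, n) * ((if i0 = i then s ^ m else 0) * L' j n t)", OF DERIV_sum that(2)])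
        (use that s3 XY in \<open>auto intro!: derivative_eq_intros d2\<close>)
    have s5: "(\<Sum>m\<le>k-2. (\<Sum>n\<le>k-2. e (i0, j0, m, n) * t ^ n) * s ^ m) = 0" if "s \<in> ?X" "t \<in> ?Y" for s t
    proof -
      let ?f = "\<lambda>(m, n). (i0, j0, m, n)"
      have "(\<Sum>m\<le>k-2. (\<Sum>n\<le>k-2. e (i0, j0, m, n) * t ^ n) * s ^ m)
        = (\<Sum>(m, n)\<in>{..k-2}\<times>{..k-2}. e (i0, j0, m, n) * (s ^ m * t ^ n))"
        by (simp add: sum.cartesian_product[symmetric] sum_distrib_left mult_ac)
      also have "\<dots> = (\<Sum>(i, j, m, n)\<in>?f ` ({..k-2}\<times>{..k-2}). e (i, j, m, n) * ((if i0 = i then s ^ m else 0) * (if j0 = j then t ^ n else 0)))"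
        by (subst sum.reindex) (auto simp: inj_on_def case_prod_beta)
      also have "\<dots> = (\<Sum>(i, j, m, n)\<in>I. e (i, j, m, n) * ((if i0 = i then s ^ m else 0) * (if j0 = j then t ^ n else 0)))"
        by (rule sum.mono_neutral_left[OF fin]) (use i0 in \<open>auto simp: I_def index_set_def\<close>)
      finally show ?thesis using s4[OF that] by simp
    qed
    \<comment> \<open>For fixed t the coefficients in s vanish; each of them is a polynomial in t to
      which the same argument applies.\<close>
    have "(\<Sum>n\<le>k-2. e (i0, j0, m0, n) * t ^ n) = 0" if "t \<in> ?Y" for t
      by (rule polynomial_zero_on_interval[OF grid_less[OF gx i0(1)] _ i0(3), where c="\<lambda>m. \<Sum>n\<le>k-2. e (i0, j0, m, n) * t ^ n"])
        (use s5 that in auto)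
    then have "e (i0, j0, m0, n0) = 0"
      by (intro polynomial_zero_on_interval[OF grid_less[OF gy i0(2)] _ i0(4), where c="\<lambda>n. e (i0, j0, m0, n)"]) auto
    then show ?thesis by (simp add: \<kappa>0)
  qed
  show thesis by (rule that[of \<Phi> P]) (use V P inj in auto)
qed

end

subsection \<open>Moments\<close>

definition bimonom :: "nat \<Rightarrow> nat \<Rightarrow> plane \<Rightarrow> real" where
  "bimonom m n z = fst z ^ m * snd z ^ n"

lemma bimonom_continuous: "continuous_on S (bimonom m n)"
  unfolding bimonom_def by (intro continuous_intros)

definition open_cell :: "(nat \<Rightarrow> real) \<Rightarrow> (nat \<Rightarrow> real) \<Rightarrow> nat \<Rightarrow> nat \<Rightarrow> plane set" where
  "open_cell x y i j = box (x i, y j) (x (Suc i), y (Suc j))"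

lemma mem_open_cell: "(s, t) \<in> open_cell x y i j \<longleftrightarrow> s \<in> {x i<..<x (Suc i)} \<and> t \<in> {y j<..<y (Suc j)}"
  by (auto simp: open_cell_def mem_box Basis_prod_def)

lemma open_cell_subset: "open_cell x y i j \<subseteq> cell x y i j"
  unfolding open_cell_def cell_def by (rule box_subset_cbox)

lemma open_open_cell: "open (open_cell x y i j)"
  by (simp add: open_cell_def open_box)

lemma AE_open_cell: "AE z in lebesgue. z \<in> cell x y i j \<longrightarrow> z \<in> open_cell x y i j"
proof -
  have "cell x y i j - open_cell x y i j \<in> null_sets lebesgue"
    unfolding cell_def open_cell_def using negligible_frontier_interval negligible_iff_null_sets by blast
  then show ?thesis by (auto dest: AE_not_in elim: eventually_mono)
qed

text \<open>Changing an integrable function on a null set preserves integrability by completeness of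
  the measure. So arbitrary values of \<open>diff_op\<close> on the edges are harmless.\<close>

lemma set_integral_AE_eq:
  fixes f g :: "plane \<Rightarrow> real"
  assumes f: "set_integrable lebesgue S f" and ae: "AE z in lebesgue. z \<in> S \<longrightarrow> g z = f z"
  shows "set_integrable lebesgue S g" "(LINT z:S|lebesgue. g z) = (LINT z:S|lebesgue. f z)"
proof -
  let ?N = "{z. \<not> (z \<in> S \<longrightarrow> g z = f z)}"
  have N: "negligible ?N"
    using ae unfolding completion.AE_iff_null_sets negligible_iff_null_sets by simp
  show g: "set_integrable lebesgue S g"
    by (rule absolutely_integrable_spike[OF f N]) auto
  have "integral S g = integral S f"
    by (rule integral_spike[OF N]) auto
  then show "(LINT z:S|lebesgue. g z) = (LINT z:S|lebesgue. f z)"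
    using set_lebesgue_integral_eq_integral(2)[OF f] set_lebesgue_integral_eq_integral(2)[OF g] by simp
qed

lemma set_integral_lincomb:
  fixes f :: "'i \<Rightarrow> plane \<Rightarrow> real"
  assumes "finite I" "\<And>i. i \<in> I \<Longrightarrow> set_integrable lebesgue S (f i)"
  shows "set_integrable lebesgue S (\<lambda>z. \<Sum>i\<in>I. r i * f i z)"
    "(LINT z:S|lebesgue. (\<Sum>i\<in>I. r i * f i z)) = (\<Sum>i\<in>I. r i * (LINT z:S|lebesgue. f i z))"
  using assms
proof (induction I rule: finite_induct)
  case empty
  { case 1 show ?case by (simp add: set_integrable_def) }
  { case 2 show ?case by (simp add: set_lebesgue_integral_def) }
next
  case (insert i I)
  have a: "set_integrable lebesgue S (\<lambda>z. r i * f i z)" if "\<And>i'. i' \<in> insert i I \<Longrightarrow> set_integrable lebesgue S (f i')"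
    using that by (intro set_integrable_mult_right) auto
  { case 1 then show ?case using insert a by (simp add: set_integral_add) }
  { case 2 then show ?case using insert a by (simp add: set_integral_add) }
qed

section \<open>Locality and linearity of the differential operator\<close>

lemma dx_local:
  assumes "open S" "z \<in> S" "\<And>w. w \<in> S \<Longrightarrow> f w = g w"
  shows "dx f z = dx g z"
proof -
  have "open ((\<lambda>s. (s, snd z)) -` S)" by (intro open_vimage assms continuous_intros)
  then have "\<forall>\<^sub>F s in nhds (fst z). f (s, snd z) = g (s, snd z)"
    unfolding eventually_nhds using assms by (intro exI[of _ "(\<lambda>s. (s, snd z)) -` S"]) auto
  then show ?thesis unfolding dx_def by (rule deriv_cong_ev) simp
qed

lemma dy_local:
  assumes "open S" "z \<in> S" "\<And>w. w \<in> S \<Longrightarrow> f w = g w"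
  shows "dy f z = dy g z"
proof -
  have "open ((\<lambda>t. (fst z, t)) -` S)" by (intro open_vimage assms continuous_intros)
  then have "\<forall>\<^sub>F t in nhds (snd z). f (fst z, t) = g (fst z, t)"
    unfolding eventually_nhds using assms by (intro exI[of _ "(\<lambda>t. (fst z, t)) -` S"]) auto
  then show ?thesis unfolding dy_def by (rule deriv_cong_ev) simp
qed

lemma dx_cmult: "polyfun p \<Longrightarrow> dx (\<lambda>z. r * p z) z = r * dx p z"
  using DERIV_imp_deriv[OF DERIV_cmult[OF polyfun_der_x[of p "snd z" "fst z"], of r]]
  by (simp add: dx_def)

lemma dy_cmult: "polyfun p \<Longrightarrow> dy (\<lambda>z. r * p z) z = r * dy p z"
  using DERIV_imp_deriv[OF DERIV_cmult[OF polyfun_der_y[of p "fst z" "snd z"], of r]]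
  by (simp add: dy_def)

lemma dx_diff: "polyfun p \<Longrightarrow> polyfun q \<Longrightarrow> dx (\<lambda>z. p z - q z) = (\<lambda>z. dx p z - dx q z)"
  using DERIV_imp_deriv[OF DERIV_diff[OF polyfun_der_x polyfun_der_x]]
  by (fastforce simp: dx_def)

lemma dy_diff: "polyfun p \<Longrightarrow> polyfun q \<Longrightarrow> dy (\<lambda>z. p z - q z) = (\<lambda>z. dy p z - dy q z)"
  using DERIV_imp_deriv[OF DERIV_diff[OF polyfun_der_y polyfun_der_y]]
  by (fastforce simp: dy_def)

lemma dx_lincomb:
  assumes "finite I" "\<And>i. i \<in> I \<Longrightarrow> polyfun (p i)"
  shows "dx (\<lambda>z. \<Sum>i\<in>I. r i * p i z) = (\<lambda>z. \<Sum>i\<in>I. r i * dx (p i) z)"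
proof
  fix z
  have "((\<lambda>s. \<Sum>i\<in>I. r i * p i (s, snd z)) has_real_derivative (\<Sum>i\<in>I. r i * dx (p i) (fst z, snd z))) (at (fst z))"
    using assms by (intro DERIV_sum DERIV_cmult polyfun_der_x)
  then show "dx (\<lambda>z. \<Sum>i\<in>I. r i * p i z) z = (\<Sum>i\<in>I. r i * dx (p i) z)"
    by (simp add: dx_def DERIV_imp_deriv)
qed

lemma dy_lincomb:
  assumes "finite I" "\<And>i. i \<in> I \<Longrightarrow> polyfun (p i)"
  shows "dy (\<lambda>z. \<Sum>i\<in>I. r i * p i z) = (\<lambda>z. \<Sum>i\<in>I. r i * dy (p i) z)"
proof
  fix z
  have "((\<lambda>t. \<Sum>i\<in>I. r i * p i (fst z, t)) has_real_derivative (\<Sum>i\<in>I. r i * dy (p i) (fst z, snd z))) (at (snd z))"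
    using assms by (intro DERIV_sum DERIV_cmult polyfun_der_y)
  then show "dy (\<lambda>z. \<Sum>i\<in>I. r i * p i z) z = (\<Sum>i\<in>I. r i * dy (p i) z)"
    by (simp add: dy_def DERIV_imp_deriv)
qed

lemma cd_op_lincomb:
  assumes "finite I" "\<And>i. i \<in> I \<Longrightarrow> polyfun (p i)"
  shows "cd_op \<alpha> b1 b2 \<gamma> (\<lambda>z. \<Sum>i\<in>I. r i * p i z) z = (\<Sum>i\<in>I. r i * cd_op \<alpha> b1 b2 \<gamma> (p i) z)"
  unfolding cd_op_def
  by (subst dx_lincomb dy_lincomb, use assms in simp_all)+
    (simp add: sum_distrib_left sum.distrib sum_subtractf algebra_simps)

lemma cd_op_diff:
  assumes "polyfun p" "polyfun q"
  shows "cd_op \<alpha> b1 b2 \<gamma> (\<lambda>z. p z - q z) z = cd_op \<alpha> b1 b2 \<gamma> p z - cd_op \<alpha> b1 b2 \<gamma> q z"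
  unfolding cd_op_def by (simp add: dx_diff dy_diff assms algebra_simps)

lemma diff_op_cell:
  assumes p: "polyfun p" and z: "z \<in> open_cell x y i j"
    and agree: "\<And>w. w \<in> open_cell x y i j \<Longrightarrow> u w = p w"
  shows "diff_op \<alpha> \<beta> \<gamma> u z = cd_op \<alpha> (fst \<beta>) (snd \<beta>) \<gamma> p z"
proof -
  note op = open_open_cell[of x y i j]
  \<comment> \<open>Needed on the whole open cell and not only at \<open>z\<close>, since the first
    derivatives are differentiated again.\<close>
  have d: "dx u w = dx p w" "dy u w = dy p w" if "w \<in> open_cell x y i j" for w
    using dx_local[OF op that agree] dy_local[OF op that agree] by auto
  have "dx (\<lambda>z. \<alpha> * dx u z) z = dx (\<lambda>z. \<alpha> * dx p z) z"
    by (rule dx_local[OF op z]) (simp add: d)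
  moreover have "dy (\<lambda>z. \<alpha> * dy u z) z = dy (\<lambda>z. \<alpha> * dy p z) z"
    by (rule dy_local[OF op z]) (simp add: d)
  ultimately show ?thesis
    by (simp add: diff_op_def cd_op_def d[OF z] agree[OF z] p dx_cmult dy_cmult inner_prod_def algebra_simps)
qed

section \<open>Cells, test functions and reduction of the method to moments\<close>

context product_grid
begin

abbreviation "Dom \<equiv> Omega a b c d"
abbreviation "Cells \<equiv> T_h M x N y"

lemma open_cell_disjoint:
  assumes "z \<in> open_cell x y i j" "z \<in> cell x y i' j'" "i < M" "j < N" "i' < M" "j' < N"
  shows "i = i'" "j = j'"
proof -
  have *: "i = i'" if g: "grid l r n w" and "w i < s" "s < w (Suc i)" "w i' \<le> s" "s \<le> w (Suc i')" "i < n" "i' < n"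
    for l r n w s i i'
  proof (rule ccontr)
    assume "i \<noteq> i'"
    then consider "Suc i \<le> i'" | "Suc i' \<le> i" by linarith
    then show False
      using grid_mono[OF g, of "Suc i" i'] grid_mono[OF g, of "Suc i'" i] that by cases auto
  qed
  obtain s t where z: "z = (s, t)" by (cases z)
  show "i = i'" by (rule *[OF gx, of i s i']) (use assms in \<open>auto simp: z mem_cell mem_open_cell\<close>)
  show "j = j'" by (rule *[OF gy, of j t j']) (use assms in \<open>auto simp: z mem_cell mem_open_cell\<close>)
qed

lemma open_cell_nonempty:
  assumes "i < M" "j < N"
  shows "((x i + x (Suc i)) / 2, (y j + y (Suc j)) / 2) \<in> open_cell x y i j"
  using grid_less[OF gx assms(1)] grid_less[OF gy assms(2)] by (simp add: mem_open_cell)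

text \<open>\<open>ip\<close> sums over a set of cells, where coinciding cells would count once;
  injectivity turns it into a double sum over indices.\<close>

lemma cell_inj: "inj_on (\<lambda>(i, j). cell x y i j) ({..<M} \<times> {..<N})"
proof (rule inj_onI, clarsimp)
  fix i j i' j' assume *: "i < M" "j < N" "i' < M" "j' < N" "cell x y i j = cell x y i' j'"
  then show "i = i' \<and> j = j'"
    using open_cell_disjoint[OF open_cell_nonempty[OF *(1,2)] _ *(1-4)]
      open_cell_nonempty[OF *(1,2)] open_cell_subset[of x y i j] by blast
qed

lemma ip_cells: "ip Cells w v = (\<Sum>i<M. \<Sum>j<N. LINT z:cell x y i j|lebesgue. w z * v z)"
  unfolding ip_def T_h_cells sum.reindex[OF cell_inj]
  by (simp add: sum.cartesian_product case_prod_beta)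

lemma cell_in_closure:
  assumes "i < M" "j < N"
  shows "cell x y i j \<subseteq> closure Dom"
  using grid_bounds[OF gx, of i] grid_bounds[OF gx, of "Suc i"] assms
    grid_bounds[OF gy, of j] grid_bounds[OF gy, of "Suc j"] by (auto simp: closure_Omega mem_cell)

lemma cells_cover:
  assumes "z \<in> closure Dom"
  shows "\<exists>i<M. \<exists>j<N. z \<in> cell x y i j"
proof -
  have *: "\<exists>i<n. w i \<le> s \<and> s \<le> w (Suc i)" if "0 < n" "w 0 \<le> s" "s \<le> w n" for n and w :: "nat \<Rightarrow> real" and s
    using that
  proof (induction n)
    case (Suc n)
    show ?case
    proof (cases "n = 0 \<or> w n \<le> s")
      case True
      then show ?thesis using Suc.prems by (intro exI[of _ n]) auto
    next
      case False
      then show ?thesis using Suc.IH Suc.prems less_SucI by (metis leI less_imp_le neq0_conv)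
    qed
  qed simp
  obtain s t where z: "z = (s, t)" by (cases z)
  have "s \<in> {a..b}" "t \<in> {c..d}" using assms by (auto simp: z closure_Omega)
  moreover have "x 0 = a" "x M = b" "y 0 = c" "y N = d" using gx gy by (auto simp: grid_def)
  ultimately show ?thesis using *[OF M0, of x s] *[OF N0, of y t] by (auto simp: z mem_cell)
qed

text \<open>With the open cell the function is zero everywhere on every other closed cell, shared
  edges included; on its own cell it can differ from the monomial only on the boundary, a null
  set.\<close>

definition test_fun :: "nat \<Rightarrow> nat \<Rightarrow> nat \<Rightarrow> nat \<Rightarrow> plane \<Rightarrow> real" where
  "test_fun i j m n z = indicator (open_cell x y i j) z * bimonom m n z"

lemma bimonom_Pol: "m \<le> r \<Longrightarrow> n \<le> r \<Longrightarrow> bimonom m n \<in> Pol r r"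
proof -
  assume mn: "m \<le> r" "n \<le> r"
  have e: "s ^ p = (\<Sum>i\<le>r. (if i = p then 1 else 0) * s ^ i)" if "p \<le> r" for p and s :: real
  proof -
    have "(\<Sum>i\<le>r. (if i = p then 1 else 0) * s ^ i) = (\<Sum>i\<le>r. if i = p then s ^ i else 0)"
      by (intro sum.cong) auto
    then show ?thesis using that by simp
  qed
  have "bimonom m n = (\<lambda>z. (\<Sum>i\<le>r. (if i = m then 1 else 0) * fst z ^ i) * (\<Sum>j\<le>r. (if j = n then 1 else 0) * snd z ^ j))"
    unfolding bimonom_def by (simp only: e[OF mn(1), symmetric] e[OF mn(2), symmetric])
  then show ?thesis using Pol_tensor by simp
qed

lemma cont_set_integrable:
  fixes f :: "plane \<Rightarrow> real"
  assumes "continuous_on (cell x y i j) f"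
  shows "set_integrable lebesgue (cell x y i j) f" "(LINT z:cell x y i j|lebesgue. f z) = integral (cell x y i j) f"
proof -
  show "set_integrable lebesgue (cell x y i j) f"
    using assms unfolding cell_def by (rule absolutely_integrable_continuous)
  then show "(LINT z:cell x y i j|lebesgue. f z) = integral (cell x y i j) f"
    by (rule set_lebesgue_integral_eq_integral)
qed

lemma test_fun_in_W_h:
  assumes ij: "i < M" "j < N" and mn: "m \<le> k - 2" "n \<le> k - 2"
  shows "test_fun i j m n \<in> W_h Dom Cells k"
proof -
  have D: "Dom \<in> sets lebesgue" by (simp add: Omega_def borel_open open_Times)
  have int: "integrable lebesgue (\<lambda>z. indicator (open_cell x y i j) z * g z)" if "continuous_on UNIV g" for g :: "plane \<Rightarrow> real"
  proof -
    have "set_integrable lebesgue (cell x y i j) g"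
      using that continuous_on_subset by (intro cont_set_integrable) auto
    then have "set_integrable lebesgue (open_cell x y i j) g"
      by (rule set_integrable_subset) (use open_cell_subset in \<open>auto simp: open_cell_def\<close>)
    then show ?thesis by (simp add: set_integrable_def)
  qed
  have 1: "integrable lebesgue (test_fun i j m n)"
    using int[OF bimonom_continuous] by (simp add: test_fun_def[abs_def])
  have "integrable lebesgue (\<lambda>z. indicator (open_cell x y i j) z * (bimonom m n z)\<^sup>2)"
    by (intro int continuous_on_power bimonom_continuous)
  also have "(\<lambda>z. indicator (open_cell x y i j) z * (bimonom m n z)\<^sup>2) = (\<lambda>z. (test_fun i j m n z)\<^sup>2)"
    by (auto simp: test_fun_def fun_eq_iff indicator_def)
  finally have 2: "integrable lebesgue (\<lambda>z. (test_fun i j m n z)\<^sup>2)" .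
  have "test_fun i j m n \<in> L2 Dom"
    unfolding L2_def
  proof (intro CollectI conjI)
    show "test_fun i j m n \<in> borel_measurable (lebesgue_on Dom)"
      using 1 by (intro measurable_restrict_space1) auto
    show "integrable (lebesgue_on Dom) (\<lambda>z. (test_fun i j m n z)\<^sup>2)"
      using integrable_mult_indicator[OF D 2] D by (simp add: integrable_restrict_space)
  qed
  moreover have "\<exists>p\<in>Q (k - 2). AE z in lebesgue. z \<in> \<tau> \<longrightarrow> test_fun i j m n z = p z" if \<tau>: "\<tau> \<in> Cells" for \<tau>
  proof -
    obtain i' j' where ij': "i' < M" "j' < N" "\<tau> = cell x y i' j'" using \<tau> by (auto simp: T_h_cells)
    show ?thesis
    proof (cases "i = i' \<and> j = j'")
      case True
      have "AE z in lebesgue. z \<in> \<tau> \<longrightarrow> test_fun i j m n z = bimonom m n z"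
        using AE_open_cell[of x y i j] by eventually_elim (use True ij' in \<open>auto simp: test_fun_def\<close>)
      then show ?thesis using bimonom_Pol[OF mn] Q_eq_Pol by blast
    next
      case False
      then have "z \<in> \<tau> \<Longrightarrow> test_fun i j m n z = (\<lambda>_. 0) z" for z
        using open_cell_disjoint[of z i j i' j'] ij ij' by (auto simp: test_fun_def indicator_def)
      then show ?thesis using Pol_zero Q_eq_Pol by (intro bexI[of _ "\<lambda>_. 0"]) auto
    qed
  qed
  ultimately show ?thesis by (simp add: W_h_def)
qed

definition moment :: "(plane \<Rightarrow> real) \<Rightarrow> nat \<Rightarrow> nat \<Rightarrow> nat \<Rightarrow> nat \<Rightarrow> real" where
  "moment g i j m n = (LINT z:cell x y i j|lebesgue. g z * bimonom m n z)"

definition moments_exist :: "nat \<Rightarrow> (plane \<Rightarrow> real) \<Rightarrow> bool" where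
  "moments_exist r g \<longleftrightarrow> (\<forall>i<M. \<forall>j<N. \<forall>m\<le>r. \<forall>n\<le>r. set_integrable lebesgue (cell x y i j) (\<lambda>z. g z * bimonom m n z))"

lemma ip_test_fun:
  assumes ij: "i < M" "j < N" and mn: "m \<le> r" "n \<le> r" and g: "moments_exist r g"
  shows "ip Cells g (test_fun i j m n) = moment g i j m n"
proof -
  have "(LINT z:cell x y i' j'|lebesgue. g z * test_fun i j m n z) = (if i' = i then if j' = j then moment g i j m n else 0 else 0)"
    if ij': "i' < M" "j' < N" for i' j'
  proof (cases "i' = i \<and> j' = j")
    case True
    have "AE z in lebesgue. z \<in> cell x y i j \<longrightarrow> g z * test_fun i j m n z = g z * bimonom m n z"
      using AE_open_cell[of x y i j] by eventually_elim (auto simp: test_fun_def)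
    from set_integral_AE_eq(2)[OF _ this] show ?thesis
      using g ij mn True by (simp add: moment_def moments_exist_def)
  next
    case False
    then have "z \<in> cell x y i' j' \<Longrightarrow> test_fun i j m n z = 0" for z
      using open_cell_disjoint[of z i j i' j'] ij ij' by (auto simp: test_fun_def indicator_def)
    then have "(\<lambda>z. indicator (cell x y i' j') z *\<^sub>R (g z * test_fun i j m n z)) = (\<lambda>_. 0)"
      by (auto simp: fun_eq_iff indicator_def)
    then show ?thesis using False by (simp add: set_lebesgue_integral_def)
  qed
  then have "ip Cells g (test_fun i j m n) = (\<Sum>i'<M. \<Sum>j'<N. if i' = i then if j' = j then moment g i j m n else 0 else 0)"
    unfolding ip_cells by (intro sum.cong refl) auto
  also have "\<dots> = (\<Sum>i'<M. if i' = i then moment g i j m n else 0)"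
    using ij by (intro sum.cong refl) auto
  finally show ?thesis using ij by simp
qed

text \<open>The coefficients depend on \<open>v\<close> alone, so the same expansion serves both
  sides of the discrete equation.\<close>

lemma test_expand:
  assumes v: "v \<in> W_h Dom Cells k"
  shows "\<exists>C. \<forall>i<M. \<forall>j<N. \<forall>g. moments_exist (k - 2) g \<longrightarrow>
    (LINT z:cell x y i j|lebesgue. g z * v z) = (\<Sum>(m, n)\<in>{..k-2} \<times> {..k-2}. C i j m n * moment g i j m n)"
proof -
  have "\<exists>C. AE z in lebesgue. z \<in> cell x y i j \<longrightarrow> v z = (\<Sum>m\<le>k-2. \<Sum>n\<le>k-2. C m n * fst z ^ m * snd z ^ n)"
    if "i < M" "j < N" for i j
  proof -
    have "cell x y i j \<in> Cells" using that by (auto simp: T_h_cells)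
    then obtain p where p: "p \<in> Q (k - 2)" "AE z in lebesgue. z \<in> cell x y i j \<longrightarrow> v z = p z"
      using v unfolding W_h_def by blast
    then show ?thesis unfolding Q_eq_Pol Pol_eq by blast
  qed
  note ex = this
  define C where "C i j = (SOME C. AE z in lebesgue. z \<in> cell x y i j \<longrightarrow>
      v z = (\<Sum>m\<le>k-2. \<Sum>n\<le>k-2. C m n * fst z ^ m * snd z ^ n))" for i j
  have C: "AE z in lebesgue. z \<in> cell x y i j \<longrightarrow> v z = (\<Sum>m\<le>k-2. \<Sum>n\<le>k-2. C i j m n * fst z ^ m * snd z ^ n)"
    if "i < M" "j < N" for i j
    unfolding C_def by (rule someI_ex[OF ex[OF that]])
  show ?thesis
  proof (intro exI[of _ C] allI impI)
    fix i j g assume ij: "i < M" "j < N" and g: "moments_exist (k - 2) g"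
    let ?I = "{..k-2} \<times> {..k-2}"
    have ae: "AE z in lebesgue. z \<in> cell x y i j \<longrightarrow>
        g z * v z = (\<Sum>q\<in>?I. C i j (fst q) (snd q) * (g z * bimonom (fst q) (snd q) z))"
      using C[OF ij]
    proof eventually_elim
      case (elim z)
      then show ?case
        by (auto simp: bimonom_def sum.cartesian_product case_prod_beta sum_distrib_left mult_ac)
    qed
    have i: "set_integrable lebesgue (cell x y i j) (\<lambda>z. g z * bimonom (fst q) (snd q) z)" if "q \<in> ?I" for q
      using g ij that by (auto simp: moments_exist_def)
    show "(LINT z:cell x y i j|lebesgue. g z * v z) = (\<Sum>(m, n)\<in>?I. C i j m n * moment g i j m n)"
      using set_integral_AE_eq(2)[OF set_integral_lincomb(1)[of ?I _ "\<lambda>q z. g z * bimonom (fst q) (snd q) z", OF _ i] ae]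
        set_integral_lincomb(2)[of ?I _ "\<lambda>q z. g z * bimonom (fst q) (snd q) z" "\<lambda>q. C i j (fst q) (snd q)", OF _ i]
      by (simp add: moment_def case_prod_beta)
  qed
qed

text \<open>One direction tests with cell monomials; the other uses that every test function is, up
  to null sets, a combination of them. The variational problem thus becomes finitely many equations
  indexed by \<open>index_set\<close>.\<close>

lemma galerkin_iff_moments:
  assumes g: "moments_exist (k - 2) g" and f: "moments_exist (k - 2) f"
  shows "(\<forall>v\<in>W_h Dom Cells k. ip Cells g v = ip Cells f v) \<longleftrightarrow>
    (\<forall>i<M. \<forall>j<N. \<forall>m\<le>k-2. \<forall>n\<le>k-2. moment g i j m n = moment f i j m n)"
proof safe
  fix i j m n assume eq: "\<forall>v\<in>W_h Dom Cells k. ip Cells g v = ip Cells f v" and A: "i < M" "j < N" "m \<le> k - 2" "n \<le> k - 2"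
  from eq test_fun_in_W_h[OF A] have "ip Cells g (test_fun i j m n) = ip Cells f (test_fun i j m n)" by blast
  then show "moment g i j m n = moment f i j m n"
    by (simp only: ip_test_fun[OF A g] ip_test_fun[OF A f])
next
  fix v assume eq: "\<forall>i<M. \<forall>j<N. \<forall>m\<le>k-2. \<forall>n\<le>k-2. moment g i j m n = moment f i j m n" and v: "v \<in> W_h Dom Cells k"
  obtain C where C: "\<And>i j g. i < M \<Longrightarrow> j < N \<Longrightarrow> moments_exist (k - 2) g \<Longrightarrow>
    (LINT z:cell x y i j|lebesgue. g z * v z) = (\<Sum>(m, n)\<in>{..k-2} \<times> {..k-2}. C i j m n * moment g i j m n)"
    using test_expand[OF v] by blast
  show "ip Cells g v = ip Cells f v"
    unfolding ip_cells by (intro sum.cong refl) (use C g f eq in \<open>auto intro!: sum.cong\<close>)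
qed

lemma data_moments_exist:
  assumes "\<forall>v\<in>W_h Dom Cells k. ip_defined Cells f v"
  shows "moments_exist (k - 2) f"
  unfolding moments_exist_def
proof (intro allI impI)
  fix i j m n assume A: "i < M" "j < N" "m \<le> k - 2" "n \<le> k - 2"
  then have "set_integrable lebesgue (cell x y i j) (\<lambda>z. f z * test_fun i j m n z)"
    using assms test_fun_in_W_h[OF A] unfolding ip_defined_def T_h_cells by blast
  moreover have "AE z in lebesgue. z \<in> cell x y i j \<longrightarrow> f z * bimonom m n z = f z * test_fun i j m n z"
    using AE_open_cell[of x y i j] by eventually_elim (auto simp: test_fun_def)
  ultimately show "set_integrable lebesgue (cell x y i j) (\<lambda>z. f z * bimonom m n z)"
    by (rule set_integral_AE_eq(1))
qed

text \<open>Edges are null sets, so the moments are ordinary integrals of continuous functions, to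
  which the polynomial calculus applies.\<close>

lemma diff_op_moments:
  assumes poly: "\<And>i j. i < M \<Longrightarrow> j < N \<Longrightarrow> polyfun (U i j)"
    and agree: "\<And>i j z. i < M \<Longrightarrow> j < N \<Longrightarrow> z \<in> cell x y i j \<Longrightarrow> u z = U i j z"
  shows "moments_exist r (diff_op \<alpha> \<beta> \<gamma> u)"
    "i < M \<Longrightarrow> j < N \<Longrightarrow> moment (diff_op \<alpha> \<beta> \<gamma> u) i j m n =
       integral (cell x y i j) (\<lambda>z. cd_op \<alpha> (fst \<beta>) (snd \<beta>) \<gamma> (U i j) z * bimonom m n z)"
proof -
  let ?L = "\<lambda>i j. cd_op \<alpha> (fst \<beta>) (snd \<beta>) \<gamma> (U i j)"
  have ae: "AE z in lebesgue. z \<in> cell x y i j \<longrightarrow> diff_op \<alpha> \<beta> \<gamma> u z * bimonom m n z = ?L i j z * bimonom m n z"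
    if ij: "i < M" "j < N" for i j m n
    using AE_open_cell[of x y i j]
  proof eventually_elim
    case (elim z)
    show ?case
    proof
      assume "z \<in> cell x y i j"
      then have zo: "z \<in> open_cell x y i j" using elim by simp
      have "diff_op \<alpha> \<beta> \<gamma> u z = ?L i j z"
        by (rule diff_op_cell[OF poly[OF ij] zo], rule agree[OF ij subsetD[OF open_cell_subset]])
      then show "diff_op \<alpha> \<beta> \<gamma> u z * bimonom m n z = ?L i j z * bimonom m n z" by simp
    qed
  qed
  have c: "continuous_on (cell x y i j) (\<lambda>z. ?L i j z * bimonom m n z)" if "i < M" "j < N" for i j m n
    using poly[OF that] by (intro continuous_on_mult cd_op_continuous bimonom_continuous)
  show "moments_exist r (diff_op \<alpha> \<beta> \<gamma> u)"
    unfolding moments_exist_def using set_integral_AE_eq(1)[OF cont_set_integrable(1)[OF c] ae] by blast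
  show "moment (diff_op \<alpha> \<beta> \<gamma> u) i j m n = integral (cell x y i j) (\<lambda>z. ?L i j z * bimonom m n z)" if "i < M" "j < N"
    unfolding moment_def
    using set_integral_AE_eq(2)[OF cont_set_integrable(1)[OF c[OF that]] ae[OF that]] cont_set_integrable(2)[OF c[OF that]]
    by simp
qed

end

lemma bimonom_orthogonal_Pol:
  assumes L: "continuous_on UNIV L" and q: "q \<in> Pol r r"
    and orth: "\<And>m n. m \<le> r \<Longrightarrow> n \<le> r \<Longrightarrow> integral (cell x y i j) (\<lambda>z. L z * bimonom m n z) = 0"
  shows "integral (cell x y i j) (\<lambda>z. L z * q z) = 0"
proof -
  obtain C where C: "q = (\<lambda>z. \<Sum>m\<le>r. \<Sum>n\<le>r. C m n * fst z ^ m * snd z ^ n)"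
    using q by (auto simp: Pol_eq)
  have int: "(\<lambda>z. L z * bimonom m n z) integrable_on cell x y i j" for m n
    unfolding cell_def by (intro cont_integrable2 continuous_on_mult L bimonom_continuous)
  have "(\<lambda>z. L z * q z) = (\<lambda>z. \<Sum>m\<le>r. \<Sum>n\<le>r. C m n * (L z * bimonom m n z))"
    by (simp add: C bimonom_def sum_distrib_left mult_ac)
  then have "integral (cell x y i j) (\<lambda>z. L z * q z) = integral (cell x y i j) (\<lambda>z. \<Sum>m\<le>r. \<Sum>n\<le>r. C m n * (L z * bimonom m n z))"
    by simp
  also have "\<dots> = (\<Sum>m\<le>r. \<Sum>n\<le>r. C m n * integral (cell x y i j) (\<lambda>z. L z * bimonom m n z))"
  proof -
    have 1: "(\<lambda>z. C m n * (L z * bimonom m n z)) integrable_on cell x y i j" for m n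
      by (intro integrable_on_mult_right int)
    have 2: "(\<lambda>z. \<Sum>n\<le>r. C m n * (L z * bimonom m n z)) integrable_on cell x y i j" for m
      by (intro integrable_sum finite_atMost 1)
    show ?thesis by (simp add: integral_sum[OF finite_atMost 2] integral_sum[OF finite_atMost 1])
  qed
  also have "\<dots> = 0" using orth by simp
  finally show ?thesis .
qed

lemma Pol_mono:
  assumes "p \<in> Pol m n" "m \<le> m'" "n \<le> n'"
  shows "p \<in> Pol m' n'"
proof -
  obtain C where C: "\<And>s t. p (s, t) = (\<Sum>i\<le>m. \<Sum>j\<le>n. C i j * s ^ i * t ^ j)"
    using assms(1) by (auto simp: Pol_def)
  have "p (s, t) = (\<Sum>i\<le>m'. \<Sum>j\<le>n'. (if i \<le> m \<and> j \<le> n then C i j else 0) * s ^ i * t ^ j)" for s t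
  proof -
    have "p (s, t) = (\<Sum>q\<in>{..m} \<times> {..n}. C (fst q) (snd q) * s ^ fst q * t ^ snd q)"
      by (simp add: C sum.cartesian_product case_prod_beta)
    also have "\<dots> = (\<Sum>q\<in>{..m'} \<times> {..n'}. (if fst q \<le> m \<and> snd q \<le> n then C (fst q) (snd q) else 0) * s ^ fst q * t ^ snd q)"
      using assms(2,3) by (intro sum.mono_neutral_cong_left) auto
    finally show ?thesis by (simp add: sum.cartesian_product case_prod_beta)
  qed
  then show ?thesis unfolding Pol_def by (intro CollectI exI allI)
qed

lemma trial_family_diff:
  assumes "trial_family a b c d M x N y U" "trial_family a b c d M x N y V"
  shows "trial_family a b c d M x N y (\<lambda>i j z. U i j z - V i j z)"
proof -
  interpret U: trial_family a b c d M x N y U by fact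
  interpret V: trial_family a b c d M x N y V by fact
  have d: "polyfun (\<lambda>z. U i j z - V i j z)" for i j
  proof -
    obtain m n m' n' where "U i j \<in> Pol m n" "V i j \<in> Pol m' n'"
      using U.poly V.poly unfolding polyfun_def by blast
    then have "U i j \<in> Pol (max m m') (max n n')" "V i j \<in> Pol (max m m') (max n n')"
      by (auto intro: Pol_mono)
    then show ?thesis using Pol_diff unfolding polyfun_def by blast
  qed
  show ?thesis
    using U.match_x V.match_x U.match_dx V.match_dx U.vanish_x V.vanish_x U.match_y V.match_y U.match_dy V.match_dy U.vanish_y V.vanish_y d
    by unfold_locales (auto simp: matches_x_def matches_y_def vanishes_x_def vanishes_y_def dx_diff dy_diff)
qed

lemma mesh_le_h_max_x:
  assumes "i < M"
  shows "x (Suc i) - x i \<le> h_max M x N y"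
proof -
  have "x (Suc i) - x (Suc i - 1) \<in> edge_lengths M x N y"
    unfolding edge_lengths_def using assms by (intro UnI1 imageI) auto
  then show ?thesis unfolding h_max_def by (intro Max_ge) (auto simp: edge_lengths_def)
qed

lemma mesh_le_h_max_y:
  assumes "j < N"
  shows "y (Suc j) - y j \<le> h_max M x N y"
proof -
  have "y (Suc j) - y (Suc j - 1) \<in> edge_lengths M x N y"
    unfolding edge_lengths_def using assms by (intro UnI2 imageI) auto
  then show ?thesis unfolding h_max_def by (intro Max_ge) (auto simp: edge_lengths_def)
qed

section \<open>Unique solvability on one mesh\<close>

context product_grid
begin

text \<open>\<open>hom\<close> is used twice: for the trivial kernel of the matrix, which yields a
  solution among the combinations of the \<open>\<Phi>\<close>, and for the difference of an
  arbitrary solution in \<open>V_h0\<close> and that one. Uniqueness thus holds in the whole space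
  without expanding its elements in the \<open>\<Phi>\<close>.\<close>

lemma unique_solvability:
  assumes k: "k \<ge> 3"
    and stab: "\<And>U. trial_family a b c d M x N y U \<Longrightarrow>
      csum (\<lambda>i j z. cd_op \<alpha> (fst \<beta>) (snd \<beta>) \<gamma> (U i j) z * dx (dx (dy (dy (U i j)))) z) = 0 \<Longrightarrow>
      (\<And>q. csum (\<lambda>i j z. cd_op \<alpha> (fst \<beta>) (snd \<beta>) \<gamma> (U i j) z * q i j) = 0) \<Longrightarrow>
      \<forall>i<M. \<forall>j<N. \<forall>s\<in>{x i..x (Suc i)}. \<forall>t\<in>{y j..y (Suc j)}. U i j (s, t) = 0"
    and f: "\<forall>v\<in>W_h Dom Cells k. ip_defined Cells f v"
  shows "\<exists>!u. u \<in> V_h0 Dom Cells k \<and> (\<forall>v\<in>W_h Dom Cells k. a_form \<alpha> \<beta> \<gamma> Cells u v = ip Cells f v)"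
proof -
  let ?r = "k - 2"
  let ?L = "cd_op \<alpha> (fst \<beta>) (snd \<beta>) \<gamma>"
  note fm = data_moments_exist[OF f]
  \<comment> \<open>Zero moments up to degree k - 2 yield both orthogonality hypotheses of
    \<open>stab\<close>, as u_xxyy and the cellwise constants have at most this degree.\<close>
  have hom: "\<forall>i<M. \<forall>j<N. \<forall>z\<in>cell x y i j. U i j z = 0"
    if tf: "trial_family a b c d M x N y U" and P: "\<And>i j. U i j \<in> Pol k k"
      and z: "\<And>i j m n. i < M \<Longrightarrow> j < N \<Longrightarrow> m \<le> ?r \<Longrightarrow> n \<le> ?r \<Longrightarrow>
        integral (cell x y i j) (\<lambda>z. ?L (U i j) z * bimonom m n z) = 0" for U
  proof -
    interpret trial_family a b c d M x N y U by fact
    have J0: "csum (\<lambda>i j z. ?L (U i j) z * q i j z) = 0" if "\<And>i j. q i j \<in> Pol ?r ?r" for q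
      unfolding cell_sum_def using bimonom_orthogonal_Pol[OF cd_op_continuous[OF poly] that z]
      by (intro sum.neutral ballI) (auto simp: cell_def)
    \<comment> \<open>Two derivatives in each variable lower both degrees from k to k - 2.\<close>
    have "dx (dx (dy (dy (U i j)))) \<in> Pol ?r ?r" for i j
      using Pol_dx[OF Pol_dx[OF Pol_dy[OF Pol_dy[OF P[of i j]]]]] by (simp add: numeral_2_eq_2)
    from J0[OF this] have "csum (\<lambda>i j z. ?L (U i j) z * dx (dx (dy (dy (U i j)))) z) = 0" .
    moreover have "csum (\<lambda>i j z. ?L (U i j) z * q i j) = 0" for q
    proof (rule J0)
      show "(\<lambda>z. q i j) \<in> Pol ?r ?r" for i j
        using Pol_cmult[OF bimonom_Pol[of 0 ?r 0], of "q i j"] by (simp add: bimonom_def)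
    qed
    ultimately have "\<forall>i<M. \<forall>j<N. \<forall>s\<in>{x i..x (Suc i)}. \<forall>t\<in>{y j..y (Suc j)}. U i j (s, t) = 0"
      by (intro stab tf) auto
    then show ?thesis by (auto simp: mem_cell)
  qed
  have sol_iff: "(\<forall>v\<in>W_h Dom Cells k. a_form \<alpha> \<beta> \<gamma> Cells u v = ip Cells f v) \<longleftrightarrow>
      (\<forall>i<M. \<forall>j<N. \<forall>m\<le>?r. \<forall>n\<le>?r. integral (cell x y i j) (\<lambda>z. ?L (U i j) z * bimonom m n z) = moment f i j m n)"
    if poly: "\<And>i j. i < M \<Longrightarrow> j < N \<Longrightarrow> polyfun (U i j)"
      and agree: "\<And>i j z. i < M \<Longrightarrow> j < N \<Longrightarrow> z \<in> cell x y i j \<Longrightarrow> u z = U i j z" for u U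
  proof -
    note dm = diff_op_moments[where U=U and u=u and \<alpha>=\<alpha> and \<beta>=\<beta> and \<gamma>=\<gamma>, OF poly agree]
    have me: "moments_exist ?r (diff_op \<alpha> \<beta> \<gamma> u)" by (rule dm(1))
    have mm: "moment (diff_op \<alpha> \<beta> \<gamma> u) i j m n = integral (cell x y i j) (\<lambda>z. ?L (U i j) z * bimonom m n z)"
      if "i < M" "j < N" for i j m n by (rule dm(2)) (use that in auto)
    show ?thesis unfolding a_form_def galerkin_iff_moments[OF me fm] using mm by simp
  qed
  have k2: "2 \<le> k" using k by simp
  define I where "I = index_set M N ?r"
  have fin: "finite I" by (simp add: I_def)
  obtain \<Phi> P where V: "\<And>e. restrict (\<lambda>z. \<Sum>\<kappa>\<in>I. e \<kappa> * \<Phi> \<kappa> z) (closure Dom) \<in> V_h0 Dom Cells k"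
    and P: "\<And>\<kappa> i j. \<kappa> \<in> I \<Longrightarrow> P \<kappa> i j \<in> Pol k k"
    and \<Phi>: "\<And>\<kappa> i j z. \<kappa> \<in> I \<Longrightarrow> i < M \<Longrightarrow> j < N \<Longrightarrow> z \<in> cell x y i j \<Longrightarrow> \<Phi> \<kappa> z = P \<kappa> i j z"
    and inj: "\<And>e \<kappa>. (\<And>z. z \<in> closure Dom \<Longrightarrow> (\<Sum>\<kappa>\<in>I. e \<kappa> * \<Phi> \<kappa> z) = 0) \<Longrightarrow> \<kappa> \<in> I \<Longrightarrow> e \<kappa> = 0"
  proof (rule trial_functions[OF k2, folded I_def], goal_cases)
    case (1 \<Phi> P)
    show ?case by (rule 1(1)[of \<Phi> P]; fact 1(2-5))
  qed
  \<comment> \<open>Rows are test monomials on cells, columns are trial functions.\<close>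
  define A where "A = (\<lambda>(i, j, m, n) \<kappa>. integral (cell x y i j) (\<lambda>z. ?L (P \<kappa> i j) z * bimonom m n z))"
  define U where "U e i j = (if i < M \<and> j < N then (\<lambda>z. \<Sum>\<kappa>\<in>I. e \<kappa> * P \<kappa> i j z) else (\<lambda>_. 0))" for e i j
  define u where "u e = restrict (\<lambda>z. \<Sum>\<kappa>\<in>I. e \<kappa> * \<Phi> \<kappa> z) (closure Dom)" for e
  have UP: "U e i j \<in> Pol k k" for e i j
    using Pol_sum[where P="\<lambda>\<kappa>. P \<kappa> i j" and r=e, OF fin P] by (simp add: U_def Pol_zero)
  then have Upoly: "polyfun (U e i j)" for e i j unfolding polyfun_def by blast
  have agree: "u e z = U e i j z" if "i < M" "j < N" "z \<in> cell x y i j" for e i j z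
    using cell_in_closure[OF that(1,2)] that \<Phi> by (auto simp: u_def U_def intro!: sum.cong)
  have uV: "u e \<in> V_h0 Dom Cells k" for e unfolding u_def by (rule V)
  have tf: "trial_family a b c d M x N y (U e)" for e
    by (rule trial_family_of_agree[OF Upoly _ agree uV]) (auto simp: U_def)
  have momU: "integral (cell x y i j) (\<lambda>z. ?L (U e i j) z * bimonom m n z) = (\<Sum>\<kappa>\<in>I. A (i, j, m, n) \<kappa> * e \<kappa>)"
    if "i < M" "j < N" for e i j m n
  proof -
    have pp: "\<And>\<kappa>. \<kappa> \<in> I \<Longrightarrow> polyfun (P \<kappa> i j)" using P unfolding polyfun_def by blast
    have int: "(\<lambda>z. ?L (P \<kappa> i j) z * bimonom m n z) integrable_on cell x y i j" if "\<kappa> \<in> I" for \<kappa>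
      unfolding cell_def using pp[OF that]
      by (intro cont_integrable2 continuous_on_mult cd_op_continuous bimonom_continuous)
    have "(\<lambda>z. ?L (U e i j) z * bimonom m n z) = (\<lambda>z. \<Sum>\<kappa>\<in>I. e \<kappa> * (?L (P \<kappa> i j) z * bimonom m n z))"
      using that by (simp add: U_def cd_op_lincomb[OF fin pp] sum_distrib_left mult_ac)
    then have "integral (cell x y i j) (\<lambda>z. ?L (U e i j) z * bimonom m n z) =
        integral (cell x y i j) (\<lambda>z. \<Sum>\<kappa>\<in>I. e \<kappa> * (?L (P \<kappa> i j) z * bimonom m n z))" by simp
    also have "\<dots> = (\<Sum>\<kappa>\<in>I. e \<kappa> * integral (cell x y i j) (\<lambda>z. ?L (P \<kappa> i j) z * bimonom m n z))"
      by (subst integral_sum[OF fin integrable_on_mult_right[OF int]]) simp_all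
    finally show ?thesis by (simp add: A_def mult.commute)
  qed
  have "\<exists>e. \<forall>\<kappa>\<in>I. (\<Sum>\<kappa>'\<in>I. A \<kappa> \<kappa>' * e \<kappa>') = (case \<kappa> of (i, j, m, n) \<Rightarrow> moment f i j m n)"
  proof (rule square_system_solvable[OF fin])
    \<comment> \<open>A kernel vector gives a trial function with zero moments; it vanishes on all
      cells, hence on the closed rectangle they cover, and independence of the \<open>\<Phi>\<close>
      makes the vector zero.\<close>
    fix e assume e: "\<forall>\<kappa>\<in>I. (\<Sum>\<kappa>'\<in>I. A \<kappa> \<kappa>' * e \<kappa>') = 0"
    have "\<forall>i<M. \<forall>j<N. \<forall>z\<in>cell x y i j. U e i j z = 0"
      by (rule hom[OF tf UP]) (use e in \<open>auto simp: momU I_def index_set_def\<close>)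
    then have "(\<Sum>\<kappa>\<in>I. e \<kappa> * \<Phi> \<kappa> z) = 0" if "z \<in> closure Dom" for z
      using cells_cover[OF that] agree[of _ _ z e] that by (auto simp: u_def)
    then show "\<forall>\<kappa>\<in>I. e \<kappa> = 0" using inj by blast
  qed
  then obtain e where e: "\<And>i j m n. (i, j, m, n) \<in> I \<Longrightarrow> (\<Sum>\<kappa>\<in>I. A (i, j, m, n) \<kappa> * e \<kappa>) = moment f i j m n"
    by fastforce
  show ?thesis
  proof (rule ex1I[of _ "u e"])
    have "\<forall>v\<in>W_h Dom Cells k. a_form \<alpha> \<beta> \<gamma> Cells (u e) v = ip Cells f v"
    proof (rule iffD2[OF sol_iff[where u="u e" and U="U e"]])
      show "\<forall>i<M. \<forall>j<N. \<forall>m\<le>?r. \<forall>n\<le>?r. integral (cell x y i j) (\<lambda>z. ?L (U e i j) z * bimonom m n z) = moment f i j m n"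
        using e by (simp add: momU I_def index_set_def)
    qed (rule Upoly, rule agree)
    then show "u e \<in> V_h0 Dom Cells k \<and> (\<forall>v\<in>W_h Dom Cells k. a_form \<alpha> \<beta> \<gamma> Cells (u e) v = ip Cells f v)"
      using uV by simp
  next
    fix w assume w: "w \<in> V_h0 Dom Cells k \<and> (\<forall>v\<in>W_h Dom Cells k. a_form \<alpha> \<beta> \<gamma> Cells w v = ip Cells f v)"
    obtain W where W: "\<And>i j. W i j \<in> Pol k k"
      "\<And>i j z. i < M \<Longrightarrow> j < N \<Longrightarrow> z \<in> cell x y i j \<Longrightarrow> w z = W i j z" "trial_family a b c d M x N y W"
      using family_exists[of w k] w by blast
    have Wp: "polyfun (W i j)" for i j using W(1) unfolding polyfun_def by blast
    have mW: "integral (cell x y i j) (\<lambda>z. ?L (W i j) z * bimonom m n z) = moment f i j m n"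
      if "i < M" "j < N" "m \<le> ?r" "n \<le> ?r" for i j m n
    proof -
      have "(\<forall>v\<in>W_h Dom Cells k. a_form \<alpha> \<beta> \<gamma> Cells w v = ip Cells f v) \<longleftrightarrow>
        (\<forall>i<M. \<forall>j<N. \<forall>m\<le>?r. \<forall>n\<le>?r. integral (cell x y i j) (\<lambda>z. ?L (W i j) z * bimonom m n z) = moment f i j m n)"
        by (rule sol_iff) (use Wp W(2) in auto)
      then show ?thesis using w that by blast
    qed
    have "\<forall>i<M. \<forall>j<N. \<forall>z\<in>cell x y i j. W i j z - U e i j z = 0"
    proof (rule hom[OF trial_family_diff[OF W(3) tf] Pol_diff[OF W(1) UP]])
      fix i j m n assume A: "i < M" "j < N" "m \<le> ?r" "n \<le> ?r"
      have int: "(\<lambda>z. ?L p z * bimonom m n z) integrable_on cell x y i j" if "polyfun p" for p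
        unfolding cell_def by (intro cont_integrable2 continuous_on_mult cd_op_continuous bimonom_continuous that)
      have "integral (cell x y i j) (\<lambda>z. ?L (U e i j) z * bimonom m n z) = moment f i j m n"
        using e A by (simp add: momU I_def index_set_def)
      then show "integral (cell x y i j) (\<lambda>z. ?L (\<lambda>z. W i j z - U e i j z) z * bimonom m n z) = 0"
        using integral_diff[OF int[OF Wp] int[OF Upoly], of i j e i j] mW[OF A]
        by (simp add: cd_op_diff[OF Wp Upoly] left_diff_distrib)
    qed
    then have "w z = u e z" if "z \<in> closure Dom" for z
      using cells_cover[OF that] agree[of _ _ z e] W(2)[of _ _ z] by fastforce
    \<comment> \<open>Both functions are \<open>undefined\<close> off the closed domain, so equality
      there is equality of functions.\<close>
    moreover have "w \<in> extensional (closure Dom)" "u e \<in> extensional (closure Dom)"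
      using w uV[of e] by (auto simp: V_h0_def V_h_def)
    ultimately show "w = u e" using extensionalityI by blast
  qed
qed

end

text \<open>The threshold is that of \<open>uniform_stability\<close>, chosen before any mesh is
  given; afterwards the argument concerns a single mesh, with \<open>h_max\<close> bounding every
  edge.\<close>

theorem theorem3p2:
  fixes a b c d \<alpha> \<gamma> C\<^sub>q :: real and \<beta> :: "real \<times> real" and k :: nat
  assumes "a < b" and "c < d" and "\<alpha> > 0" and "\<gamma> \<ge> 0" and "k \<ge> 3"
  shows "\<exists>h\<^sub>0>0. \<forall>M N x y.
           grid a b M x \<and> grid c d N y \<and>
           h_max M x N y \<le> C\<^sub>q * h_min M x N y \<and> h_max M x N y \<le> h\<^sub>0 \<longrightarrow>
           (\<forall>f. (\<forall>v \<in> W_h (Omega a b c d) (T_h M x N y) k. ip_defined (T_h M x N y) f v) \<longrightarrow>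
             (\<exists>!u. u \<in> V_h0 (Omega a b c d) (T_h M x N y) k \<and>
                (\<forall>v \<in> W_h (Omega a b c d) (T_h M x N y) k.
                   a_form \<alpha> \<beta> \<gamma> (T_h M x N y) u v = ip (T_h M x N y) f v)))"
proof -
  obtain h0 where h0: "h0 > 0" and stab: "\<And>M N x y U. trial_family a b c d M x N y U \<Longrightarrow>
    \<forall>i<M. x (Suc i) - x i \<le> h0 \<Longrightarrow> \<forall>j<N. y (Suc j) - y j \<le> h0 \<Longrightarrow>
    cell_sum x M y N (\<lambda>i j z. cd_op \<alpha> (fst \<beta>) (snd \<beta>) \<gamma> (U i j) z * dx (dx (dy (dy (U i j)))) z) = 0 \<Longrightarrow>
    \<forall>q. cell_sum x M y N (\<lambda>i j z. cd_op \<alpha> (fst \<beta>) (snd \<beta>) \<gamma> (U i j) z * q i j) = 0 \<Longrightarrow>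
    \<forall>i<M. \<forall>j<N. \<forall>s\<in>{x i..x (Suc i)}. \<forall>t\<in>{y j..y (Suc j)}. U i j (s, t) = 0"
    using uniform_stability[OF assms(1-4), of "fst \<beta>" "snd \<beta>"] by auto
  show ?thesis
  proof (intro exI[of _ h0] conjI h0 allI impI)
    fix M N x y f
    assume A: "grid a b M x \<and> grid c d N y \<and> h_max M x N y \<le> C\<^sub>q * h_min M x N y \<and> h_max M x N y \<le> h0"
      and f: "\<forall>v \<in> W_h (Omega a b c d) (T_h M x N y) k. ip_defined (T_h M x N y) f v"
    interpret product_grid a b c d M x N y using assms A by unfold_locales auto
    have h: "\<forall>i<M. x (Suc i) - x i \<le> h0" "\<forall>j<N. y (Suc j) - y j \<le> h0"
      using mesh_le_h_max_x[of _ M x N y] mesh_le_h_max_y[of _ N y M x] A by force+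
    show "\<exists>!u. u \<in> V_h0 (Omega a b c d) (T_h M x N y) k \<and>
        (\<forall>v \<in> W_h (Omega a b c d) (T_h M x N y) k. a_form \<alpha> \<beta> \<gamma> (T_h M x N y) u v = ip (T_h M x N y) f v)"
      by (rule unique_solvability[OF assms(5) stab[OF _ h] f]) auto
  qed
qed

end
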